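(* Let $k$ be a field, $q\in k^\times$ not a root of unity, and $m,n\ge2$ integers. Let $\Lambda_q(m,n)=k\langle x,y\rangle/(x^m,\,y^n,\,yx-qxy)$. Then as an algebra \[ \mathrm{HH}^*(\Lambda_q(m,n))\cong k[U]/(U^2)\times_k{\textstyle\bigwedge^*_k}(V,W), \] with $U$ in cohomological degree $0$ and $V,W$ in degree $1$, and the Gerstenhaber bracket is given by \[ [V,U]=(m-1)U,\qquad [W,U]=(n-1)U,\qquad [V,W]=0. \]
   Context: $\mathrm{HH}^*$ denotes Hochschild cohomology $\mathrm{HH}^*(\Lambda,\Lambda)$ with its cup product and Gerstenhaber bracket. The fiber product $k[U]/(U^2)\times_k\bigwedge^*_k(V,W)$ is the fiber product over $k$ of the two algebras with respect to their augmentations ($U\mapsto0$, $V,W\mapsto0$); it has basis $1,U,V,W,VW$ with $U^2=UV=UW=0$, $V^2=W^2=0$, $VW=-WV$. *)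

theory Defs
  imports Main
begin

text \<open>Lambda_q(m,n) = k<x,y>/(x^m, y^n, yx - q xy) has k-basis x^i y^j, 0 <= i < m,
  0 <= j < n, indexed by pairs (i,j).  Hochschild cochains C^d(Lambda,Lambda) are
  k-linear maps Lambda^{(tensor) d} -> Lambda, determined by their values on basis
  tuples: f bs e is the coefficient of the basis element e in f(b_1 (x) ... (x) b_d).\<close>

definition bas :: "nat \<Rightarrow> nat \<Rightarrow> (nat \<times> nat) set" where
  "bas m n = {0..<m} \<times> {0..<n}"

text \<open>Structure constants: x^i y^j * x^a y^b = q^(j a) x^(i+a) y^(j+b) (zero if out of range).\<close>
definition mc :: "nat \<Rightarrow> nat \<Rightarrow> 'k::field \<Rightarrow> nat \<times> nat \<Rightarrow> nat \<times> nat \<Rightarrow> nat \<times> nat \<Rightarrow> 'k" where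
  "mc m n q b c e =
     (if fst b + fst c < m \<and> snd b + snd c < n \<and> e = (fst b + fst c, snd b + snd c)
      then q ^ (snd b * fst c) else 0)"

type_synonym 'k cochain = "(nat \<times> nat) list \<Rightarrow> nat \<times> nat \<Rightarrow> 'k"

definition zero_cochain :: "'k::field cochain" where
  "zero_cochain = (\<lambda>as e. 0)"

definition is_cochain :: "nat \<Rightarrow> nat \<Rightarrow> nat \<Rightarrow> 'k::field cochain \<Rightarrow> bool" where
  "is_cochain m n d f \<longleftrightarrow>
     (\<forall>bs e. f bs e \<noteq> 0 \<longrightarrow> length bs = d \<and> set bs \<subseteq> bas m n \<and> e \<in> bas m n)"

definition wf_args :: "nat \<Rightarrow> nat \<Rightarrow> nat \<Rightarrow> (nat \<times> nat) list \<Rightarrow> nat \<times> nat \<Rightarrow> bool" where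
  "wf_args m n d as e \<longleftrightarrow> length as = d \<and> set as \<subseteq> bas m n \<and> e \<in> bas m n"

definition hdiff :: "nat \<Rightarrow> nat \<Rightarrow> 'k::field \<Rightarrow> nat \<Rightarrow> 'k cochain \<Rightarrow> 'k cochain" where
  "hdiff m n q d f = (\<lambda>as e. if wf_args m n (Suc d) as e then
      (\<Sum>c\<in>bas m n. mc m n q (hd as) c e * f (tl as) c)
    + (\<Sum>i\<in>{1..d}. (-1) ^ i *
         (\<Sum>g\<in>bas m n. mc m n q (as ! (i - 1)) (as ! i) g * f (take (i - 1) as @ g # drop (i + 1) as) e))
    + (-1) ^ Suc d * (\<Sum>c\<in>bas m n. f (butlast as) c * mc m n q c (last as) e)
    else 0)"

definition cocycle :: "nat \<Rightarrow> nat \<Rightarrow> 'k::field \<Rightarrow> nat \<Rightarrow> 'k cochain \<Rightarrow> bool" where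
  "cocycle m n q d f \<longleftrightarrow> is_cochain m n d f \<and> hdiff m n q d f = zero_cochain"

definition coboundary :: "nat \<Rightarrow> nat \<Rightarrow> 'k::field \<Rightarrow> nat \<Rightarrow> 'k cochain \<Rightarrow> bool" where
  "coboundary m n q d f \<longleftrightarrow>
     (case d of 0 \<Rightarrow> f = zero_cochain
      | Suc d' \<Rightarrow> (\<exists>h. is_cochain m n d' h \<and> f = hdiff m n q d' h))"

definition cohom :: "nat \<Rightarrow> nat \<Rightarrow> 'k::field \<Rightarrow> nat \<Rightarrow> 'k cochain \<Rightarrow> 'k cochain \<Rightarrow> bool" where
  "cohom m n q d f g \<longleftrightarrow> coboundary m n q d (\<lambda>as e. f as e - g as e)"

definition lincomb :: "(nat \<Rightarrow> 'k::field) \<Rightarrow> 'k cochain list \<Rightarrow> 'k cochain" where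
  "lincomb a cs = (\<lambda>as e. \<Sum>i<length cs. a i * (cs ! i) as e)"

definition smul_cochain :: "'k::field \<Rightarrow> 'k cochain \<Rightarrow> 'k cochain" where
  "smul_cochain c f = (\<lambda>as e. c * f as e)"

definition hh_basis :: "nat \<Rightarrow> nat \<Rightarrow> 'k::field \<Rightarrow> nat \<Rightarrow> 'k cochain list \<Rightarrow> bool" where
  "hh_basis m n q d cs \<longleftrightarrow>
     (\<forall>c\<in>set cs. cocycle m n q d c)
   \<and> (\<forall>a. coboundary m n q d (lincomb a cs) \<longrightarrow> (\<forall>i<length cs. a i = 0))
   \<and> (\<forall>z. cocycle m n q d z \<longrightarrow> (\<exists>a. cohom m n q d z (lincomb a cs)))"

definition one_cochain :: "'k::field cochain" where
  "one_cochain = (\<lambda>as e. if as = [] \<and> e = (0, 0) then 1 else 0)"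

definition cup :: "nat \<Rightarrow> nat \<Rightarrow> 'k::field \<Rightarrow> nat \<Rightarrow> nat \<Rightarrow> 'k cochain \<Rightarrow> 'k cochain \<Rightarrow> 'k cochain" where
  "cup m n q p r f g = (\<lambda>as e. if wf_args m n (p + r) as e then
      (\<Sum>b\<in>bas m n. \<Sum>c\<in>bas m n. f (take p as) b * g (drop p as) c * mc m n q b c e)
    else 0)"

text \<open>Gerstenhaber circle products: f o_i g (1 <= i <= p), f o g = sum_i (-1)^((i-1)(r-1)) f o_i g.
  (The parity of (i-1)(r-1) equals that of (i-1)(r+1); the latter avoids truncated subtraction.)\<close>
definition circ_i :: "nat \<Rightarrow> nat \<Rightarrow> nat \<Rightarrow> nat \<Rightarrow> 'k::field cochain \<Rightarrow> 'k cochain \<Rightarrow> 'k cochain" where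
  "circ_i m n r i f g = (\<lambda>as e.
      \<Sum>c\<in>bas m n. g (take r (drop (i - 1) as)) c * f (take (i - 1) as @ c # drop (i - 1 + r) as) e)"

definition gcirc :: "nat \<Rightarrow> nat \<Rightarrow> nat \<Rightarrow> nat \<Rightarrow> 'k::field cochain \<Rightarrow> 'k cochain \<Rightarrow> 'k cochain" where
  "gcirc m n p r f g = (\<lambda>as e. if p \<ge> 1 \<and> wf_args m n (p + r - 1) as e then
      (\<Sum>i\<in>{1..p}. (-1) ^ ((i - 1) * (r + 1)) * circ_i m n r i f g as e)
    else 0)"

text \<open>Gerstenhaber bracket [f,g] = f o g - (-1)^((p-1)(r-1)) g o f, for f in C^p, g in C^r.\<close>
definition gbracket :: "nat \<Rightarrow> nat \<Rightarrow> nat \<Rightarrow> nat \<Rightarrow> 'k::field cochain \<Rightarrow> 'k cochain \<Rightarrow> 'k cochain" where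
  "gbracket m n p r f g = (\<lambda>as e.
      gcirc m n p r f g as e - (-1) ^ ((p + 1) * (r + 1)) * gcirc m n r p g f as e)"

end

theory Submission
  imports Defs "HOL-Library.Product_Plus"
begin

declare split_paired_All [simp del] split_paired_Ex [simp del]

text \<open>After rescaling by powers of \<open>q\<close>, the part of the Hochschild complex of weight \<open>(s, t)\<close> becomes the
  corresponding part of the complex of the commutative algebra \<open>k[x, y]/(x^m, y^n)\<close> with coefficients
  twisted by the automorphism \<open>x \<mapsto> q^t x\<close>, \<open>y \<mapsto> q^(-s) y\<close>. Filter it by the degree of the output. The layers
  are the Ext complexes of the simple module, whose cohomology is found by dimension shifting along
  \<open>0 \<rightarrow> x^p M \<rightarrow> M \<rightarrow> M/x^p M \<rightarrow> 0\<close> and is spanned by one explicit class for each pair \<open>(i, j)\<close>. Those classes extend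
  to cochains closed under the differential up to the scalars \<open>1 - q^t\<close> and \<open>1 + q^t + \<dots> + q^((m-1)t)\<close> (and the
  analogous ones in \<open>y\<close>), so every cocycle is cohomologous to a combination of them, and what remains is
  a complex of dimension at most four. As \<open>q\<close> is not a root of unity, it is exact unless the weight is zero, where
  its differential vanishes and it gives \<open>1, V, W, VW\<close>, or the weight is \<open>(m - 1, n - 1)\<close>, which gives \<open>U\<close>.\<close>

text \<open>The cohomology is defined by the bar complex, which is far larger than the minimal
  bimodule resolution; a full comparison would need maps both ways and a homotopy. Only one
  direction is made explicit here: a cochain for each generator of the minimal resolution. That
  these cochains suffice is checked on the layers, where the twist is invisible: the last face
  survives there only for the letter \<open>1\<close>, on which every character is 1. One Ext
  computation thus serves all weights, and \<open>q\<close> enters only through the scalars of the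
  small complex. A layer class extends to a cochain in many ways. The choice is made so that the
  differential is exactly a combination of the chosen cochains, without error terms in other layers;
  this is the origin of the quantum integers. It also replaces a spectral sequence by correction of
  one layer at a time. The bound four arises because a generator matters in a given weight only if
  its internal degree lies in a window of width \<open>m\<close> in \<open>x\<close> and
  \<open>n\<close> in \<open>y\<close>, and each window meets at most two consecutive
  generators.\<close>

section \<open>The bar differential on words of monomials\<close>

text \<open>The inner faces of the bar differential, with the first merge counted positively:
  merging the letters number \<open>k\<close> and \<open>k + 1\<close> carries the sign \<open>(-1) ^ (k - 1)\<close>. A merge that leaves \<open>A\<close>
  is a product equal to zero.\<close>

fun merge_sum :: "(nat \<times> nat) set \<Rightarrow> ((nat \<times> nat) list \<Rightarrow> 'k::field) \<Rightarrow> (nat \<times> nat) list \<Rightarrow> 'k" where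
  "merge_sum A f (a # b # l) = (if a + b \<in> A then f ((a + b) # l) else 0) - merge_sum A (\<lambda>l. f (a # l)) (b # l)"
| "merge_sum A f [a] = 0"
| "merge_sum A f [] = 0"

lemma merge_sum_cong:
  assumes "\<And>w'. Suc (length w') = length w \<Longrightarrow> set w' \<subseteq> A \<Longrightarrow> sum_list w' = sum_list w \<Longrightarrow> f w' = g w'"
    and "set w \<subseteq> A"
  shows "merge_sum A f w = merge_sum A g w"
  using assms
proof (induction A f w arbitrary: g rule: merge_sum.induct)
  case (1 A f a b l)
  have "merge_sum A (\<lambda>l. f (a # l)) (b # l) = merge_sum A (\<lambda>l. g (a # l)) (b # l)"
    by (rule 1(1)) (use 1(2,3) in auto)
  moreover have "a + b \<in> A \<Longrightarrow> f ((a + b) # l) = g ((a + b) # l)"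
    using 1(3) by (intro 1(2)) (auto simp: add.assoc)
  ultimately show ?case by simp
qed auto

lemma merge_sum_add: "merge_sum A (\<lambda>l. f l + g l) w = merge_sum A f w + merge_sum A g w"
  by (induction A f w arbitrary: g rule: merge_sum.induct) auto

lemma merge_sum_cmult: "merge_sum A (\<lambda>l. c * f l) w = c * merge_sum A f w"
  by (induction A f w rule: merge_sum.induct) (auto simp: algebra_simps)

lemma merge_sum_zero [simp]: "merge_sum A (\<lambda>l. 0) w = 0"
  by (induction A "\<lambda>l::(nat\<times>nat) list. 0::'a" w rule: merge_sum.induct) auto

lemma merge_sum_diff: "merge_sum A (\<lambda>l. f l - g l) w = merge_sum A f w - merge_sum A g w"
  using merge_sum_add[of A f "\<lambda>l. (-1) * g l" w] merge_sum_cmult[of A "-1" g w] by simp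

lemma merge_sum_minus: "merge_sum A (\<lambda>l. - g l) w = - merge_sum A g w"
  using merge_sum_cmult[of A "-1" g w] by simp

lemma merge_sum_snoc:
  "merge_sum A f (l @ [a, b]) = merge_sum A (\<lambda>l. f (l @ [b])) (l @ [a])
     + (-1) ^ length l * (if a + b \<in> A then f (l @ [a + b]) else 0)"
proof (induction l arbitrary: f)
  case Nil
  then show ?case by simp
next
  case (Cons c l)
  then show ?case using Cons[of "\<lambda>l. f (c # l)"] by (cases l) (auto simp: algebra_simps)
qed

lemma merge_sum_cong_length:
  assumes "\<And>w'. Suc (length w') = length w \<Longrightarrow> f w' = g w'"
  shows "merge_sum A f w = merge_sum A g w"
  using assms
proof (induction A f w arbitrary: g rule: merge_sum.induct)
  case (1 A f a b l)
  have "merge_sum A (\<lambda>l. f (a # l)) (b # l) = merge_sum A (\<lambda>l. g (a # l)) (b # l)"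
    by (rule 1(1)) (use 1(2) in auto)
  moreover have "f ((a + b) # l) = g ((a + b) # l)"
    by (intro 1(2)) auto
  ultimately show ?case by simp
qed auto

text \<open>Splitting off the first letter writes \<open>merge_sum\<close> as one merge minus
  \<open>merge_sum\<close> of the tail. The square of the second part vanishes by induction, and the
  mixed terms cancel up to the two bracketings of \<open>a + b + c\<close>. These agree because
  \<open>A\<close> is closed under factors: if the triple sum lies in \<open>A\<close>, so do the
  partial sums.\<close>

lemma merge_sum_merge_sum:
  assumes dc: "\<And>a b. a + b \<in> A \<Longrightarrow> a \<in> A"
  shows "merge_sum A (merge_sum A f) w = 0"
proof (induction w arbitrary: f)
  case (Cons a w)
  have dc': "a + b \<in> A \<Longrightarrow> b \<in> A" for a b
    using dc[of b a] by (simp add: add.commute)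
  show ?case
  proof (cases w)
    case (Cons b w')
    note w = this
    show ?thesis
    proof (cases w')
      case (Cons c l)
      define F where "F l' = (if a + hd l' \<in> A then f ((a + hd l') # tl l') else 0)" for l'
      have "merge_sum A (\<lambda>l'. merge_sum A f (a # l')) w = merge_sum A (\<lambda>l'. F l' - merge_sum A (\<lambda>l. f (a # l)) l') w"
        by (rule merge_sum_cong_length) (auto simp: F_def w Cons length_Suc_conv)
      also have "\<dots> = merge_sum A F w"
        by (simp add: merge_sum_diff Cons.IH)
      also have "\<dots> = (if b + c \<in> A \<and> a + (b + c) \<in> A then f ((a + (b + c)) # l) else 0)
          - (if a + b \<in> A then merge_sum A (\<lambda>l'. f ((a + b) # l')) (c # l) else 0)"
        by (simp add: w Cons F_def)
      finally have "merge_sum A (\<lambda>l'. merge_sum A f (a # l')) (b # c # l) = \<dots>"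
        by (simp add: w Cons)
      then show ?thesis
        using dc[of "a + b" c] dc'[of a "b + c"] by (auto simp: w Cons add.assoc)
    qed (auto simp: w)
  qed auto
qed auto

text \<open>A cochain \<open>\<phi> e w\<close> has an extra monomial \<open>e\<close> from a down-closed set \<open>R\<close>, the basis of a cyclic
  monomial module. Two instances matter. For \<open>R = A\<close> and a bicharacter \<open>\<rho>\<close> this is the part of the Hochschild
  complex of a fixed weight: \<open>e\<close> is the complement of the output monomial, so that the exterior faces
  raise \<open>e\<close> and \<open>e + sum_list w\<close> is constant. For \<open>\<rho>\<close> the augmentation, where the last face only sees the
  letter \<open>1\<close>, it computes the Ext groups of the module with values in the ground field.\<close>

definition cdiff :: "(nat \<times> nat) set \<Rightarrow> (nat \<times> nat) set \<Rightarrow> (nat \<times> nat \<Rightarrow> 'k::field)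
    \<Rightarrow> (nat \<times> nat \<Rightarrow> (nat \<times> nat) list \<Rightarrow> 'k) \<Rightarrow> nat \<times> nat \<Rightarrow> (nat \<times> nat) list \<Rightarrow> 'k" where
  "cdiff A R \<rho> \<phi> e w = (if w = [] then 0 else
      (if e + hd w \<in> R then \<phi> (e + hd w) (tl w) else 0) - merge_sum A (\<phi> e) w
    + (-1) ^ length w * \<rho> (last w) * (if e + last w \<in> R then \<phi> (e + last w) (butlast w) else 0))"

lemma cdiff_Nil [simp]: "cdiff A R \<rho> \<phi> e [] = 0"
  by (simp add: cdiff_def)

lemma cdiff_add: "cdiff A R \<rho> (\<lambda>e w. \<phi> e w + \<psi> e w) e w = cdiff A R \<rho> \<phi> e w + cdiff A R \<rho> \<psi> e w"
  by (auto simp: cdiff_def merge_sum_add algebra_simps)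

lemma cdiff_cmult: "cdiff A R \<rho> (\<lambda>e w. c * \<phi> e w) e w = c * cdiff A R \<rho> \<phi> e w"
  by (auto simp: cdiff_def merge_sum_cmult algebra_simps)

lemma cdiff_zero [simp]: "cdiff A R \<rho> (\<lambda>e w. 0) e w = 0"
  by (auto simp: cdiff_def)

lemma cdiff_diff: "cdiff A R \<rho> (\<lambda>e w. \<phi> e w - \<psi> e w) e w = cdiff A R \<rho> \<phi> e w - cdiff A R \<rho> \<psi> e w"
  by (auto simp: cdiff_def merge_sum_diff algebra_simps)

lemma cdiff_sum: "cdiff A R \<rho> (\<lambda>e w. \<Sum>i\<in>I. \<phi> i e w) e w = (\<Sum>i\<in>I. cdiff A R \<rho> (\<phi> i) e w)"
  by (induction I rule: infinite_finite_induct) (auto simp: cdiff_add)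

definition downset :: "(nat \<times> nat) set \<Rightarrow> bool" where
  "downset R \<longleftrightarrow> (\<forall>a b. a + b \<in> R \<longrightarrow> a \<in> R)"

definition mult_char :: "(nat \<times> nat \<Rightarrow> 'k::field) \<Rightarrow> bool" where
  "mult_char \<rho> \<longleftrightarrow> (\<forall>a b. \<rho> (a + b) = \<rho> a * \<rho> b)"

lemma downsetD: "downset R \<Longrightarrow> a + b \<in> R \<Longrightarrow> a \<in> R"
  unfolding downset_def by blast

lemma downsetD': "downset R \<Longrightarrow> a + b \<in> R \<Longrightarrow> b \<in> R"
  by (metis add.commute downsetD)

lemma cdiff_cdiff:
  assumes A: "downset A" and R: "downset R" "R \<subseteq> A" and \<rho>: "mult_char \<rho>"
  shows "cdiff A R \<rho> (cdiff A R \<rho> \<phi>) e w = 0"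
proof (cases "length w < 2")
  case True
  then consider "w = []" | a where "w = [a]"
    by (cases w rule: list.exhaust; cases "tl w") auto
  then show ?thesis by cases (auto simp: cdiff_def)
next
  case False
  \<comment> \<open>\<open>L\<close> and \<open>P\<close> are the outer faces without sign. The
    simplicial identities become one identity for each pair among \<open>L\<close>, \<open>P\<close>
    and \<open>merge_sum\<close>.\<close>
  define L where "L \<phi> e w = (if e + hd w \<in> R then \<phi> (e + hd w) (tl w) else (0::'a))"
    for \<phi> :: "nat \<times> nat \<Rightarrow> (nat \<times> nat) list \<Rightarrow> 'a" and e w
  define P where "P \<phi> e w = \<rho> (last w) * (if e + last w \<in> R then \<phi> (e + last w) (butlast w) else (0::'a))"
    for \<phi> :: "nat \<times> nat \<Rightarrow> (nat \<times> nat) list \<Rightarrow> 'a" and e w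
  have cdiff: "cdiff A R \<rho> \<phi> e w = L \<phi> e w - merge_sum A (\<phi> e) w + (-1) ^ length w * P \<phi> e w"
    if "w \<noteq> []" for \<phi> :: "nat \<times> nat \<Rightarrow> (nat \<times> nat) list \<Rightarrow> 'a" and e w
    using that by (simp add: cdiff_def L_def P_def)
  obtain a b l where w: "w = a # b # l"
    using False by (cases w; cases "tl w") auto
  obtain l' c d where w': "w = l' @ [c, d]"
    using False by (cases w rule: rev_cases; cases "butlast w" rule: rev_cases) auto
  obtain N where N: "length w = Suc (Suc N)" and Nl': "length l' = N"
    using w' by simp
  \<comment> \<open>Two first faces equal one first face after merging the first two letters. No
    term is lost to \<open>A\<close>: if \<open>e + a + b\<close> lies in \<open>R\<close>, then
    \<open>a + b\<close> lies in \<open>R\<close>, hence in \<open>A\<close>.\<close>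
  have LL: "L (L \<phi>) e w = L (\<lambda>e. merge_sum A (\<phi> e)) e w + merge_sum A (L \<phi> e) w"
    using downsetD[OF R(1), of "e + a" b] downsetD'[OF R(1), of e "a + b"] R(2)
    by (auto simp: L_def w add.assoc)
  have LP: "L (P \<phi>) e w = P (L \<phi>) e w"
  proof -
    define z where "z = last (b # l)"
    have "last w = z" "last (tl w) = z" "hd w = a" "hd (butlast w) = a" "tl (butlast w) = butlast (tl w)"
      by (auto simp: w z_def)
    then show ?thesis
      using downsetD[OF R(1), of "e + a" z] downsetD[OF R(1), of "e + z" a]
      unfolding L_def P_def by (auto simp: add_ac)
  qed
  have \<rho>cd: "\<rho> (c + d) = \<rho> c * \<rho> d"
    using \<rho> unfolding mult_char_def by blast
  have BP: "merge_sum A (P \<phi> e) w = P (\<lambda>e. merge_sum A (\<phi> e)) e w + (-1) ^ N * P (P \<phi>) e w"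
    using downsetD[OF R(1), of "e + d" c] downsetD'[OF R(1), of e "c + d"] R(2)
    by (auto simp: P_def w' merge_sum_snoc merge_sum_cmult Nl' butlast_append \<rho>cd add_ac mult_ac)
  have "cdiff A R \<rho> (cdiff A R \<rho> \<phi>) e w = L (cdiff A R \<rho> \<phi>) e w - merge_sum A (cdiff A R \<rho> \<phi> e) w
      + (-1) ^ length w * P (cdiff A R \<rho> \<phi>) e w"
    using w by (intro cdiff) auto
  moreover have "L (cdiff A R \<rho> \<phi>) e w = L (L \<phi>) e w - L (\<lambda>e. merge_sum A (\<phi> e)) e w
      + (-1) ^ Suc N * L (P \<phi>) e w"
    using N by (auto simp: L_def[of "cdiff A R \<rho> \<phi>"] w cdiff) (auto simp: L_def w)
  moreover have "P (cdiff A R \<rho> \<phi>) e w = P (L \<phi>) e w - P (\<lambda>e. merge_sum A (\<phi> e)) e w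
      + (-1) ^ Suc N * P (P \<phi>) e w"
    using Nl' by (auto simp: P_def[of "cdiff A R \<rho> \<phi>"] w' butlast_append cdiff) (auto simp: P_def w' butlast_append algebra_simps)
  moreover have "merge_sum A (cdiff A R \<rho> \<phi> e) w = merge_sum A (L \<phi> e) w - merge_sum A (merge_sum A (\<phi> e)) w
      + (-1) ^ Suc N * merge_sum A (P \<phi> e) w"
  proof -
    have "merge_sum A (cdiff A R \<rho> \<phi> e) w = merge_sum A (\<lambda>w. L \<phi> e w - merge_sum A (\<phi> e) w + (-1) ^ Suc N * P \<phi> e w) w"
    proof (rule merge_sum_cong_length)
      fix w' :: "(nat \<times> nat) list" assume "Suc (length w') = length w"
      then have "w' \<noteq> []" "length w' = Suc N" using N by auto
      then show "cdiff A R \<rho> \<phi> e w' = L \<phi> e w' - merge_sum A (\<phi> e) w' + (-1) ^ Suc N * P \<phi> e w'"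
        using cdiff[of w' \<phi> e] by simp
    qed
    then show ?thesis
      by (simp only: merge_sum_add merge_sum_diff merge_sum_cmult)
  qed
  moreover have "merge_sum A (merge_sum A (\<phi> e)) w = 0"
    by (rule merge_sum_merge_sum) (use A downsetD in blast)
  moreover have "(-1) ^ N * ((-1) ^ N * x) = x" for x :: 'a
    by (simp flip: mult.assoc power_add)
  ultimately show ?thesis
    by (simp add: LL LP BP N algebra_simps)
qed

section \<open>Dimension shifting\<close>

definition aug :: "nat \<times> nat \<Rightarrow> 'k::field" where
  "aug w = (if w = 0 then 1 else 0)"

lemma pair_add_eq_0: "a + b = 0 \<longleftrightarrow> a = 0 \<and> b = 0" for a b :: "nat \<times> nat"
  by (cases a; cases b) (auto simp: zero_prod_def)

lemma mult_char_aug: "mult_char aug"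
  unfolding mult_char_def aug_def using pair_add_eq_0 by auto

text \<open>Every face keeps \<open>e + sum_list w\<close> fixed, so the complex splits by
  \<open>T\<close>. Statements are made on one summand; values of a cochain elsewhere are
  arbitrary.\<close>

definition cell :: "(nat \<times> nat) set \<Rightarrow> (nat \<times> nat) set \<Rightarrow> nat \<times> nat \<Rightarrow> nat \<Rightarrow> nat \<times> nat \<Rightarrow> (nat \<times> nat) list \<Rightarrow> bool" where
  "cell A R T d e w \<longleftrightarrow> e \<in> R \<and> length w = d \<and> set w \<subseteq> A \<and> e + sum_list w = T"

lemma sum_list_butlast: "w \<noteq> [] \<Longrightarrow> sum_list (butlast w) + last w = (sum_list w :: nat \<times> nat)"
  by (induction w rule: rev_induct) auto

lemma cdiff_cong:
  assumes "\<And>e' w'. e' \<in> R \<Longrightarrow> Suc (length w') = length w \<Longrightarrow> set w' \<subseteq> A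
      \<Longrightarrow> e' + sum_list w' = e + sum_list w \<Longrightarrow> \<phi> e' w' = \<psi> e' w'"
    and "e \<in> R" "set w \<subseteq> A"
  shows "cdiff A R \<rho> \<phi> e w = cdiff A R \<rho> \<psi> e w"
proof (cases "w = []")
  case False
  have "merge_sum A (\<phi> e) w = merge_sum A (\<psi> e) w"
    by (rule merge_sum_cong) (use assms in auto)
  moreover have "\<phi> (e + hd w) (tl w) = \<psi> (e + hd w) (tl w)" if "e + hd w \<in> R"
    using that assms(3) False by (intro assms(1)) (auto simp: add.assoc neq_Nil_conv)
  moreover have "\<phi> (e + last w) (butlast w) = \<psi> (e + last w) (butlast w)" if "e + last w \<in> R"
    using that assms(3) False sum_list_butlast[OF False]
    by (intro assms(1)) (auto simp: add_ac dest: in_set_butlastD)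
  ultimately show ?thesis using False by (simp add: cdiff_def)
qed simp

lemma cdiff_cell_cong:
  assumes "\<And>e' w'. cell A R T d e' w' \<Longrightarrow> \<phi> e' w' = \<psi> e' w'" and "cell A R T (Suc d) e w"
  shows "cdiff A R \<rho> \<phi> e w = cdiff A R \<rho> \<psi> e w"
  using assms by (intro cdiff_cong) (auto simp: cell_def)

definition aug_cocycle where
  "aug_cocycle A R d T \<phi> \<longleftrightarrow> (\<forall>e w. cell A R T (Suc d) e w \<longrightarrow> cdiff A R aug \<phi> e w = 0)"

text \<open>Cohomology of dimension at most one in this degree. With \<open>\<theta>\<close> zero it
  expresses vanishing, the form in which acyclic modules enter.\<close>

definition spanned where
  "spanned A d R T \<theta> \<longleftrightarrow> (\<forall>\<phi>. aug_cocycle A R d T \<phi> \<longrightarrow>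
     (\<exists>a \<psi>. \<forall>e w. cell A R T d e w \<longrightarrow> \<phi> e w = a * \<theta> e w + cdiff A R aug \<psi> e w))"

definition nontriv where
  "nontriv A d R T \<theta> \<longleftrightarrow> aug_cocycle A R d T \<theta> \<and>
     (\<forall>b \<psi>. (\<forall>e w. cell A R T d e w \<longrightarrow> b * \<theta> e w = cdiff A R aug \<psi> e w) \<longrightarrow> b = 0)"

text \<open>\<open>R1\<close> is a quotient module of \<open>Rb\<close> and \<open>R2\<close>, moved by \<open>c\<close>, is the kernel. When \<open>Rb\<close> has no cohomology,
  the connecting map \<open>connecting\<close> raises the degree by one.\<close>

locale cut =
  fixes A Rb R1 R2 :: "(nat \<times> nat) set" and c :: "nat \<times> nat"
  assumes dA: "downset A" and dRb: "downset Rb" and RbA: "Rb \<subseteq> A"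
    and dR1: "downset R1" and R1Rb: "R1 \<subseteq> Rb"
    and cut1: "\<And>e. e \<in> Rb \<Longrightarrow> e \<notin> R1 \<Longrightarrow> \<exists>e'\<in>R2. e = e' + c"
    and cut2: "\<And>e. e \<in> R2 \<Longrightarrow> e + c \<in> Rb"
    and cut3: "\<And>e. e \<in> R2 \<Longrightarrow> e + c \<notin> R1"
begin

definition inflate :: "(nat \<times> nat \<Rightarrow> (nat \<times> nat) list \<Rightarrow> 'k::field) \<Rightarrow> nat \<times> nat \<Rightarrow> (nat \<times> nat) list \<Rightarrow> 'k" where
  "inflate \<phi> e w = (if e \<in> R1 then \<phi> e w else 0)"

definition extend :: "(nat \<times> nat \<Rightarrow> (nat \<times> nat) list \<Rightarrow> 'k::field) \<Rightarrow> nat \<times> nat \<Rightarrow> (nat \<times> nat) list \<Rightarrow> 'k" where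
  "extend \<theta> e w = (if e \<in> R1 then 0 else \<theta> (e - c) w)"

text \<open>The snake construction: lift a cochain of the kernel to \<open>Rb\<close> by zero and
  differentiate. For a cocycle of the kernel the result vanishes off \<open>R1\<close>, so it comes
  from the quotient.\<close>

definition connecting :: "(nat \<times> nat \<Rightarrow> (nat \<times> nat) list \<Rightarrow> 'k::field) \<Rightarrow> nat \<times> nat \<Rightarrow> (nat \<times> nat) list \<Rightarrow> 'k" where
  "connecting \<theta> = cdiff A Rb aug (extend \<theta>)"

lemma R2_iff:
  assumes e: "e \<in> R2"
  shows "e + x \<in> R2 \<longleftrightarrow> e + c + x \<in> Rb"
proof
  assume "e + x \<in> R2"
  then show "e + c + x \<in> Rb" using cut2[of "e + x"] by (simp add: ac_simps)
next
  assume *: "e + c + x \<in> Rb"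
  have "e + c + x \<notin> R1" using cut3[OF e] downsetD[OF dR1] by blast
  then obtain e' where "e' \<in> R2" "e + c + x = e' + c" using cut1[OF *] by blast
  moreover from this have "e + x + c = e' + c" by (simp add: ac_simps)
  ultimately show "e + x \<in> R2" using add_right_imp_eq by blast
qed

lemma notin_R1: "e \<notin> R1 \<Longrightarrow> e + x \<notin> R1"
  using downsetD[OF dR1] by blast

lemma cdiff_inflate_in:
  assumes "e \<in> R1"
  shows "cdiff A Rb \<rho> (inflate \<phi>) e w = cdiff A R1 \<rho> \<phi> e w"
proof -
  have "inflate \<phi> e = \<phi> e" using assms by (auto simp: inflate_def)
  then show ?thesis using R1Rb unfolding cdiff_def by (auto simp: inflate_def)
qed

lemma cdiff_inflate_out:
  assumes "e \<notin> R1"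
  shows "cdiff A Rb \<rho> (inflate \<phi>) e w = 0"
proof -
  have "inflate \<phi> e = (\<lambda>w. 0)" using assms by (auto simp: inflate_def)
  then show ?thesis using assms notin_R1 unfolding cdiff_def by (auto simp: inflate_def)
qed

lemma cdiff_res:
  assumes "e \<in> R2"
  shows "cdiff A R2 \<rho> (\<lambda>e. \<psi> (e + c)) e w = cdiff A Rb \<rho> \<psi> (e + c) w"
proof -
  have "e + x + c = e + c + x" for x by (simp add: ac_simps)
  then show ?thesis by (simp only: cdiff_def R2_iff[OF assms])
qed

lemma extend_res: "e \<in> R2 \<Longrightarrow> extend \<theta> (e + c) w = \<theta> e w"
  using cut3 by (auto simp: extend_def)

lemma cdiff_extend:
  assumes "e \<in> R2" "set w \<subseteq> A"
  shows "cdiff A Rb \<rho> (extend \<theta>) (e + c) w = cdiff A R2 \<rho> \<theta> e w"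
  unfolding cdiff_res[OF assms(1), symmetric]
  by (rule cdiff_cong) (use assms extend_res in auto)

lemma cell_shift: "cell A R2 T d e w \<Longrightarrow> cell A Rb (T + c) d (e + c) w"
  using cut2[of e] by (simp add: cell_def ac_simps)

lemma cell_R1: "cell A R1 T d e w \<Longrightarrow> cell A Rb T d e w"
  using R1Rb by (auto simp: cell_def)

lemma cell_cases:
  assumes "cell A Rb (T + c) d e w"
  obtains "cell A R1 (T + c) d e w" "e \<in> R1"
  | e' where "e = e' + c" "cell A R2 T d e' w" "e \<notin> R1"
proof (cases "e \<in> R1")
  case True
  then show thesis using assms that(1) by (simp add: cell_def)
next
  case False
  then obtain e' where e': "e' \<in> R2" "e = e' + c" using cut1[of e] assms by (auto simp: cell_def)
  have "(e' + sum_list w) + c = T + c" using assms e' by (simp add: cell_def ac_simps)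
  then have "e' + sum_list w = T" by (rule add_right_imp_eq)
  then show thesis using that(2)[of e'] assms False e' by (simp add: cell_def)
qed

lemma cdiff_cdiff_Rb: "cdiff A Rb aug (cdiff A Rb aug \<phi>) e w = 0"
  by (rule cdiff_cdiff[OF dA dRb RbA mult_char_aug])

text \<open>Surjectivity of the connecting map. A cocycle of the quotient bounds after inflation;
  its primitive restricts to a cocycle of the kernel, which is a multiple of \<open>\<theta>\<close>
  up to a coboundary.\<close>

lemma spanned_shift:
  assumes "spanned A (Suc d) Rb (T + c) (\<lambda>_ _. 0 :: 'k::field)" and "spanned A d R2 T \<theta>"
  shows "spanned A (Suc d) R1 (T + c) (connecting \<theta> :: _ \<Rightarrow> _ \<Rightarrow> 'k)"
  unfolding spanned_def
proof (intro allI impI)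
  fix \<phi> :: "nat \<times> nat \<Rightarrow> (nat \<times> nat) list \<Rightarrow> 'k"
  assume \<phi>: "aug_cocycle A R1 (Suc d) (T + c) \<phi>"
  have "aug_cocycle A Rb (Suc d) (T + c) (inflate \<phi>)"
    unfolding aug_cocycle_def
  proof (intro allI impI)
    fix e w assume g: "cell A Rb (T + c) (Suc (Suc d)) e w"
    show "cdiff A Rb aug (inflate \<phi>) e w = 0"
      using g by (rule cell_cases) (use \<phi> in \<open>auto simp: cdiff_inflate_in cdiff_inflate_out aug_cocycle_def\<close>)
  qed
  then obtain \<psi> where \<psi>: "\<And>e w. cell A Rb (T + c) (Suc d) e w \<Longrightarrow> inflate \<phi> e w = cdiff A Rb aug \<psi> e w"
    using assms(1) unfolding spanned_def by fastforce
  have "aug_cocycle A R2 d T (\<lambda>e. \<psi> (e + c))"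
    unfolding aug_cocycle_def
  proof (intro allI impI)
    fix e w assume g: "cell A R2 T (Suc d) e w"
    then have e: "e \<in> R2" by (simp add: cell_def)
    show "cdiff A R2 aug (\<lambda>e. \<psi> (e + c)) e w = 0"
      using \<psi>[OF cell_shift[OF g]] cut3[OF e] by (simp add: cdiff_res[OF e] inflate_def)
  qed
  then obtain a \<eta> where a\<eta>: "\<And>e w. cell A R2 T d e w \<Longrightarrow> \<psi> (e + c) w = a * \<theta> e w + cdiff A R2 aug \<eta> e w"
    using assms(2) unfolding spanned_def by blast
  \<comment> \<open>This corrected primitive vanishes on the kernel, hence is inflated from the
    quotient. Subtracting a coboundary leaves its differential unchanged.\<close>
  define \<psi>2 where "\<psi>2 e w = \<psi> e w - a * extend \<theta> e w - cdiff A Rb aug (extend \<eta>) e w" for e w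
  have \<psi>2: "inflate \<psi>2 e w = \<psi>2 e w" if "cell A Rb (T + c) d e w" for e w
    using that
  proof (cases rule: cell_cases)
    case (2 e')
    then have "e' \<in> R2" "set w \<subseteq> A" by (auto simp: cell_def)
    then show ?thesis using 2
      by (simp add: inflate_def \<psi>2_def extend_res cdiff_extend a\<eta>)
  qed (auto simp: inflate_def)
  have "\<phi> e w = a * connecting \<theta> e w + cdiff A R1 aug \<psi>2 e w" if g: "cell A R1 (T + c) (Suc d) e w" for e w
  proof -
    have e: "e \<in> R1" using g by (simp add: cell_def)
    have "cdiff A R1 aug \<psi>2 e w = cdiff A Rb aug (inflate \<psi>2) e w"
      by (simp add: cdiff_inflate_in e)
    also have "\<dots> = cdiff A Rb aug \<psi>2 e w"
      by (rule cdiff_cell_cong[OF \<psi>2 cell_R1[OF g]])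
    also have "\<dots> = inflate \<phi> e w - a * connecting \<theta> e w"
      unfolding \<psi>2_def cdiff_diff cdiff_cmult cdiff_cdiff_Rb connecting_def \<psi>[OF cell_R1[OF g]] by simp
    finally show ?thesis using e by (simp add: inflate_def)
  qed
  then show "\<exists>a \<psi>. \<forall>e w. cell A R1 (T + c) (Suc d) e w \<longrightarrow> \<phi> e w = a * connecting \<theta> e w + cdiff A R1 aug \<psi> e w"
    by blast
qed

text \<open>Injectivity of the connecting map. If a multiple of \<open>connecting \<theta>\<close>
  bounds on the quotient, the same multiple of \<open>extend \<theta>\<close> minus the inflated
  primitive is a cocycle of \<open>Rb\<close>. It bounds, and restriction to the kernel shows that
  this multiple of \<open>\<theta>\<close> bounds too.\<close>

lemma nontriv_shift:
  assumes spanned: "spanned A d Rb (T + c) (\<lambda>_ _. 0 :: 'k::field)" and nontriv: "nontriv A d R2 T \<theta>"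
  shows "nontriv A (Suc d) R1 (T + c) (connecting \<theta> :: _ \<Rightarrow> _ \<Rightarrow> 'k)"
  unfolding nontriv_def
proof (intro conjI allI impI)
  have co: "cdiff A Rb aug (extend \<theta>) e w = 0" if "cell A Rb (T + c) (Suc d) e w" "e \<notin> R1" for e w
    using that(1)
  proof (cases rule: cell_cases)
    case (2 e')
    then have "e' \<in> R2" "set w \<subseteq> A" by (auto simp: cell_def)
    then show ?thesis using 2 nontriv by (simp add: cdiff_extend nontriv_def aug_cocycle_def)
  qed (use that in simp)
  show "aug_cocycle A R1 (Suc d) (T + c) (connecting \<theta>)"
    unfolding aug_cocycle_def
  proof (intro allI impI)
    fix e w assume g: "cell A R1 (T + c) (Suc (Suc d)) e w"
    then have e: "e \<in> R1" by (simp add: cell_def)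
    have "cdiff A R1 aug (connecting \<theta>) e w = cdiff A Rb aug (inflate (connecting \<theta>)) e w"
      by (simp add: cdiff_inflate_in e)
    also have "\<dots> = cdiff A Rb aug (cdiff A Rb aug (extend \<theta>)) e w"
      by (rule cdiff_cell_cong[OF _ cell_R1[OF g]]) (auto simp: inflate_def connecting_def co)
    also have "\<dots> = 0" by (rule cdiff_cdiff_Rb)
    finally show "cdiff A R1 aug (connecting \<theta>) e w = 0" .
  qed
  fix b \<psi>
  assume b: "\<forall>e w. cell A R1 (T + c) (Suc d) e w \<longrightarrow> b * connecting \<theta> e w = cdiff A R1 aug \<psi> e w"
  have "aug_cocycle A Rb d (T + c) (\<lambda>e w. b * extend \<theta> e w - inflate \<psi> e w)"
    unfolding aug_cocycle_def cdiff_diff cdiff_cmult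
  proof (intro allI impI)
    fix e w assume g: "cell A Rb (T + c) (Suc d) e w"
    then show "b * cdiff A Rb aug (extend \<theta>) e w - cdiff A Rb aug (inflate \<psi>) e w = 0"
      using b co[OF g] by (cases rule: cell_cases) (auto simp: cdiff_inflate_in cdiff_inflate_out connecting_def)
  qed
  then obtain \<eta> where \<eta>: "\<And>e w. cell A Rb (T + c) d e w \<Longrightarrow> b * extend \<theta> e w - inflate \<psi> e w = cdiff A Rb aug \<eta> e w"
    using spanned unfolding spanned_def by fastforce
  have "b * \<theta> e w = cdiff A R2 aug (\<lambda>e. \<eta> (e + c)) e w" if g: "cell A R2 T d e w" for e w
  proof -
    have e: "e \<in> R2" using g by (simp add: cell_def)
    show ?thesis using \<eta>[OF cell_shift[OF g]] cut3[OF e]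
      by (simp add: cdiff_res[OF e] extend_res[OF e] inflate_def)
  qed
  then show "b = 0" using nontriv unfolding nontriv_def by blast
qed

end

text \<open>In degree \<open>T\<close> only the part of \<open>R\<close> below \<open>T\<close> is
  seen, so for small \<open>T\<close> a truncated module may be exchanged for the full one.\<close>

lemma cell_same:
  assumes "\<And>e f. e + f = T \<Longrightarrow> e \<in> R \<longleftrightarrow> e \<in> R'"
  shows "cell A R T d e w \<longleftrightarrow> cell A R' T d e w"
  using assms unfolding cell_def by blast

lemma cdiff_same:
  assumes "\<And>e f. e + f = T \<Longrightarrow> e \<in> R \<longleftrightarrow> e \<in> R'" and "cell A R T d e w"
  shows "cdiff A R \<rho> \<phi> e w = cdiff A R' \<rho> \<phi> e w"
proof (cases "w = []")
  case False
  have "e + hd w + sum_list (tl w) = T"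
    using assms(2) False by (cases w) (auto simp: cell_def add_ac)
  moreover have "e + last w + sum_list (butlast w) = T"
    using assms(2) sum_list_butlast[OF False] by (auto simp: cell_def add_ac)
  ultimately have "e + hd w \<in> R \<longleftrightarrow> e + hd w \<in> R'" "e + last w \<in> R \<longleftrightarrow> e + last w \<in> R'"
    using assms(1) by blast+
  then show ?thesis by (simp add: cdiff_def)
qed simp

lemma spanned_same:
  assumes R: "\<And>e f. e + f = T \<Longrightarrow> e \<in> R \<longleftrightarrow> e \<in> R'"
  shows "spanned A d R T \<theta> \<longleftrightarrow> spanned A d R' T \<theta>"
proof -
  have g: "cell A R T d e w \<longleftrightarrow> cell A R' T d e w" for d e w
    by (rule cell_same) (rule R)
  have D: "cdiff A R aug \<phi> e w = cdiff A R' aug \<phi> e w" if "cell A R' T d e w" for \<phi> d e w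
    by (rule cdiff_same[of T, OF R]) (use that g in auto)
  show ?thesis
    unfolding spanned_def aug_cocycle_def g by (simp add: D)
qed

lemma nontriv_same:
  assumes R: "\<And>e f. e + f = T \<Longrightarrow> e \<in> R \<longleftrightarrow> e \<in> R'"
  shows "nontriv A d R T \<theta> \<longleftrightarrow> nontriv A d R' T \<theta>"
proof -
  have g: "cell A R T d e w \<longleftrightarrow> cell A R' T d e w" for d e w
    by (rule cell_same) (rule R)
  have D: "cdiff A R aug \<phi> e w = cdiff A R' aug \<phi> e w" if "cell A R' T d e w" for \<phi> d e w
    by (rule cdiff_same[of T, OF R]) (use that g in auto)
  show ?thesis
    unfolding nontriv_def aug_cocycle_def g by (simp add: D)
qed

lemma spanned_cong:
  assumes "\<And>e w. cell A R T d e w \<Longrightarrow> \<theta> e w = \<theta>' e w"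
  shows "spanned A d R T \<theta> \<longleftrightarrow> spanned A d R T \<theta>'"
  unfolding spanned_def using assms by (simp cong: conj_cong)

lemma nontriv_cong:
  assumes "\<And>e w. cell A R T d e w \<Longrightarrow> \<theta> e w = \<theta>' e w"
  shows "nontriv A d R T \<theta> \<longleftrightarrow> nontriv A d R T \<theta>'"
proof -
  have "cdiff A R aug \<theta> e w = cdiff A R aug \<theta>' e w" if "cell A R T (Suc d) e w" for e w
    by (rule cdiff_cell_cong[OF assms that])
  then show ?thesis
    unfolding nontriv_def aug_cocycle_def using assms by simp
qed

lemma spanned_vacuous:
  assumes "\<And>e w. \<not> cell A R T d e w"
  shows "spanned A d R T \<theta>"
  unfolding spanned_def using assms by simp

section \<open>Cochains from the periodic resolution of a truncated polynomial algebra\<close>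

definition qint :: "'k::field \<Rightarrow> nat \<Rightarrow> 'k" where
  "qint \<zeta> k = (\<Sum>j<k. \<zeta> ^ j)"

lemma qint_simps [simp]: "qint \<zeta> 0 = 0" "qint \<zeta> (Suc 0) = 1"
  by (simp_all add: qint_def)

lemma qint_1 [simp]: "qint 1 k = of_nat k"
  by (simp add: qint_def)

lemma qint_geom: "(1 - \<zeta>) * qint \<zeta> k = 1 - \<zeta> ^ k"
  unfolding qint_def by (rule one_diff_power_eq[symmetric])

lemma qint_add: "qint \<zeta> (a + b) = qint \<zeta> a + \<zeta> ^ a * qint \<zeta> b"
  unfolding qint_def by (induction b) (auto simp: algebra_simps power_add)

text \<open>\<open>res_deg M i\<close> is the internal degree of the generator in degree \<open>i\<close> of the 2-periodic minimal resolution of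
  \<open>k[x]/(x^M)\<close>, and \<open>res_coeff\<close> the coefficient of its differential, twisted by the automorphism that scales \<open>x\<close>.\<close>

fun res_deg :: "nat \<Rightarrow> nat \<Rightarrow> nat" where
  "res_deg M 0 = 0"
| "res_deg M (Suc 0) = 1"
| "res_deg M (Suc (Suc i)) = res_deg M i + M"

definition res_coeff :: "'k::field \<Rightarrow> nat \<Rightarrow> nat \<Rightarrow> 'k" where
  "res_coeff \<zeta> M i = (if even i then 1 - \<zeta> else qint \<zeta> M)"

text \<open>The pull-back of the generator in degree \<open>i\<close> along the comparison map from the bar resolution: each pair
  of letters contributes the carry of their sum, a single remaining letter its quantum integer, and \<open>H\<close> takes
  the rest of the word. Applied once in each direction it gives the generators in two variables.\<close>

fun periodic :: "(nat \<times> nat \<Rightarrow> nat) \<Rightarrow> 'k::field \<Rightarrow> nat \<Rightarrow> nat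
    \<Rightarrow> ((nat \<times> nat) list \<Rightarrow> 'k) \<Rightarrow> (nat \<times> nat) list \<Rightarrow> 'k" where
  "periodic pr \<zeta> M 0 H w = H w"
| "periodic pr \<zeta> M (Suc 0) H (a # w) = qint \<zeta> (pr a) * H w"
| "periodic pr \<zeta> M (Suc (Suc i)) H (a # b # w) = (if M \<le> pr a + pr b then periodic pr \<zeta> M i H w else 0)"
| "periodic pr \<zeta> M i H w = 0"

definition word_diff where
  "word_diff A \<chi> \<phi> w = (if w = [] then 0 else
     \<phi> (tl w) - merge_sum A \<phi> w + (-1) ^ length w * \<chi> (last w) * \<phi> (butlast w))"

lemma word_diff_Cons: "word_diff A \<chi> \<phi> (a # w) = \<phi> w - merge_sum A \<phi> (a # w)
   + (-1) ^ Suc (length w) * \<chi> (last (a # w)) * \<phi> (butlast (a # w))"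
  by (simp add: word_diff_def)

lemma periodic_Nil: "H [] = 0 \<Longrightarrow> periodic pr \<zeta> M i H [] = 0"
  by (cases "(pr, \<zeta>, M, i, H, [] :: (nat \<times> nat) list)" rule: periodic.cases) auto

lemma periodic_Nil_Suc [simp]: "periodic pr \<zeta> M (Suc i) H [] = 0"
  by (cases i) auto

lemma periodic_cmult: "periodic pr \<zeta> M i (\<lambda>w. c * H w) w = c * periodic pr \<zeta> M i H w"
  by (induction pr \<zeta> M i H w rule: periodic.induct) auto

lemma periodic_zero [simp]: "periodic pr \<zeta> M i (\<lambda>w. 0) = (\<lambda>w. 0)"
  using periodic_cmult[of pr \<zeta> M i 0 "\<lambda>_. 0"] by (intro ext) simp

locale coord =
  fixes pr pr' :: "nat \<times> nat \<Rightarrow> nat" and M M' :: nat and A :: "(nat \<times> nat) set"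
  assumes pr_add [simp]: "pr (a + b) = pr a + pr b" and pr'_add [simp]: "pr' (a + b) = pr' a + pr' b"
    and pr_0 [simp]: "pr 0 = 0" and pr'_0 [simp]: "pr' 0 = 0"
    and A_iff: "a \<in> A \<longleftrightarrow> pr a < M \<and> pr' a < M'"
    and M2: "2 \<le> M"
begin

text \<open>A carry uses up degree at least \<open>M\<close> and a nonzero quantum integer at least
  1, which adds up to the internal degree of the generator.\<close>

lemma periodic_support:
  assumes H: "\<And>w. H w \<noteq> 0 \<Longrightarrow> L \<le> pr' (sum_list w)" and "periodic pr \<zeta> M i H w \<noteq> 0"
  shows "res_deg M i \<le> pr (sum_list w)" "L \<le> pr' (sum_list w)"
proof -
  have "res_deg M i \<le> pr (sum_list w) \<and> L \<le> pr' (sum_list w)"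
    using assms(2)
  proof (induction i arbitrary: w rule: induct_nat_012)
    case 0
    then show ?case using H by auto
  next
    case 1
    then obtain a v where w: "w = a # v" by (cases w) auto
    then have "pr a \<noteq> 0" "H v \<noteq> 0" using 1 by (auto intro: ccontr)
    then show ?case using H[of v] by (auto simp: w trans_le_add2)
  next
    case (ge2 i)
    then obtain a b v where w: "w = a # b # v"
      by (cases w; cases "tl w") auto
    then show ?case using ge2 by (fastforce split: if_splits simp: w)
  qed
  then show "res_deg M i \<le> pr (sum_list w)" "L \<le> pr' (sum_list w)" by auto
qed

text \<open>One direction of a double complex: \<open>H\<close> is the generator in the other
  variable and \<open>H'\<close> its own differential. The assumption on \<open>H\<close> is the
  case \<open>i = 0\<close>; there \<open>(1 - \<zeta>) * qint \<zeta> k\<close> is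
  \<open>1 - \<zeta> ^ k\<close>, the mismatch of the outer faces under the twist. The word stays
  below the degree of generator \<open>i + 2\<close> in this direction and cannot overflow in the
  other.\<close>

lemma periodic_word_diff:
  assumes HD: "\<And>w. set w \<subseteq> A \<Longrightarrow> pr (sum_list w) < M \<Longrightarrow> pr' (sum_list w) < M' + L \<Longrightarrow>
        w \<noteq> [] \<Longrightarrow> word_diff A \<chi> H w = (1 - \<zeta>) * qint \<zeta> (pr (hd w)) * H (tl w) + H' w"
    and H'0: "H' [] = 0"
    and H: "\<And>w. H w \<noteq> 0 \<Longrightarrow> L \<le> pr' (sum_list w)"
    and w: "set w \<subseteq> A" "pr (sum_list w) < res_deg M i + M" "pr' (sum_list w) < M' + L"
  shows "word_diff A \<chi> (periodic pr \<zeta> M i H) w = res_coeff \<zeta> M i * periodic pr \<zeta> M (Suc i) H w + (-1) ^ i * periodic pr \<zeta> M i H' w"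
  using w
proof (induction i arbitrary: w rule: induct_nat_012)
  case 0
  then show ?case
    by (cases w) (auto simp: HD res_coeff_def word_diff_def[of _ _ _ "[]"] H'0)
next
  case 1
  show ?case
  proof (cases w)
    case Nil
    then show ?thesis by (simp add: word_diff_def)
  next
    case (Cons a v)
    note w1 = this
    show ?thesis
    proof (cases v)
      case Nil
      then show ?thesis by (simp add: w1 word_diff_def H'0)
    next
      case (Cons b r)
      note w = w1 Cons
      have ab: "pr a < M" "pr b < M" "pr' a < M'" "pr' b < M'"
        using 1(1) w A_iff by auto
      have X1: "periodic pr \<zeta> M (Suc 0) H = (\<lambda>v. if v = [] then 0 else qint \<zeta> (pr (hd v)) * H (tl v))"
      proof
        fix v show "periodic pr \<zeta> M (Suc 0) H v = (if v = [] then 0 else qint \<zeta> (pr (hd v)) * H (tl v))"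
          by (cases v) auto
      qed
      have d: "word_diff A \<chi> (periodic pr \<zeta> M (Suc 0) H) w = qint \<zeta> (pr b) * H r
         - (if a + b \<in> A then qint \<zeta> (pr a + pr b) * H r else 0)
         + qint \<zeta> (pr a) * H r - qint \<zeta> (pr a) * word_diff A \<chi> H (b # r)"
        by (cases r; simp add: w word_diff_Cons merge_sum_cmult; simp add: algebra_simps)
      \<comment> \<open>Since \<open>H\<close> consumes at least \<open>L\<close> of the degree in
        \<open>pr'\<close>, the letters \<open>a\<close> and \<open>b\<close> cannot overflow
        there.\<close>
      have ok: "a + b \<in> A \<longleftrightarrow> pr a + pr b < M" if "H r \<noteq> 0"
      proof -
        have "pr' a + pr' b < M'"
          using 1(3) H[OF that] by (simp add: w)
        then show ?thesis by (simp add: A_iff)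
      qed
      \<comment> \<open>The whole word may have degree \<open>M\<close>. A first letter of positive
        exponent brings the tail below \<open>M\<close>, as needed for the assumption on
        \<open>H\<close>; for exponent 0 the quantum integer kills both sides.\<close>
      have d': "qint \<zeta> (pr a) * word_diff A \<chi> H (b # r) = qint \<zeta> (pr a) * ((1 - \<zeta>) * qint \<zeta> (pr b) * H r + H' (b # r))"
      proof (cases "pr a = 0")
        case False
        then have "word_diff A \<chi> H (b # r) = (1 - \<zeta>) * qint \<zeta> (pr b) * H r + H' (b # r)"
          using HD[of "b # r"] 1 by (auto simp: w)
        then show ?thesis by simp
      qed simp
      \<comment> \<open>The subtracted product is
        \<open>(1 - \<zeta> ^ pr a) * qint \<zeta> (pr b)\<close>, so the twist turns a plain sum
        into the addition rule for quantum integers.\<close>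
      have q: "qint \<zeta> (pr b) + qint \<zeta> (pr a) - qint \<zeta> (pr a) * ((1 - \<zeta>) * qint \<zeta> (pr b)) = qint \<zeta> (pr a + pr b)"
      proof -
        have "qint \<zeta> (pr a) * ((1 - \<zeta>) * qint \<zeta> (pr b)) = ((1 - \<zeta>) * qint \<zeta> (pr a)) * qint \<zeta> (pr b)"
          by simp
        then show ?thesis unfolding qint_geom qint_add by (simp add: algebra_simps)
      qed
      have "word_diff A \<chi> (periodic pr \<zeta> M (Suc 0) H) w
        = (qint \<zeta> (pr b) + qint \<zeta> (pr a) - qint \<zeta> (pr a) * ((1 - \<zeta>) * qint \<zeta> (pr b))) * H r
          - (if a + b \<in> A then qint \<zeta> (pr a + pr b) * H r else 0) - qint \<zeta> (pr a) * H' (b # r)"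
        unfolding d d' by (simp add: algebra_simps)
      also have "\<dots> = (if a + b \<in> A then 0 else qint \<zeta> (pr a + pr b) * H r) - qint \<zeta> (pr a) * H' (b # r)"
        unfolding q by simp
      also have "(if a + b \<in> A then 0 else qint \<zeta> (pr a + pr b) * H r)
          = res_coeff \<zeta> M 1 * periodic pr \<zeta> M 2 H w"
      proof (cases "H r = 0")
        case False
        \<comment> \<open>A merge that leaves \<open>A\<close> therefore has exponent exactly
          \<open>M\<close>; this is where the coefficient \<open>qint \<zeta> M\<close>
          arises.\<close>
        have "pr a + pr b \<le> M" using 1 by (simp add: w)
        then show ?thesis using ok[OF False] by (auto simp: w res_coeff_def numeral_2_eq_2)
      qed (auto simp: w numeral_2_eq_2)
      finally show ?thesis by (simp add: w numeral_2_eq_2)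
    qed
  qed
next
  case (ge2 i)
  show ?case
  proof (cases "length w < 3")
    case True
    then consider "w = []" | a where "w = [a]" | a b where "w = [a, b]"
      by (cases w; cases "tl w"; cases "tl (tl w)") auto
    then show ?thesis
      by cases (auto simp: word_diff_def periodic_Nil[of H', OF H'0])
  next
    case False
    then obtain a b c r where w: "w = a # b # c # r"
      by (cases w; cases "tl w"; cases "tl (tl w)") auto
    have abc: "pr a < M" "pr b < M" "pr c < M"
      using ge2(3) w A_iff by auto
    define B where "B = merge_sum A (periodic pr \<zeta> M i H) (c # r)"
    define x where "x = periodic pr \<zeta> M i H r"
    \<comment> \<open>The first four terms are the coboundary of the carry function, which is a
      2-cocycle; they cancel. The fourth of them compensates for the first face contained in the
      last term.\<close>
    have "word_diff A \<chi> (periodic pr \<zeta> M (Suc (Suc i)) H) w =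
       (if M \<le> pr b + pr c then x else 0)
       - (if a + b \<in> A \<and> M \<le> pr a + pr b + pr c then x else 0)
       + (if b + c \<in> A \<and> M \<le> pr a + pr b + pr c then x else 0)
       - (if M \<le> pr a + pr b then x else 0)
       + (if M \<le> pr a + pr b then word_diff A \<chi> (periodic pr \<zeta> M i H) (c # r) else 0)"
      by (cases r) (auto simp: w word_diff_Cons x_def add.assoc merge_sum_minus)
    moreover have "a + b \<in> A \<longleftrightarrow> pr a + pr b < M" "b + c \<in> A \<longleftrightarrow> pr b + pr c < M" if "x \<noteq> 0"
    proof -
      have "L \<le> pr' (sum_list r)"
        by (rule periodic_support(2)[where i = i and \<zeta> = \<zeta>, OF H]) (use that in \<open>auto simp: x_def\<close>)
      then have "pr' a + pr' b < M'" "pr' b + pr' c < M'"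
        using ge2(5) by (simp_all add: w)
      then show "a + b \<in> A \<longleftrightarrow> pr a + pr b < M" "b + c \<in> A \<longleftrightarrow> pr b + pr c < M"
        by (simp_all add: A_iff)
    qed
    ultimately have "word_diff A \<chi> (periodic pr \<zeta> M (Suc (Suc i)) H) w =
       (if M \<le> pr a + pr b then word_diff A \<chi> (periodic pr \<zeta> M i H) (c # r) else 0)"
      using abc by (cases "x = 0") auto
    also have "\<dots> = res_coeff \<zeta> M (Suc (Suc i)) * periodic pr \<zeta> M (Suc (Suc (Suc i))) H w
        + (-1) ^ (Suc (Suc i)) * periodic pr \<zeta> M (Suc (Suc i)) H' w"
      using ge2(1)[of "c # r"] ge2(3-5) by (auto simp: w res_coeff_def)
    finally show ?thesis .
  qed
qed

end

section \<open>Ext groups of the simple module\<close>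

text \<open>At \<open>e\<close> in \<open>R1\<close> the extension by zero vanishes, which removes
  the inner faces. The last face goes too: the augmentation admits only the letter \<open>1\<close>,
  which does not move \<open>e\<close>. Only the first face remains.\<close>

lemma (in cut) connecting_hit:
  assumes "e \<in> R1" "w \<noteq> []" "e + hd w = e' + c" "e' \<in> R2"
  shows "connecting \<theta> e w = \<theta> e' (tl w)"
proof -
  have "extend \<theta> e = (\<lambda>w. 0)" using assms by (auto simp: extend_def)
  moreover have "e' + c \<in> Rb" using cut2 assms by simp
  ultimately show ?thesis
    using assms extend_res[OF assms(4), of \<theta>] by (simp add: connecting_def cdiff_def aug_def)
qed

lemma (in cut) connecting_miss:
  assumes "e \<in> R1" "e + hd w \<notin> Rb \<or> e + hd w \<in> R1"
  shows "connecting \<theta> e w = 0"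
proof -
  have "extend \<theta> e = (\<lambda>w. 0)" using assms by (auto simp: extend_def)
  then show ?thesis
    using assms by (auto simp: connecting_def cdiff_def aug_def extend_def)
qed

text \<open>Cuts are made along \<open>pr\<close>, while \<open>N'\<close> bounds the other exponent
  and stays fixed. The \<open>y\<close>-direction comes first, with \<open>N'\<close> equal to
  \<open>m\<close>, and then the \<open>x\<close>-direction, with \<open>N'\<close> equal to
  1.\<close>

locale direction = coord +
  fixes N' :: nat
  assumes pr_inj: "pr a = pr b \<Longrightarrow> pr' a = pr' b \<Longrightarrow> a = b"
    and ex: "\<exists>e. pr e = i \<and> pr' e = j"
    and N': "1 \<le> N'" "N' \<le> M'"
begin

definition slab where "slab p = {e. pr e < p \<and> pr' e < N'}"

definition axis where "axis p = (SOME e. pr e = p \<and> pr' e = 0)"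

lemma axis [simp]: "pr (axis p) = p" "pr' (axis p) = 0"
  using someI_ex[OF ex[of p 0]] by (auto simp: axis_def)

lemma split_axis:
  assumes "p \<le> pr T"
  obtains T' where "T = T' + axis p" "pr T' = pr T - p" "pr' T' = pr' T"
proof -
  obtain T' where "pr T' = pr T - p" "pr' T' = pr' T" using ex by blast
  then show thesis using that[of T'] assms pr_inj[of T "T' + axis p"] by simp
qed

lemma cutI:
  assumes "0 < p" "p < M"
  shows "cut A (slab M) (slab p) (slab (M - p)) (axis p)"
proof
  fix e assume "e \<in> slab M" "e \<notin> slab p"
  then have "p \<le> pr e" by (auto simp: slab_def)
  then obtain e' where "e = e' + axis p" "pr e' = pr e - p" "pr' e' = pr' e" by (rule split_axis)
  then show "\<exists>e'\<in>slab (M - p). e = e' + axis p"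
    using \<open>e \<in> slab M\<close> \<open>p \<le> pr e\<close> by (intro bexI[of _ e']) (auto simp: slab_def)
qed (use assms N' in \<open>auto simp: slab_def downset_def A_iff\<close>)

lemma cell_pr: "cell A R T d e w \<Longrightarrow> pr e + pr (sum_list w) = pr T \<and> pr' e + pr' (sum_list w) = pr' T"
  by (auto simp: cell_def)

lemma slab_same:
  assumes "pr T < p" "p \<le> M" and "e + f = T"
  shows "e \<in> slab p \<longleftrightarrow> e \<in> slab M"
  using assms by (auto simp: slab_def)

lemma spanned_slab_same: "pr T < p \<Longrightarrow> p \<le> M \<Longrightarrow> spanned A d (slab p) T \<theta> \<longleftrightarrow> spanned A d (slab M) T \<theta>"
  by (rule spanned_same) (rule slab_same)

lemma nontriv_slab_same: "pr T < p \<Longrightarrow> p \<le> M \<Longrightarrow> nontriv A d (slab p) T \<theta> \<longleftrightarrow> nontriv A d (slab M) T \<theta>"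
  by (rule nontriv_same) (rule slab_same)

text \<open>The abstract \<open>Q\<close> lets \<open>spanned\<close> and \<open>nontriv\<close>
  share one induction. The cuts at 1 and at \<open>M - 1\<close> lead from \<open>slab 1\<close>
  back to \<open>slab 1\<close>, which is the period 2 of the resolution. On the relevant cells the
  composed connecting maps are literally \<open>periodic\<close>, so the abstract class is an
  explicit cochain.\<close>

lemma periodic_shift_induct:
  fixes Q :: "nat \<Rightarrow> (nat \<times> nat) set \<Rightarrow> nat \<times> nat \<Rightarrow> (nat \<times> nat \<Rightarrow> (nat \<times> nat) list \<Rightarrow> 'k::field) \<Rightarrow> bool"
  assumes Q_shift: "\<And>p d T \<theta>. 0 < p \<Longrightarrow> p < M \<Longrightarrow> Q d (slab (M - p)) T \<theta>
        \<Longrightarrow> Q (Suc d) (slab p) (T + axis p) (cut.connecting A (slab M) (slab p) (axis p) \<theta>)"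
    and Q_same: "\<And>p d T \<theta>. pr T < p \<Longrightarrow> p \<le> M \<Longrightarrow> Q d (slab M) T \<theta> \<Longrightarrow> Q d (slab p) T \<theta>"
    and Q_cong: "\<And>d R T \<theta> \<theta>'. (\<And>e w. cell A R T d e w \<Longrightarrow> \<theta> e w = \<theta>' e w) \<Longrightarrow> Q d R T \<theta> \<Longrightarrow> Q d R T \<theta>'"
    and base: "\<And>T0. pr T0 = 0 \<Longrightarrow> pr' T0 = v \<Longrightarrow> Q d (slab M) T0 (\<lambda>_. H)"
    and H: "\<And>w. H w \<noteq> 0 \<Longrightarrow> v \<le> pr' (sum_list w)"
    and T: "pr T = res_deg M i" "pr' T = v"
  shows "Q (i + d) (slab 1) T (\<lambda>_. periodic pr \<zeta> M i H)"
  using T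
proof (induction i arbitrary: T rule: induct_nat_012)
  case 0
  have "(periodic pr \<zeta> M 0 H) = H" by (rule ext) simp
  moreover have "Q d (slab 1) T (\<lambda>_. H)"
    by (rule Q_same[OF _ _ base]) (use 0 M2 in auto)
  ultimately show ?case by simp
next
  case 1
  interpret c: cut A "slab M" "slab 1" "slab (M - 1)" "axis 1"
    by (rule cutI) (use M2 in auto)
  obtain T0 where T0: "T = T0 + axis 1" "pr T0 = pr T - 1" "pr' T0 = pr' T"
    by (rule split_axis[of 1 T]) (use 1 in auto)
  have "Q d (slab (M - 1)) T0 (\<lambda>_. H)"
    by (rule Q_same[OF _ _ base]) (use T0 1 M2 in auto)
  then have "Q (Suc d) (slab 1) T (c.connecting (\<lambda>_. H))"
    unfolding T0(1) by (intro Q_shift) (use M2 in auto)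
  then have "Q (Suc d) (slab 1) T (\<lambda>_. periodic pr \<zeta> M (Suc 0) H)"
  proof (rule Q_cong[rotated])
    fix e w assume g: "cell A (slab 1) T (Suc d) e w"
    then obtain a r where w: "w = a # r" by (cases w) (auto simp: cell_def)
    have e: "e \<in> slab 1" using g by (simp add: cell_def)
    note gp = cell_pr[OF g]
    show "c.connecting (\<lambda>_. H) e w = periodic pr \<zeta> M (Suc 0) H w"
    proof (cases "H r = 0")
      case True
      show ?thesis
      proof (cases "e + a \<in> slab M \<and> e + a \<notin> slab 1")
        case t: True
        then obtain e' where "e' \<in> slab (M - 1)" "e + a = e' + axis 1" using c.cut1 by blast
        then show ?thesis using c.connecting_hit[OF e, of w e' "\<lambda>_. H"] True by (simp add: w)
      qed (use c.connecting_miss[OF e, of w] True in \<open>auto simp: w\<close>)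
    next
      case False
      have z: "pr' e = 0" "pr' a = 0" using H[OF False] gp 1 by (auto simp: w)
      have pe: "pr e = 0" using e by (simp add: slab_def)
      have "pr a \<le> 1" using gp 1 pe by (simp add: w)
      then consider "pr a = 0" | "pr a = 1" by linarith
      then show ?thesis
      proof cases
        case 1
        then have "e + a \<in> slab 1" using z pe N' by (simp add: slab_def)
        then show ?thesis using c.connecting_miss[OF e, of w] 1 by (simp add: w)
      next
        case 2
        then have "e + a \<in> slab M" "e + a \<notin> slab 1" using z pe N' M2 by (simp_all add: slab_def)
        then obtain e' where "e' \<in> slab (M - 1)" "e + a = e' + axis 1" using c.cut1 by blast
        then show ?thesis using c.connecting_hit[OF e, of w e' "\<lambda>_. H"] 2 by (simp add: w)
      qed
    qed
  qed
  then show ?case by simp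
next
  case (ge2 i)
  interpret c: cut A "slab M" "slab 1" "slab (M - 1)" "axis 1"
    by (rule cutI) (use M2 in auto)
  have "cut A (slab M) (slab (M - 1)) (slab (M - (M - 1))) (axis (M - 1))"
    by (rule cutI) (use M2 in auto)
  moreover have "M - (M - 1) = 1" using M2 by simp
  ultimately interpret c': cut A "slab M" "slab (M - 1)" "slab 1" "axis (M - 1)" by simp
  have "1 \<le> pr T" using ge2(3) M2 by simp
  then obtain T1 where T1: "T = T1 + axis 1" "pr T1 = pr T - 1" "pr' T1 = pr' T" by (rule split_axis)
  have "M - 1 \<le> pr T1" using ge2(3) T1(2) by simp
  then obtain T2 where T2: "T1 = T2 + axis (M - 1)" "pr T2 = pr T1 - (M - 1)" "pr' T2 = pr' T1"
    by (rule split_axis)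
  have "Q (i + d) (slab 1) T2 (\<lambda>_. periodic pr \<zeta> M i H)"
    by (rule ge2(1)) (use ge2(3,4) T1(2,3) T2(2,3) M2 in auto)
  then have "Q (Suc (i + d)) (slab (M - 1)) T1 (c'.connecting (\<lambda>_. periodic pr \<zeta> M i H))"
    unfolding T2(1) by (intro Q_shift) (use M2 \<open>M - (M - 1) = 1\<close> in simp_all)
  then have "Q (Suc (Suc (i + d))) (slab 1) T (c.connecting (c'.connecting (\<lambda>_. periodic pr \<zeta> M i H)))"
    unfolding T1(1) by (intro Q_shift) (use M2 in auto)
  then have "Q (Suc (Suc (i + d))) (slab 1) T (\<lambda>_. periodic pr \<zeta> M (Suc (Suc i)) H)"
  proof (rule Q_cong[rotated])
    fix e w assume g: "cell A (slab 1) T (Suc (Suc (i + d))) e w"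
    then obtain a b r where w: "w = a # b # r"
      by (cases w; cases "tl w") (auto simp: cell_def)
    have e: "e \<in> slab 1" using g by (simp add: cell_def)
    then have pe: "pr e = 0" by (simp add: slab_def)
    have ab: "pr a < M" "pr b < M" using g by (auto simp: w cell_def A_iff)
    note gp = cell_pr[OF g]
    define x where "x = periodic pr \<zeta> M i H r"
    have pr_w: "pr (sum_list w) = pr a + pr b + pr (sum_list r)" "pr' (sum_list w) = pr' a + pr' b + pr' (sum_list r)"
      by (simp_all add: w)
    \<comment> \<open>The tail \<open>r\<close> uses up the whole degree \<open>v\<close> and at
      least \<open>res_deg M i\<close> in direction \<open>pr\<close>; what is left for
      \<open>e\<close>, \<open>a\<close> and \<open>b\<close> lies on the axis and amounts to at
      most \<open>M\<close>.\<close>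
    have x: "pr' e = 0" "pr' a = 0" "pr' b = 0" "pr a + pr b \<le> M" if "x \<noteq> 0"
    proof -
      have "res_deg M i \<le> pr (sum_list r)" "v \<le> pr' (sum_list r)"
        using periodic_support[of H v \<zeta> i r] H that by (auto simp: x_def)
      then show "pr' e = 0" "pr' a = 0" "pr' b = 0" "pr a + pr b \<le> M"
        using gp pr_w ge2(3,4) pe by simp_all
    qed
    show "c.connecting (c'.connecting (\<lambda>_. periodic pr \<zeta> M i H)) e w = periodic pr \<zeta> M (Suc (Suc i)) H w"
    proof (cases "e + a \<in> slab M \<and> e + a \<notin> slab 1")
      case False
      then have "c.connecting (c'.connecting (\<lambda>_. periodic pr \<zeta> M i H)) e w = 0"
        using c.connecting_miss[OF e, of w] by (auto simp: w)
      moreover have "periodic pr \<zeta> M (Suc (Suc i)) H w = 0"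
      proof (rule ccontr)
        assume "periodic pr \<zeta> M (Suc (Suc i)) H w \<noteq> 0"
        then have "x \<noteq> 0" "M \<le> pr a + pr b" by (auto simp: w x_def split: if_splits)
        then have "e + a \<in> slab M \<and> e + a \<notin> slab 1" using x ab pe N' by (auto simp: slab_def)
        then show False using False by simp
      qed
      ultimately show ?thesis by simp
    next
      case True
      then obtain e' where e': "e' \<in> slab (M - 1)" "e + a = e' + axis 1" using c.cut1 by blast
      have c1: "c.connecting (c'.connecting (\<lambda>_. periodic pr \<zeta> M i H)) e w = c'.connecting (\<lambda>_. periodic pr \<zeta> M i H) e' (b # r)"
        using c.connecting_hit[OF e, of w e'] e' by (simp add: w)
      have "pr (e + a) = pr (e' + axis 1)" "pr' (e + a) = pr' (e' + axis 1)" using e' by simp_all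
      then have pe': "pr a = pr e' + 1" "pr' e' = pr' e + pr' a" using pe by simp_all
      show ?thesis
      proof (cases "e' + b \<in> slab M \<and> e' + b \<notin> slab (M - 1)")
        case f: False
        then have "c'.connecting (\<lambda>_. periodic pr \<zeta> M i H) e' (b # r) = 0"
          using c'.connecting_miss[OF e'(1), of "b # r"] by auto
        moreover have "periodic pr \<zeta> M (Suc (Suc i)) H w = 0"
        proof (rule ccontr)
          assume "periodic pr \<zeta> M (Suc (Suc i)) H w \<noteq> 0"
          then have "x \<noteq> 0" "M \<le> pr a + pr b" by (auto simp: w x_def split: if_splits)
          then have "e' + b \<in> slab M \<and> e' + b \<notin> slab (M - 1)" using x ab pe' N' by (auto simp: slab_def)
          then show False using f by simp
        qed
        ultimately show ?thesis using c1 by simp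
      next
        case t: True
        then obtain e'' where e'': "e'' \<in> slab 1" "e' + b = e'' + axis (M - 1)" using c'.cut1 by blast
        \<comment> \<open>The first cut has removed 1 from the exponent of \<open>a\<close>, so
          reaching the second cut at \<open>M - 1\<close> is the carry condition.\<close>
        have "M - 1 \<le> pr (e' + b)" unfolding e''(2) by simp
        then have "M \<le> pr a + pr b" using pe' M2 by simp
        moreover have "c'.connecting (\<lambda>_. periodic pr \<zeta> M i H) e' (b # r) = x"
          using c'.connecting_hit[OF e'(1), of "b # r" e''] e'' by (simp add: x_def)
        ultimately show ?thesis using c1 by (simp add: w x_def)
      qed
    qed
  qed
  then show ?case by simp
qed

lemma connecting_zero:
  assumes "0 < p" "p < M"
  shows "cut.connecting A (slab M) (slab p) (axis p) (\<lambda>_ _. 0 :: 'k::field) = (\<lambda>_ _. 0)"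
proof -
  interpret c: cut A "slab M" "slab p" "slab (M - p)" "axis p" by (rule cutI) fact+
  have p: "c.extend (\<lambda>_ _. 0 :: 'k) = (\<lambda>_ _. 0)" by (intro ext) (simp add: c.extend_def)
  show ?thesis unfolding c.connecting_def p by (intro ext) simp
qed

context
  assumes base0: "\<And>d T. 0 < pr T \<Longrightarrow> spanned A d (slab M) T (\<lambda>_ _. 0 :: 'k::field)"
begin

lemma spanned_slab_shift:
  assumes "0 < p" "p < M" "spanned A d (slab (M - p)) T (\<theta> :: _ \<Rightarrow> _ \<Rightarrow> 'k)"
  shows "spanned A (Suc d) (slab p) (T + axis p) (cut.connecting A (slab M) (slab p) (axis p) \<theta>)"
proof -
  interpret c: cut A "slab M" "slab p" "slab (M - p)" "axis p" by (rule cutI) fact+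
  show ?thesis by (rule c.spanned_shift[OF base0 assms(3)]) (use assms in simp)
qed

lemma nontriv_slab_shift:
  assumes "0 < p" "p < M" "nontriv A d (slab (M - p)) T (\<theta> :: _ \<Rightarrow> _ \<Rightarrow> 'k)"
  shows "nontriv A (Suc d) (slab p) (T + axis p) (cut.connecting A (slab M) (slab p) (axis p) \<theta>)"
proof -
  interpret c: cut A "slab M" "slab p" "slab (M - p)" "axis p" by (rule cutI) fact+
  show ?thesis by (rule c.nontriv_shift[OF base0 assms(3)]) (use assms in simp)
qed

lemma spanned_periodic:
  assumes "\<And>T0. pr T0 = 0 \<Longrightarrow> pr' T0 = v \<Longrightarrow> spanned A d (slab M) T0 (\<lambda>_. H :: _ \<Rightarrow> 'k)"
    and "\<And>w. H w \<noteq> 0 \<Longrightarrow> v \<le> pr' (sum_list w)"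
    and "pr T = res_deg M i" "pr' T = v"
  shows "spanned A (i + d) (slab 1) T (\<lambda>_. periodic pr \<zeta> M i H)"
proof (rule periodic_shift_induct[where Q = "spanned A" and v = v])
  fix p d T and \<theta> :: "nat \<times> nat \<Rightarrow> (nat \<times> nat) list \<Rightarrow> 'k"
  assume "0 < p" "p < M" "spanned A d (slab (M - p)) T \<theta>"
  then show "spanned A (Suc d) (slab p) (T + axis p) (cut.connecting A (slab M) (slab p) (axis p) \<theta>)" by (rule spanned_slab_shift)
next
  fix p d T and \<theta> :: "nat \<times> nat \<Rightarrow> (nat \<times> nat) list \<Rightarrow> 'k"
  assume p: "pr T < p" "p \<le> M" and *: "spanned A d (slab M) T \<theta>"
  show "spanned A d (slab p) T \<theta>"
    using * by (simp only: spanned_slab_same[OF p])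
next
  fix d R T and \<theta> \<theta>' :: "nat \<times> nat \<Rightarrow> (nat \<times> nat) list \<Rightarrow> 'k"
  assume *: "\<And>e w. cell A R T d e w \<Longrightarrow> \<theta> e w = \<theta>' e w" and "spanned A d R T \<theta>"
  then show "spanned A d R T \<theta>'" using spanned_cong[OF *] by simp
qed fact+

lemma nontriv_periodic:
  assumes "\<And>T0. pr T0 = 0 \<Longrightarrow> pr' T0 = v \<Longrightarrow> nontriv A d (slab M) T0 (\<lambda>_. H :: _ \<Rightarrow> 'k)"
    and "\<And>w. H w \<noteq> 0 \<Longrightarrow> v \<le> pr' (sum_list w)"
    and "pr T = res_deg M i" "pr' T = v"
  shows "nontriv A (i + d) (slab 1) T (\<lambda>_. periodic pr \<zeta> M i H)"
proof (rule periodic_shift_induct[where Q = "nontriv A" and v = v])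
  fix p d T and \<theta> :: "nat \<times> nat \<Rightarrow> (nat \<times> nat) list \<Rightarrow> 'k"
  assume "0 < p" "p < M" "nontriv A d (slab (M - p)) T \<theta>"
  then show "nontriv A (Suc d) (slab p) (T + axis p) (cut.connecting A (slab M) (slab p) (axis p) \<theta>)" by (rule nontriv_slab_shift)
next
  fix p d T and \<theta> :: "nat \<times> nat \<Rightarrow> (nat \<times> nat) list \<Rightarrow> 'k"
  assume p: "pr T < p" "p \<le> M" and *: "nontriv A d (slab M) T \<theta>"
  show "nontriv A d (slab p) T \<theta>"
    using * by (simp only: nontriv_slab_same[OF p])
next
  fix d R T and \<theta> \<theta>' :: "nat \<times> nat \<Rightarrow> (nat \<times> nat) list \<Rightarrow> 'k"
  assume *: "\<And>e w. cell A R T d e w \<Longrightarrow> \<theta> e w = \<theta>' e w" and "nontriv A d R T \<theta>"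
  then show "nontriv A d R T \<theta>'" using nontriv_cong[OF *] by simp
qed fact+

text \<open>The two cuts are undone in turn, lowering the degree by 1 and by \<open>M - 1\<close>.
  This stops when \<open>T\<close> lies below the cut, where the truncated module looks like the
  acyclic \<open>slab M\<close>, or when the cohomological degree is exhausted and no cells
  remain.\<close>

lemma spanned_zero:
  assumes "\<And>i. i \<le> d \<Longrightarrow> pr T \<noteq> res_deg M i"
  shows "spanned A d (slab 1) T (\<lambda>_ _. 0 :: 'k)"
  using assms
proof (induction d arbitrary: T rule: less_induct)
  case (less d)
  have T0: "pr T \<noteq> 0" using less.prems[of 0] by simp
  show ?case
  proof (cases d)
    case 0
    show ?thesis by (rule spanned_vacuous) (use 0 T0 in \<open>auto simp: cell_def slab_def\<close>)
  next
    case (Suc d')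
    have "pr T \<noteq> 1" using less.prems[of "Suc 0"] Suc by simp
    obtain T1 where T1: "T = T1 + axis 1" "pr T1 = pr T - 1" "pr' T1 = pr' T"
      by (rule split_axis[of 1 T]) (use T0 in auto)
    have "spanned A d' (slab (M - 1)) T1 (\<lambda>_ _. 0 :: 'k)"
    proof (cases "pr T1 < M - 1")
      case True
      have "spanned A d' (slab M) T1 (\<lambda>_ _. 0 :: 'k)"
        by (rule base0) (use T1(2) T0 \<open>pr T \<noteq> 1\<close> in simp)
      then show ?thesis
        by (simp add: spanned_slab_same[OF True, simplified])
    next
      case False
      show ?thesis
      proof (cases d')
        case 0
        show ?thesis by (rule spanned_vacuous) (use 0 False in \<open>auto simp: cell_def slab_def\<close>)
      next
        case (Suc d'')
        obtain T2 where T2: "T1 = T2 + axis (M - 1)" "pr T2 = pr T1 - (M - 1)" "pr' T2 = pr' T1"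
          by (rule split_axis[of "M - 1" T1]) (use False in auto)
        have "spanned A d'' (slab 1) T2 (\<lambda>_ _. 0 :: 'k)"
        proof (rule less.IH)
          fix i assume "i \<le> d''"
          then show "pr T2 \<noteq> res_deg M i"
            using less.prems[of "Suc (Suc i)"] Suc \<open>d = Suc d'\<close> T1(2) T2(2) False M2 by auto
        qed (use Suc \<open>d = Suc d'\<close> in simp)
        then have "spanned A (Suc d'') (slab (M - 1)) (T2 + axis (M - 1)) (\<lambda>_ _. 0 :: 'k)"
          using spanned_slab_shift[of "M - 1" d'' T2 "\<lambda>_ _. 0"] connecting_zero[of "M - 1", where 'k = 'k] M2 by simp
        then show ?thesis using Suc T2(1) by simp
      qed
    qed
    then show ?thesis
      using spanned_slab_shift[of 1 d' T1 "\<lambda>_ _. 0"] connecting_zero[of 1, where 'k = 'k] M2 Suc T1(1) by simp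
  qed
qed

end

end

section \<open>Generators in two variables and the Ext groups that they span\<close>

definition nil_ind :: "(nat \<times> nat) list \<Rightarrow> 'k::field" where
  "nil_ind w = (if w = [] then 1 else 0)"

definition gen_y :: "'k::field \<Rightarrow> nat \<Rightarrow> nat \<Rightarrow> (nat \<times> nat) list \<Rightarrow> 'k" where
  "gen_y \<xi> n j = periodic snd \<xi> n j nil_ind"

text \<open>The power of \<open>\<zeta>\<close> absorbs the \<open>x\<close>-twist of the last face.
  The price is a factor \<open>1 - \<zeta> ^ k\<close> at the first face, with \<open>k\<close> the
  \<open>x\<close>-exponent of the first letter, and this is the input that the construction in the
  \<open>x\<close>-direction expects.\<close>

definition gen_wy :: "'k::field \<Rightarrow> 'k \<Rightarrow> nat \<Rightarrow> nat \<Rightarrow> (nat \<times> nat) list \<Rightarrow> 'k" where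
  "gen_wy \<zeta> \<xi> n j w = \<zeta> ^ fst (sum_list w) * gen_y \<xi> n j w"

definition gen_xy :: "'k::field \<Rightarrow> 'k \<Rightarrow> nat \<Rightarrow> nat \<Rightarrow> nat \<Rightarrow> nat \<Rightarrow> (nat \<times> nat) list \<Rightarrow> 'k" where
  "gen_xy \<zeta> \<xi> m n i j = periodic fst \<zeta> m i (gen_wy \<zeta> \<xi> n j)"

lemma fst_0 [simp]: "fst (0 :: nat \<times> nat) = 0" and snd_0 [simp]: "snd (0 :: nat \<times> nat) = 0"
  by (simp_all add: zero_prod_def)

locale quantum_ci =
  fixes m n :: nat
  assumes m2: "2 \<le> m" and n2: "2 \<le> n"
begin

sublocale px: direction fst snd m n "bas m n" "Suc 0"
  by unfold_locales (use m2 n2 in \<open>auto simp: bas_def prod_eq_iff split_paired_Ex\<close>)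

sublocale py: direction snd fst n m "bas m n" m
  by unfold_locales (use m2 n2 in \<open>auto simp: bas_def prod_eq_iff split_paired_Ex\<close>)

lemma px_slab: "px.slab p = bas p (Suc 0)"
  by (auto simp: px.slab_def bas_def)

lemma py_slab: "py.slab p = bas m p"
  by (auto simp: py.slab_def bas_def)

lemma downset_bas: "downset (bas p r)"
  by (auto simp: downset_def bas_def)

lemma zero_bas: "(0 :: nat \<times> nat) \<in> bas m n"
  using m2 n2 by (simp add: bas_def zero_prod_def)

text \<open>The module \<open>\<Lambda>\<close> itself is free; inserting the module element as an extra letter contracts its complex.\<close>

lemma free_contraction:
  assumes "e \<in> bas m n"
  shows "cdiff (bas m n) (bas m n) aug \<phi> 0 (e # w) + cdiff (bas m n) (bas m n) aug (\<lambda>e w. \<phi> 0 (e # w)) e w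
    = \<phi> e w - (if w = [] then aug e * \<phi> 0 [] else 0)"
proof (cases w)
  case Nil
  then show ?thesis using assms zero_bas by (auto simp: cdiff_def aug_def)
next
  case (Cons a v)
  then show ?thesis using assms zero_bas by (auto simp: cdiff_def aug_def)
qed

lemma spanned_free:
  assumes "0 < d \<or> T \<noteq> 0"
  shows "spanned (bas m n) d (bas m n) T (\<lambda>_ _. 0 :: 'k::field)"
  unfolding spanned_def
proof (intro allI impI)
  fix \<phi> :: "nat \<times> nat \<Rightarrow> (nat \<times> nat) list \<Rightarrow> 'k"
  assume \<phi>: "aug_cocycle (bas m n) (bas m n) d T \<phi>"
  have "\<phi> e w = cdiff (bas m n) (bas m n) aug (\<lambda>e w. \<phi> 0 (e # w)) e w"
    if g: "cell (bas m n) (bas m n) T d e w" for e w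
  proof -
    have e: "e \<in> bas m n" using g by (simp add: cell_def)
    have "cell (bas m n) (bas m n) T (Suc d) 0 (e # w)"
      using g zero_bas by (auto simp: cell_def)
    then have "cdiff (bas m n) (bas m n) aug \<phi> 0 (e # w) = 0" using \<phi> by (simp add: aug_cocycle_def)
    moreover have "w = [] \<Longrightarrow> e \<noteq> 0" using assms g by (auto simp: cell_def)
    ultimately show ?thesis using free_contraction[OF e, of \<phi> w] by (auto simp: aug_def split: if_splits)
  qed
  then show "\<exists>a \<psi>. \<forall>e w. cell (bas m n) (bas m n) T d e w \<longrightarrow>
      \<phi> e w = a * 0 + cdiff (bas m n) (bas m n) aug \<psi> e w" by auto
qed

lemma cell_0:
  assumes "cell (bas m n) (bas m n) 0 0 e w"
  shows "e = 0" "w = []"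
  using assms by (auto simp: cell_def pair_add_eq_0)

lemma spanned_free_0: "spanned (bas m n) 0 (bas m n) 0 (\<lambda>_. nil_ind :: _ \<Rightarrow> 'k::field)"
  unfolding spanned_def
proof (intro allI impI)
  fix \<phi> :: "nat \<times> nat \<Rightarrow> (nat \<times> nat) list \<Rightarrow> 'k"
  have "\<phi> e w = \<phi> 0 [] * nil_ind w + cdiff (bas m n) (bas m n) aug \<phi> e w"
    if "cell (bas m n) (bas m n) 0 0 e w" for e w
    using cell_0[OF that] by (simp add: nil_ind_def)
  then show "\<exists>a \<psi>. \<forall>e w. cell (bas m n) (bas m n) 0 0 e w \<longrightarrow>
      \<phi> e w = a * nil_ind w + cdiff (bas m n) (bas m n) aug \<psi> e w" by blast
qed

lemma nontriv_free_0: "nontriv (bas m n) 0 (bas m n) 0 (\<lambda>_. nil_ind :: _ \<Rightarrow> 'k::field)"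
  unfolding nontriv_def
proof (intro conjI allI impI)
  show "aug_cocycle (bas m n) (bas m n) 0 0 (\<lambda>_. nil_ind :: _ \<Rightarrow> 'k)"
    unfolding aug_cocycle_def
  proof (intro allI impI)
    fix e w assume "cell (bas m n) (bas m n) 0 (Suc 0) e w"
    then have "e = 0" "w = [0]" by (auto simp: cell_def pair_add_eq_0 length_Suc_conv)
    then show "cdiff (bas m n) (bas m n) aug (\<lambda>_. nil_ind :: _ \<Rightarrow> 'k) e w = 0"
      using zero_bas by (simp add: cdiff_def nil_ind_def aug_def)
  qed
next
  fix b :: 'k and \<psi>
  assume "\<forall>e w. cell (bas m n) (bas m n) 0 0 e w \<longrightarrow> b * nil_ind w = cdiff (bas m n) (bas m n) aug \<psi> e w"
  moreover have "cell (bas m n) (bas m n) 0 0 0 []" using zero_bas by (simp add: cell_def)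
  ultimately have "b * nil_ind [] = cdiff (bas m n) (bas m n) aug \<psi> 0 []" by blast
  then show "b = 0" by (simp add: nil_ind_def)
qed

lemma py_base: "0 < snd T \<Longrightarrow> spanned (bas m n) d (py.slab n) T (\<lambda>_ _. 0 :: 'k::field)"
  unfolding py_slab by (rule spanned_free) auto

lemma spanned_bas_m_1_zero:
  assumes "\<And>j. j \<le> d \<Longrightarrow> snd T = res_deg n j \<Longrightarrow> j < d \<or> 0 < fst T"
  shows "spanned (bas m n) d (bas m (Suc 0)) T (\<lambda>_ _. 0 :: 'k::field)"
proof (cases "\<exists>j\<le>d. snd T = res_deg n j")
  case True
  then obtain j where j: "j \<le> d" "snd T = res_deg n j" by blast
  \<comment> \<open>A zero base class is shifted to a zero class, so spanning by it means
    vanishing.\<close>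
  have "spanned (bas m n) (j + (d - j)) (py.slab 1) T (\<lambda>_. periodic snd 1 n j (\<lambda>_. 0 :: 'k))"
  proof (rule py.spanned_periodic[OF py_base, where v = "fst T"])
    fix T0 :: "nat \<times> nat" assume "snd T0 = 0" "fst T0 = fst T"
    then show "spanned (bas m n) (d - j) (py.slab n) T0 (\<lambda>_ _. 0 :: 'k)"
      unfolding py_slab using assms[OF j] by (intro spanned_free) auto
  qed (use j in auto)
  then show ?thesis using j by (simp add: py_slab)
next
  case False
  have "spanned (bas m n) d (py.slab 1) T (\<lambda>_ _. 0 :: 'k)"
    by (rule py.spanned_zero[OF py_base]) (use False in auto)
  then show ?thesis by (simp add: py_slab)
qed

lemma px_base: "0 < fst T \<Longrightarrow> spanned (bas m n) d (px.slab m) T (\<lambda>_ _. 0 :: 'k::field)"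
  unfolding px_slab by (rule spanned_bas_m_1_zero) auto

lemma cell_gen_wy:
  assumes "fst T = 0" "cell (bas m n) R T d e w"
  shows "gen_wy \<zeta> \<xi> n j w = gen_y \<xi> n j w"
  using px.cell_pr[OF assms(2)] assms(1) by (simp add: gen_wy_def)

lemma spanned_gen_wy:
  assumes "fst T = 0" "snd T = res_deg n j"
  shows "spanned (bas m n) j (bas m (Suc 0)) T (\<lambda>_. gen_wy \<zeta> \<xi> n j :: _ \<Rightarrow> 'k::field)"
proof -
  have "spanned (bas m n) (j + 0) (py.slab 1) T (\<lambda>_. periodic snd \<xi> n j nil_ind :: _ \<Rightarrow> 'k)"
  proof (rule py.spanned_periodic[OF py_base, where v = 0])
    fix T0 :: "nat \<times> nat" assume "snd T0 = 0" "fst T0 = 0"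
    then have "T0 = 0" by (simp add: prod_eq_iff)
    then show "spanned (bas m n) 0 (py.slab n) T0 (\<lambda>_. nil_ind :: _ \<Rightarrow> 'k)"
      using spanned_free_0 by (simp add: py_slab)
  qed (use assms in auto)
  then have "spanned (bas m n) j (bas m (Suc 0)) T (\<lambda>_. gen_y \<xi> n j)"
    by (simp add: py_slab gen_y_def)
  moreover have "spanned (bas m n) j (bas m (Suc 0)) T (\<lambda>_. gen_wy \<zeta> \<xi> n j) \<longleftrightarrow>
      spanned (bas m n) j (bas m (Suc 0)) T (\<lambda>_. gen_y \<xi> n j)"
    by (rule spanned_cong) (erule cell_gen_wy[OF assms(1)])
  ultimately show ?thesis by simp
qed

lemma nontriv_gen_wy:
  assumes "fst T = 0" "snd T = res_deg n j"
  shows "nontriv (bas m n) j (bas m (Suc 0)) T (\<lambda>_. gen_wy \<zeta> \<xi> n j :: _ \<Rightarrow> 'k::field)"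
proof -
  have "nontriv (bas m n) (j + 0) (py.slab 1) T (\<lambda>_. periodic snd \<xi> n j nil_ind :: _ \<Rightarrow> 'k)"
  proof (rule py.nontriv_periodic[OF py_base, where v = 0])
    fix T0 :: "nat \<times> nat" assume "snd T0 = 0" "fst T0 = 0"
    then have "T0 = 0" by (simp add: prod_eq_iff)
    then show "nontriv (bas m n) 0 (py.slab n) T0 (\<lambda>_. nil_ind :: _ \<Rightarrow> 'k)"
      using nontriv_free_0 by (simp add: py_slab)
  qed (use assms in auto)
  then have "nontriv (bas m n) j (bas m (Suc 0)) T (\<lambda>_. gen_y \<xi> n j)"
    by (simp add: py_slab gen_y_def)
  moreover have "nontriv (bas m n) j (bas m (Suc 0)) T (\<lambda>_. gen_wy \<zeta> \<xi> n j) \<longleftrightarrow>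
      nontriv (bas m n) j (bas m (Suc 0)) T (\<lambda>_. gen_y \<xi> n j)"
    by (rule nontriv_cong) (erule cell_gen_wy[OF assms(1)])
  ultimately show ?thesis by simp
qed

lemma gen_y_support: "gen_y \<xi> n j w \<noteq> 0 \<Longrightarrow> res_deg n j \<le> snd (sum_list w)"
  unfolding gen_y_def by (rule py.periodic_support(1)[of nil_ind 0]) auto

lemma gen_wy_support: "gen_wy \<zeta> \<xi> n j w \<noteq> 0 \<Longrightarrow> res_deg n j \<le> snd (sum_list w)"
  using gen_y_support by (auto simp: gen_wy_def)

lemma gen_xy_support:
  assumes "gen_xy \<zeta> \<xi> m n i j w \<noteq> 0"
  shows "res_deg m i \<le> fst (sum_list w)" "res_deg n j \<le> snd (sum_list w)"
  using px.periodic_support[of "gen_wy \<zeta> \<xi> n j" "res_deg n j"] gen_wy_support assms unfolding gen_xy_def by blast+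

lemma spanned_gen_xy: "spanned (bas m n) (i + j) (bas (Suc 0) (Suc 0)) (res_deg m i, res_deg n j) (\<lambda>_. gen_xy \<zeta> \<xi> m n i j :: _ \<Rightarrow> 'k::field)"
proof -
  have "spanned (bas m n) (i + j) (px.slab 1) (res_deg m i, res_deg n j) (\<lambda>_. periodic fst \<zeta> m i (gen_wy \<zeta> \<xi> n j) :: _ \<Rightarrow> 'k)"
  proof (rule px.spanned_periodic[OF px_base, where v = "res_deg n j"])
    fix T0 :: "nat \<times> nat" assume "fst T0 = 0" "snd T0 = res_deg n j"
    then show "spanned (bas m n) j (px.slab m) T0 (\<lambda>_. gen_wy \<zeta> \<xi> n j :: _ \<Rightarrow> 'k)"
      unfolding px_slab by (rule spanned_gen_wy)
  qed (auto intro: gen_wy_support)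
  then show ?thesis by (simp add: px_slab gen_xy_def)
qed

lemma nontriv_gen_xy: "nontriv (bas m n) (i + j) (bas (Suc 0) (Suc 0)) (res_deg m i, res_deg n j) (\<lambda>_. gen_xy \<zeta> \<xi> m n i j :: _ \<Rightarrow> 'k::field)"
proof -
  have "nontriv (bas m n) (i + j) (px.slab 1) (res_deg m i, res_deg n j) (\<lambda>_. periodic fst \<zeta> m i (gen_wy \<zeta> \<xi> n j) :: _ \<Rightarrow> 'k)"
  proof (rule px.nontriv_periodic[OF px_base, where v = "res_deg n j"])
    fix T0 :: "nat \<times> nat" assume "fst T0 = 0" "snd T0 = res_deg n j"
    then show "nontriv (bas m n) j (px.slab m) T0 (\<lambda>_. gen_wy \<zeta> \<xi> n j :: _ \<Rightarrow> 'k)"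
      unfolding px_slab by (rule nontriv_gen_wy)
  qed (auto intro: gen_wy_support)
  then show ?thesis by (simp add: px_slab gen_xy_def)
qed

text \<open>A nonzero class needs generator degrees in both directions whose cohomological degrees
  add up to \<open>d\<close>. The \<open>x\<close>-degree fixes \<open>i\<close>, and then the
  \<open>y\<close>-degree must match \<open>d - i\<close>.\<close>

lemma spanned_inner_zero:
  assumes "\<And>i. i \<le> d \<Longrightarrow> T \<noteq> (res_deg m i, res_deg n (d - i))"
  shows "spanned (bas m n) d (bas (Suc 0) (Suc 0)) T (\<lambda>_ _. 0 :: 'k::field)"
proof (cases "\<exists>i\<le>d. fst T = res_deg m i")
  case True
  then obtain i where i: "i \<le> d" "fst T = res_deg m i" by blast
  have *: "snd T \<noteq> res_deg n (d - i)" using assms[OF i(1)] i(2) by (auto simp: prod_eq_iff)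
  have "spanned (bas m n) (i + (d - i)) (px.slab 1) T (\<lambda>_. periodic fst 1 m i (\<lambda>_. 0 :: 'k))"
  proof (rule px.spanned_periodic[OF px_base, where v = "snd T"])
    fix T0 :: "nat \<times> nat" assume T0: "fst T0 = 0" "snd T0 = snd T"
    show "spanned (bas m n) (d - i) (px.slab m) T0 (\<lambda>_ _. 0 :: 'k)"
      unfolding px_slab
    proof (rule spanned_bas_m_1_zero)
      fix j assume "j \<le> d - i" "snd T0 = res_deg n j"
      then show "j < d - i \<or> 0 < fst T0" using * T0 by (cases "j = d - i") auto
    qed
  qed (use i in auto)
  then show ?thesis using i by (simp add: px_slab)
next
  case False
  have "spanned (bas m n) d (px.slab 1) T (\<lambda>_ _. 0 :: 'k)"
    by (rule px.spanned_zero[OF px_base]) (use False in auto)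
  then show ?thesis by (simp add: px_slab)
qed

end

section \<open>The small complex of a fixed weight\<close>

definition bichar :: "'k::field \<Rightarrow> 'k \<Rightarrow> nat \<times> nat \<Rightarrow> 'k" where
  "bichar \<zeta> \<xi> a = \<zeta> ^ fst a * \<xi> ^ snd a"

lemma bichar_0 [simp]: "bichar \<zeta> \<xi> 0 = 1"
  by (simp add: bichar_def)

lemma mult_char_bichar: "mult_char (bichar \<zeta> \<xi>)"
  by (auto simp: mult_char_def bichar_def power_add)

lemma merge_sum_weight:
  assumes "set w \<subseteq> A"
  shows "merge_sum A (\<lambda>l. c (sum_list l) * f l) w = c (sum_list w) * merge_sum A f w"
proof -
  have "merge_sum A (\<lambda>l. c (sum_list l) * f l) w = merge_sum A (\<lambda>l. c (sum_list w) * f l) w"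
    by (rule merge_sum_cong) (use assms in auto)
  then show ?thesis by (simp add: merge_sum_cmult)
qed

lemma merge_sum_nil_ind: "merge_sum A nil_ind w = 0"
proof (cases "length w < 2")
  case True
  then show ?thesis by (cases w; cases "tl w") auto
next
  case False
  have "merge_sum A nil_ind w = merge_sum A (\<lambda>_. 0) w"
    by (rule merge_sum_cong_length) (use False in \<open>auto simp: nil_ind_def\<close>)
  then show ?thesis by simp
qed

lemma word_diff_nil_ind:
  assumes "w \<noteq> []"
  shows "word_diff A (\<lambda>a. \<xi> ^ snd a) nil_ind w = (1 - \<xi>) * qint \<xi> (snd (hd w)) * nil_ind (tl w)"
proof -
  obtain a r where w: "w = a # r" using assms by (cases w) auto
  show ?thesis by (cases r) (auto simp: w word_diff_Cons merge_sum_nil_ind qint_geom nil_ind_def)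
qed

lemma res_deg_Suc: "2 \<le> M \<Longrightarrow> res_deg M i < res_deg M (Suc i)"
  by (induction i rule: induct_nat_012) auto

lemma res_deg_mono: "2 \<le> M \<Longrightarrow> i < j \<Longrightarrow> res_deg M i < res_deg M j"
  by (rule lift_Suc_mono_less[of "res_deg M"]) (auto intro: res_deg_Suc)

context quantum_ci
begin

lemma gen_y_word_diff:
  assumes "set w \<subseteq> bas m n" "fst (sum_list w) < m" "snd (sum_list w) < res_deg n j + n"
  shows "word_diff (bas m n) (\<lambda>a. \<xi> ^ snd a) (gen_y \<xi> n j) w = res_coeff \<xi> n j * gen_y \<xi> n (Suc j) w"
  using py.periodic_word_diff[of 0 "\<lambda>a. \<xi> ^ snd a" nil_ind \<xi> "\<lambda>_. 0" w j] assms word_diff_nil_ind[of _ "bas m n" \<xi>]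
  by (simp add: gen_y_def)

lemma gen_wy_word_diff:
  assumes w: "set w \<subseteq> bas m n" "fst (sum_list w) < m" "snd (sum_list w) < n + res_deg n j" "w \<noteq> []"
  shows "word_diff (bas m n) (bichar \<zeta> \<xi>) (gen_wy \<zeta> \<xi> n j) w =
    (1 - \<zeta>) * qint \<zeta> (fst (hd w)) * gen_wy \<zeta> \<xi> n j (tl w) + res_coeff \<xi> n j * gen_wy \<zeta> \<xi> n (Suc j) w"
proof -
  define Y where "Y = gen_y \<xi> n j"
  obtain b r where br: "w = b # r" using w(4) by (cases w) auto
  have b: "merge_sum (bas m n) (gen_wy \<zeta> \<xi> n j) w = \<zeta> ^ fst (sum_list w) * merge_sum (bas m n) Y w"
    using merge_sum_weight[OF w(1), of "\<lambda>a. \<zeta> ^ fst a" Y] by (simp add: gen_wy_def[abs_def] Y_def)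
  have l: "bichar \<zeta> \<xi> (last w) * gen_wy \<zeta> \<xi> n j (butlast w)
     = \<zeta> ^ fst (sum_list w) * (\<xi> ^ snd (last w) * Y (butlast w))"
    unfolding sum_list_butlast[OF w(4), symmetric] by (simp add: bichar_def gen_wy_def Y_def power_add)
  have "word_diff (bas m n) (bichar \<zeta> \<xi>) (gen_wy \<zeta> \<xi> n j) w =
      gen_wy \<zeta> \<xi> n j (tl w) - \<zeta> ^ fst (sum_list w) * Y (tl w)
      + \<zeta> ^ fst (sum_list w) * word_diff (bas m n) (\<lambda>a. \<xi> ^ snd a) Y w"
    using w(4) b l unfolding word_diff_def by (simp add: algebra_simps)
  also have "word_diff (bas m n) (\<lambda>a. \<xi> ^ snd a) Y w = res_coeff \<xi> n j * gen_y \<xi> n (Suc j) w"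
    unfolding Y_def by (rule gen_y_word_diff) (use w in auto)
  also have "gen_wy \<zeta> \<xi> n j (tl w) - \<zeta> ^ fst (sum_list w) * Y (tl w)
     = ((1 - \<zeta>) * qint \<zeta> (fst (hd w))) * gen_wy \<zeta> \<xi> n j (tl w)"
    unfolding qint_geom by (simp add: br gen_wy_def Y_def power_add algebra_simps)
  finally show ?thesis by (simp add: gen_wy_def[of \<zeta> \<xi> n "Suc j" w] mult.left_commute)
qed

lemma gen_xy_word_diff:
  assumes w: "set w \<subseteq> bas m n" "fst (sum_list w) < res_deg m i + m" "snd (sum_list w) < n + res_deg n j"
  shows "word_diff (bas m n) (bichar \<zeta> \<xi>) (gen_xy \<zeta> \<xi> m n i j) w =
    res_coeff \<zeta> m i * gen_xy \<zeta> \<xi> m n (Suc i) j w + (-1) ^ i * res_coeff \<xi> n j * gen_xy \<zeta> \<xi> m n i (Suc j) w"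
proof -
  have "word_diff (bas m n) (bichar \<zeta> \<xi>) (periodic fst \<zeta> m i (gen_wy \<zeta> \<xi> n j)) w = res_coeff \<zeta> m i * periodic fst \<zeta> m (Suc i) (gen_wy \<zeta> \<xi> n j) w
     + (-1) ^ i * periodic fst \<zeta> m i (\<lambda>w. res_coeff \<xi> n j * gen_wy \<zeta> \<xi> n (Suc j) w) w"
  proof (rule px.periodic_word_diff[where L = "res_deg n j"])
    show "res_coeff \<xi> n j * gen_wy \<zeta> \<xi> n (Suc j) [] = 0" by (simp add: gen_wy_def gen_y_def)
  qed (use w gen_wy_support gen_wy_word_diff in auto)
  then show ?thesis by (simp add: gen_xy_def periodic_cmult)
qed

text \<open>The generator in degree \<open>(i, j)\<close> contributes to total degree \<open>T\<close> only if the remaining exponent is that of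
  a basis monomial.\<close>

definition in_window :: "nat \<times> nat \<Rightarrow> nat \<Rightarrow> nat \<Rightarrow> bool" where
  "in_window T i j \<longleftrightarrow> res_deg m i \<le> fst T \<and> fst T < res_deg m i + m \<and> res_deg n j \<le> snd T \<and> snd T < res_deg n j + n"

definition window_supp :: "nat \<times> nat \<Rightarrow> (nat \<Rightarrow> nat \<Rightarrow> 'k::field) \<Rightarrow> bool" where
  "window_supp T \<alpha> \<longleftrightarrow> (\<forall>i j. \<alpha> i j \<noteq> 0 \<longrightarrow> in_window T i j)"

lemma cell_sums:
  assumes "cell A R T d e w"
  shows "fst e + fst (sum_list w) = fst T" "snd e + snd (sum_list w) = snd T"
  using assms by (auto simp: cell_def)

text \<open>In the window every outer face that can contribute is admissible: where the generator is
  nonzero, the remaining word has at least its internal degree, so \<open>e\<close> plus the removed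
  letter is still a basis monomial. Hence \<open>cdiff\<close> agrees with
  \<open>word_diff\<close>.\<close>

lemma cdiff_gen_xy:
  assumes g: "cell (bas m n) (bas m n) T (Suc d) e w" and c: "in_window T i j"
  shows "cdiff (bas m n) (bas m n) (bichar \<zeta> \<xi>) (\<lambda>_. gen_xy \<zeta> \<xi> m n i j) e w =
    res_coeff \<zeta> m i * gen_xy \<zeta> \<xi> m n (Suc i) j w + (-1) ^ i * res_coeff \<xi> n j * gen_xy \<zeta> \<xi> m n i (Suc j) w"
proof -
  have wn: "w \<noteq> []" using g by (auto simp: cell_def)
  have 1: "e + a \<in> bas m n" if "a + sum_list v = sum_list w" "gen_xy \<zeta> \<xi> m n i j v \<noteq> 0" for a v
  proof -
    have "fst a + fst (sum_list v) = fst (sum_list w)" "snd a + snd (sum_list v) = snd (sum_list w)"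
      using that(1) by (metis fst_add, metis snd_add)
    then show ?thesis
      using gen_xy_support[OF that(2)] c cell_sums[OF g] by (auto simp: bas_def in_window_def mem_Times_iff)
  qed
  have "hd w + sum_list (tl w) = sum_list w" using wn by (cases w) auto
  note h = 1[OF this]
  have "last w + sum_list (butlast w) = sum_list w"
    using sum_list_butlast[OF wn] by (simp add: add.commute)
  note l = 1[OF this]
  have "cdiff (bas m n) (bas m n) (bichar \<zeta> \<xi>) (\<lambda>_. gen_xy \<zeta> \<xi> m n i j) e w = word_diff (bas m n) (bichar \<zeta> \<xi>) (gen_xy \<zeta> \<xi> m n i j) w"
  proof -
    have "(if e + hd w \<in> bas m n then gen_xy \<zeta> \<xi> m n i j (tl w) else 0) = gen_xy \<zeta> \<xi> m n i j (tl w)"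
      "(if e + last w \<in> bas m n then gen_xy \<zeta> \<xi> m n i j (butlast w) else 0) = gen_xy \<zeta> \<xi> m n i j (butlast w)"
      using h l by auto
    then show ?thesis using wn unfolding cdiff_def word_diff_def by simp
  qed
  also have "\<dots> = res_coeff \<zeta> m i * gen_xy \<zeta> \<xi> m n (Suc i) j w + (-1) ^ i * res_coeff \<xi> n j * gen_xy \<zeta> \<xi> m n i (Suc j) w"
    by (rule gen_xy_word_diff) (use g c cell_sums[OF g] in \<open>auto simp: cell_def in_window_def\<close>)
  finally show ?thesis .
qed

definition gen_sum :: "'k::field \<Rightarrow> 'k \<Rightarrow> nat \<Rightarrow> (nat \<Rightarrow> nat \<Rightarrow> 'k) \<Rightarrow> (nat \<times> nat) list \<Rightarrow> 'k" where
  "gen_sum \<zeta> \<xi> d \<alpha> w = (\<Sum>i\<le>d. \<alpha> i (d - i) * gen_xy \<zeta> \<xi> m n i (d - i) w)"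

text \<open>The total differential of a double complex of scalars; the sign is that of passing the
  \<open>i\<close> letters of the \<open>x\<close>-part.\<close>

definition small_diff :: "'k::field \<Rightarrow> 'k \<Rightarrow> nat \<times> nat \<Rightarrow> (nat \<Rightarrow> nat \<Rightarrow> 'k) \<Rightarrow> nat \<Rightarrow> nat \<Rightarrow> 'k" where
  "small_diff \<zeta> \<xi> T \<alpha> i j = (if in_window T i j then
      (if i = 0 then 0 else res_coeff \<zeta> m (i - 1) * \<alpha> (i - 1) j)
    + (if j = 0 then 0 else (-1) ^ i * res_coeff \<xi> n (j - 1) * \<alpha> i (j - 1)) else 0)"

lemma window_supp_small_diff: "window_supp T (small_diff \<zeta> \<xi> T \<alpha>)"
  by (auto simp: window_supp_def small_diff_def)

lemma gen_sum_add: "gen_sum \<zeta> \<xi> d (\<lambda>i j. \<alpha> i j + \<beta> i j) w = gen_sum \<zeta> \<xi> d \<alpha> w + gen_sum \<zeta> \<xi> d \<beta> w"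
  by (simp add: gen_sum_def sum.distrib algebra_simps)

lemma gen_sum_diff: "gen_sum \<zeta> \<xi> d (\<lambda>i j. \<alpha> i j - \<beta> i j) w = gen_sum \<zeta> \<xi> d \<alpha> w - gen_sum \<zeta> \<xi> d \<beta> w"
  by (simp add: gen_sum_def sum_subtractf algebra_simps)

lemma cdiff_gen_sum:
  assumes g: "cell (bas m n) (bas m n) T (Suc d) e w" and \<alpha>: "window_supp T \<alpha>"
  shows "cdiff (bas m n) (bas m n) (bichar \<zeta> \<xi>) (\<lambda>_. gen_sum \<zeta> \<xi> d \<alpha>) e w = gen_sum \<zeta> \<xi> (Suc d) (small_diff \<zeta> \<xi> T \<alpha>) w"
proof -
  define G where "G i j = gen_xy \<zeta> \<xi> m n i j w" for i j
  define a where "a i = (if i = 0 then 0 else res_coeff \<zeta> m (i - 1) * \<alpha> (i - 1) (Suc d - i))" for i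
  define b where "b i = (if i = Suc d then 0 else (-1) ^ i * res_coeff \<xi> n (d - i) * \<alpha> i (d - i))" for i
  have "cdiff (bas m n) (bas m n) (bichar \<zeta> \<xi>) (\<lambda>_. gen_sum \<zeta> \<xi> d \<alpha>) e w
      = (\<Sum>i\<le>d. \<alpha> i (d - i) * cdiff (bas m n) (bas m n) (bichar \<zeta> \<xi>) (\<lambda>_. gen_xy \<zeta> \<xi> m n i (d - i)) e w)"
    by (simp add: gen_sum_def[abs_def] cdiff_sum cdiff_cmult)
  also have "\<dots> = (\<Sum>i\<le>d. a (Suc i) * G (Suc i) (d - i) + b i * G i (Suc d - i))"
  proof (rule sum.cong[OF refl])
    fix i assume i: "i \<in> {..d}"
    show "\<alpha> i (d - i) * cdiff (bas m n) (bas m n) (bichar \<zeta> \<xi>) (\<lambda>_. gen_xy \<zeta> \<xi> m n i (d - i)) e w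
       = a (Suc i) * G (Suc i) (d - i) + b i * G i (Suc d - i)"
    proof (cases "\<alpha> i (d - i) = 0")
      case False
      then have "in_window T i (d - i)" using \<alpha> by (auto simp: window_supp_def)
      then show ?thesis
        using i by (simp add: cdiff_gen_xy[OF g] a_def b_def G_def Suc_diff_le algebra_simps)
    qed (simp add: a_def b_def)
  qed
  also have "\<dots> = (\<Sum>i\<le>d. a (Suc i) * G (Suc i) (d - i)) + (\<Sum>i\<le>d. b i * G i (Suc d - i))"
    by (rule sum.distrib)
  also have "(\<Sum>i\<le>d. a (Suc i) * G (Suc i) (d - i)) = (\<Sum>i\<le>Suc d. a i * G i (Suc d - i))"
    by (simp add: sum.atMost_Suc_shift a_def del: sum.atMost_Suc)
  also have "(\<Sum>i\<le>d. b i * G i (Suc d - i)) = (\<Sum>i\<le>Suc d. b i * G i (Suc d - i))"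
    by (simp add: b_def)
  also have "(\<Sum>i\<le>Suc d. a i * G i (Suc d - i)) + (\<Sum>i\<le>Suc d. b i * G i (Suc d - i))
      = (\<Sum>i\<le>Suc d. (a i + b i) * G i (Suc d - i))"
    by (simp add: sum.distrib algebra_simps del: sum.atMost_Suc)
  also have "\<dots> = gen_sum \<zeta> \<xi> (Suc d) (small_diff \<zeta> \<xi> T \<alpha>) w"
    unfolding gen_sum_def
  proof (rule sum.cong[OF refl])
    fix i assume i: "i \<in> {..Suc d}"
    show "(a i + b i) * G i (Suc d - i) = small_diff \<zeta> \<xi> T \<alpha> i (Suc d - i) * gen_xy \<zeta> \<xi> m n i (Suc d - i) w"
    proof (cases "in_window T i (Suc d - i)")
      case True
      have "Suc d - i = 0 \<longleftrightarrow> i = Suc d" using i by auto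
      then show ?thesis using True by (simp add: a_def b_def small_diff_def G_def)
    next
      case False
      \<comment> \<open>If the generator is nonzero, the window can fail only at an upper end. Both
        sources of arrows into it have no larger internal degree in either direction, so they fail
        the same bound and have coefficient 0.\<close>
      have "a i = 0 \<and> b i = 0" if "G i (Suc d - i) \<noteq> 0"
      proof -
        have up: "res_deg m i \<le> fst T" "res_deg n (Suc d - i) \<le> snd T"
          using gen_xy_support that cell_sums[OF g] unfolding G_def by fastforce+
        have "\<alpha> (i - 1) (Suc d - i) = 0" if "i \<noteq> 0"
        proof (rule ccontr)
          assume "\<alpha> (i - 1) (Suc d - i) \<noteq> 0"
          then have "in_window T (i - 1) (Suc d - i)" using \<alpha> by (auto simp: window_supp_def)
          moreover have "res_deg m (i - 1) < res_deg m i" using res_deg_mono m2 that by simp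
          ultimately show False using False up by (auto simp: in_window_def)
        qed
        moreover have "\<alpha> i (d - i) = 0" if "i \<noteq> Suc d"
        proof (rule ccontr)
          assume "\<alpha> i (d - i) \<noteq> 0"
          then have "in_window T i (d - i)" using \<alpha> by (auto simp: window_supp_def)
          moreover have "res_deg n (d - i) < res_deg n (Suc d - i)" using res_deg_mono n2 that i by auto
          ultimately show False using False up by (auto simp: in_window_def)
        qed
        ultimately show ?thesis by (auto simp: a_def b_def)
      qed
      then show ?thesis using False by (auto simp: small_diff_def G_def)
    qed
  qed
  finally show ?thesis .
qed

end

section \<open>Reduction of a cocycle to the small complex\<close>

fun gen_word_x :: "nat \<Rightarrow> nat \<Rightarrow> (nat \<times> nat) list" where
  "gen_word_x M 0 = []"
| "gen_word_x M (Suc 0) = [(1, 0)]"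
| "gen_word_x M (Suc (Suc i)) = (1, 0) # (M - 1, 0) # gen_word_x M i"

text \<open>Words dual to the generators: each pair of exponents \<open>1, M - 1\<close> just
  reaches a carry. Evaluation on them reads off the coefficients of a combination.\<close>

definition gen_word :: "nat \<Rightarrow> nat \<Rightarrow> nat \<Rightarrow> nat \<Rightarrow> (nat \<times> nat) list" where
  "gen_word m n i j = gen_word_x m i @ map prod.swap (gen_word_x n j)"

lemma gen_word_x_props:
  assumes "2 \<le> M"
  shows "sum_list (gen_word_x M i) = (res_deg M i, 0)" "length (gen_word_x M i) = i" "set (gen_word_x M i) \<subseteq> {0..<M} \<times> {0}"
  using assms by (induction i rule: induct_nat_012) (auto simp: zero_prod_def)

lemma sum_list_swap: "sum_list (map prod.swap w) = prod.swap (sum_list w :: nat \<times> nat)"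
  by (induction w) (auto simp: prod_eq_iff)

lemma periodic_fst_gen_word_x: "2 \<le> m \<Longrightarrow> periodic fst \<zeta> m i H (gen_word_x m i @ r) = H r"
  by (induction i rule: induct_nat_012) auto

lemma periodic_snd_gen_word_x: "2 \<le> n \<Longrightarrow> periodic snd \<xi> n j H (map prod.swap (gen_word_x n j) @ r) = H r"
  by (induction j rule: induct_nat_012) auto

context quantum_ci
begin

abbreviation "B \<equiv> bas m n"
abbreviation "B1 \<equiv> bas (Suc 0) (Suc 0)"

lemma gen_word_props: "sum_list (gen_word m n i j) = (res_deg m i, res_deg n j)" "length (gen_word m n i j) = i + j" "set (gen_word m n i j) \<subseteq> B"
  using gen_word_x_props[OF m2, of i] gen_word_x_props[OF n2, of j] m2 n2
  by (auto simp: gen_word_def sum_list_swap bas_def)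

lemma gen_xy_gen_word: "gen_xy \<zeta> \<xi> m n i j (gen_word m n i j) = 1"
proof -
  have "gen_y \<xi> n j (map prod.swap (gen_word_x n j)) = 1"
    using periodic_snd_gen_word_x[OF n2, of \<xi> j nil_ind "[]"] by (simp add: gen_y_def nil_ind_def)
  moreover have "fst (sum_list (map prod.swap (gen_word_x n j))) = 0"
    unfolding sum_list_swap using gen_word_x_props[OF n2, of j] by simp
  ultimately show ?thesis
    by (simp add: gen_xy_def gen_word_def periodic_fst_gen_word_x[OF m2] gen_wy_def)
qed

text \<open>With \<open>i + j\<close> fixed, a different generator has one larger index and so needs
  more degree in that direction than the word has.\<close>

lemma gen_xy_gen_word_other:
  assumes "i + j = i' + j'" "i \<noteq> i'"
  shows "gen_xy \<zeta> \<xi> m n i' j' (gen_word m n i j) = 0"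
proof (rule ccontr)
  assume "gen_xy \<zeta> \<xi> m n i' j' (gen_word m n i j) \<noteq> 0"
  from gen_xy_support[OF this] have "res_deg m i' \<le> res_deg m i" "res_deg n j' \<le> res_deg n j"
    by (simp_all add: gen_word_props)
  then show False
    using assms res_deg_mono[OF m2, of i i'] res_deg_mono[OF n2, of j j'] by (cases "i < i'") auto
qed

lemma gen_sum_gen_word:
  assumes "i \<le> d"
  shows "gen_sum \<zeta> \<xi> d \<alpha> (gen_word m n i (d - i)) = \<alpha> i (d - i)"
proof -
  have "gen_sum \<zeta> \<xi> d \<alpha> (gen_word m n i (d - i)) = (\<Sum>k\<le>d. if k = i then \<alpha> i (d - i) else 0)"
    unfolding gen_sum_def
    by (rule sum.cong[OF refl]) (use assms in \<open>auto simp: gen_xy_gen_word gen_xy_gen_word_other\<close>)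
  then show ?thesis using assms by simp
qed

definition level :: "nat \<times> nat \<Rightarrow> nat" where "level e = fst e + snd e"

lemma level_add [simp]: "level (a + b) = level a + level b"
  by (simp add: level_def)

lemma level_0: "level a = 0 \<longleftrightarrow> a = 0"
  by (auto simp: level_def prod_eq_iff)

lemma cell_tl:
  assumes "cell A R T (Suc d) e w" "e + hd w \<in> R"
  shows "cell A R T d (e + hd w) (tl w)"
  using assms by (cases w) (auto simp: cell_def add.assoc)

lemma cell_butlast:
  assumes "cell A R T (Suc d) e w" "e + last w \<in> R"
  shows "cell A R T d (e + last w) (butlast w)"
proof -
  have "w \<noteq> []" using assms by (auto simp: cell_def)
  then show ?thesis
    using assms sum_list_butlast[of w] by (auto simp: cell_def add_ac dest: in_set_butlastD)
qed

lemma cdiff_above: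
  assumes "\<And>e' w'. cell B B T d e' w' \<Longrightarrow> level e \<le> level e' \<Longrightarrow> \<phi> e' w' = 0"
    and g: "cell B B T (Suc d) e w"
  shows "cdiff B B \<rho> \<phi> e w = 0"
proof -
  have wn: "w \<noteq> []" using g by (auto simp: cell_def)
  have "merge_sum B (\<phi> e) w = merge_sum B (\<lambda>_. 0) w"
    by (rule merge_sum_cong) (use assms in \<open>auto simp: cell_def\<close>)
  moreover have "e + hd w \<in> B \<Longrightarrow> \<phi> (e + hd w) (tl w) = 0"
    using assms(1)[OF cell_tl[OF g]] by simp
  moreover have "e + last w \<in> B \<Longrightarrow> \<phi> (e + last w) (butlast w) = 0"
    using assms(1)[OF cell_butlast[OF g]] by simp
  ultimately show ?thesis using wn by (auto simp: cdiff_def)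
qed

text \<open>Where all components with larger \<open>level e\<close> vanish, exterior faces with a letter other than \<open>1\<close> drop out,
  and the leading component is a cochain of the Ext complex of the simple module.\<close>

lemma cdiff_layer:
  assumes v: "\<And>e' w'. cell B B T d e' w' \<Longrightarrow> level e < level e' \<Longrightarrow> \<phi> e' w' = 0"
    and g: "cell B B T (Suc d) e w" and \<rho>: "\<rho> 0 = 1"
  shows "cdiff B B \<rho> \<phi> e w = cdiff B B1 aug (\<lambda>_. \<phi> e) 0 w"
proof -
  have e: "e \<in> B" using g by (simp add: cell_def)
  have wn: "w \<noteq> []" using g by (auto simp: cell_def)
  have b1: "a \<in> B1 \<longleftrightarrow> a = 0" for a by (auto simp: bas_def zero_prod_def)
  have "(if e + hd w \<in> B then \<phi> (e + hd w) (tl w) else 0) = (if 0 + hd w \<in> B1 then \<phi> e (tl w) else 0)"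
  proof (cases "hd w = 0")
    case False
    then have "0 < level (hd w)" using level_0 by blast
    then show ?thesis using v[OF cell_tl[OF g]] False by (simp add: b1)
  qed (use e in \<open>simp add: b1\<close>)
  moreover have "\<rho> (last w) * (if e + last w \<in> B then \<phi> (e + last w) (butlast w) else 0)
     = aug (last w) * (if 0 + last w \<in> B1 then \<phi> e (butlast w) else 0)"
  proof (cases "last w = 0")
    case False
    then have "0 < level (last w)" using level_0 by blast
    then show ?thesis using v[OF cell_butlast[OF g]] False by (simp add: b1)
  qed (use e \<rho> in \<open>simp add: b1 aug_def\<close>)
  ultimately show ?thesis using wn unfolding cdiff_def by (simp only: if_False mult.assoc)
qed

definition gen_pos :: "nat \<times> nat \<Rightarrow> nat \<Rightarrow> nat \<Rightarrow> nat \<times> nat" where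
  "gen_pos T i j = (fst T - res_deg m i, snd T - res_deg n j)"

lemma in_window_gen_pos: "in_window T i j \<longleftrightarrow> (gen_pos T i j \<in> B \<and> gen_pos T i j + (res_deg m i, res_deg n j) = T)"
  by (auto simp: in_window_def gen_pos_def bas_def prod_eq_iff)

text \<open>\<open>gen_pos T i j\<close> is the leading position of a generator: it vanishes on
  higher levels, and on that level elsewhere. Combinations are therefore triangular for the
  filtration.\<close>

lemma gen_xy_gen_pos:
  assumes "gen_xy \<zeta> \<xi> m n i j w \<noteq> 0" and g: "cell B B T d e w"
  shows "level e \<le> level (gen_pos T i j)" "level e = level (gen_pos T i j) \<Longrightarrow> e = gen_pos T i j \<and> sum_list w = (res_deg m i, res_deg n j)"
  using gen_xy_support[OF assms(1)] cell_sums[OF g] by (auto simp: level_def gen_pos_def prod_eq_iff)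

text \<open>The differential of \<open>z\<close> vanishes above level \<open>N\<close>, so
  generators leading there have coefficient 0, as dual words show. A generator leading at
  \<open>e\<close> would appear in this layer as the coboundary of \<open>z e\<close>; its class is
  nontrivial, so its coefficient is 0 as well.\<close>

lemma layer_cocycle:
  fixes z :: "nat \<times> nat \<Rightarrow> (nat \<times> nat) list \<Rightarrow> 'k::field"
  assumes z: "\<And>e w. cell B B T d e w \<Longrightarrow> N < level e \<Longrightarrow> z e w = 0"
    and \<beta>: "window_supp T \<beta>"
    and Dz: "\<And>e w. cell B B T (Suc d) e w \<Longrightarrow> cdiff B B (bichar \<zeta> \<xi>) z e w = gen_sum \<zeta> \<xi> (Suc d) \<beta> w"
    and e: "e \<in> B" "level e = N" "e + f = T"
  shows "aug_cocycle B B1 d f (\<lambda>_. z e)"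
proof -
  have D: "cdiff B B1 aug (\<lambda>_. z e) 0 w = gen_sum \<zeta> \<xi> (Suc d) \<beta> w" if g: "cell B B T (Suc d) e w" for w
    using cdiff_layer[of T d e z w "bichar \<zeta> \<xi>"] z e g Dz[OF g] by simp
  have \<beta>0: "\<beta> i (Suc d - i) = 0" if i: "i \<le> Suc d" and N: "N < level (gen_pos T i (Suc d - i))" for i
  proof (rule ccontr)
    assume nz: "\<beta> i (Suc d - i) \<noteq> 0"
    then have c: "in_window T i (Suc d - i)" using \<beta> by (auto simp: window_supp_def)
    let ?e = "gen_pos T i (Suc d - i)" and ?w = "gen_word m n i (Suc d - i)"
    have g: "cell B B T (Suc d) ?e ?w"
      using c i by (auto simp: cell_def in_window_gen_pos gen_word_props)
    have "cdiff B B (bichar \<zeta> \<xi>) z ?e ?w = 0"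
      by (rule cdiff_above[OF _ g]) (use z N in auto)
    then show False using Dz[OF g] nz by (simp add: gen_sum_gen_word[OF i])
  qed
  have gen_sum: "\<beta> i (Suc d - i) * gen_xy \<zeta> \<xi> m n i (Suc d - i) w = 0"
    if g: "cell B B T (Suc d) e w" and i: "i \<le> Suc d" "f \<noteq> (res_deg m i, res_deg n (Suc d - i))" for i w
  proof (rule ccontr)
    assume "\<beta> i (Suc d - i) * gen_xy \<zeta> \<xi> m n i (Suc d - i) w \<noteq> 0"
    then have nz: "\<beta> i (Suc d - i) \<noteq> 0" "gen_xy \<zeta> \<xi> m n i (Suc d - i) w \<noteq> 0" by auto
    have "\<not> N < level (gen_pos T i (Suc d - i))" using \<beta>0[OF i(1)] nz(1) by blast
    moreover have "sum_list w = f"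
    proof -
      have "e + sum_list w = e + f" using g e by (simp add: cell_def)
      then show ?thesis by (rule add_left_imp_eq)
    qed
    ultimately show False using gen_xy_gen_pos[OF nz(2) g] e i by auto
  qed
  have gB: "cell B B T (Suc d) e w" and e0: "e' = 0" if "cell B B1 f (Suc d) e' w" for e' w
  proof -
    show "e' = 0" using that by (auto simp: cell_def bas_def zero_prod_def)
    then show "cell B B T (Suc d) e w" using that e by (auto simp: cell_def)
  qed
  show ?thesis
  proof (cases "\<exists>i\<le>Suc d. f = (res_deg m i, res_deg n (Suc d - i))")
    case False
    show ?thesis unfolding aug_cocycle_def
    proof (intro allI impI)
      fix e' w assume g: "cell B B1 f (Suc d) e' w"
      have "gen_sum \<zeta> \<xi> (Suc d) \<beta> w = 0"
        unfolding gen_sum_def by (rule sum.neutral) (use gen_sum[OF gB[OF g]] False in auto)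
      then show "cdiff B B1 aug (\<lambda>_. z e) e' w = 0" using D[OF gB[OF g]] e0[OF g] by simp
    qed
  next
    case True
    then obtain i where i: "i \<le> Suc d" "f = (res_deg m i, res_deg n (Suc d - i))" by blast
    have Gsi: "gen_sum \<zeta> \<xi> (Suc d) \<beta> w = \<beta> i (Suc d - i) * gen_xy \<zeta> \<xi> m n i (Suc d - i) w"
      if g: "cell B B T (Suc d) e w" for w
    proof -
      have "gen_sum \<zeta> \<xi> (Suc d) \<beta> w = (\<Sum>k\<le>Suc d. if k = i then \<beta> i (Suc d - i) * gen_xy \<zeta> \<xi> m n i (Suc d - i) w else 0)"
        unfolding gen_sum_def
      proof (rule sum.cong[OF refl])
        fix k assume k: "k \<in> {..Suc d}"
        show "\<beta> k (Suc d - k) * gen_xy \<zeta> \<xi> m n k (Suc d - k) w =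
          (if k = i then \<beta> i (Suc d - i) * gen_xy \<zeta> \<xi> m n i (Suc d - i) w else 0)"
        proof (cases "k = i")
          case False
          then have "f \<noteq> (res_deg m k, res_deg n (Suc d - k))"
            using i res_deg_mono[OF m2, of i k] res_deg_mono[OF m2, of k i] by (cases "i < k") auto
          then show ?thesis using gen_sum[OF g, of k] k False by simp
        qed simp
      qed
      then show ?thesis using i by simp
    qed
    have "nontriv B (i + (Suc d - i)) B1 f (\<lambda>_. gen_xy \<zeta> \<xi> m n i (Suc d - i))"
      unfolding i(2) by (rule nontriv_gen_xy)
    moreover have "i + (Suc d - i) = Suc d" using i by simp
    ultimately have "nontriv B (Suc d) B1 f (\<lambda>_. gen_xy \<zeta> \<xi> m n i (Suc d - i))" by simp
    moreover have "\<forall>e' w. cell B B1 f (Suc d) e' w \<longrightarrow>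
       \<beta> i (Suc d - i) * gen_xy \<zeta> \<xi> m n i (Suc d - i) w = cdiff B B1 aug (\<lambda>_. z e) e' w"
      using D gB e0 Gsi by metis
    ultimately have "\<beta> i (Suc d - i) = 0" unfolding nontriv_def by blast
    then show ?thesis unfolding aug_cocycle_def using D gB e0 Gsi by (metis mult_zero_left)
  qed
qed

lemma layer_solve:
  fixes z :: "nat \<times> nat \<Rightarrow> (nat \<times> nat) list \<Rightarrow> 'k::field"
  assumes c: "aug_cocycle B B1 d f (\<lambda>_. z e)"
  shows "\<exists>a \<psi>. (\<forall>i. a i \<noteq> 0 \<longrightarrow> i \<le> d \<and> f = (res_deg m i, res_deg n (d - i))) \<and>
    (\<forall>w. cell B B1 f d 0 w \<longrightarrow>
       z e w = (\<Sum>i\<le>d. a i * gen_xy \<zeta> \<xi> m n i (d - i) w) + cdiff B B1 aug \<psi> 0 w)"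
proof (cases "\<exists>i\<le>d. f = (res_deg m i, res_deg n (d - i))")
  case True
  then obtain i where i: "i \<le> d" "f = (res_deg m i, res_deg n (d - i))" by blast
  have "spanned B (i + (d - i)) B1 f (\<lambda>_. gen_xy \<zeta> \<xi> m n i (d - i))"
    unfolding i(2) by (rule spanned_gen_xy)
  then have "spanned B d B1 f (\<lambda>_. gen_xy \<zeta> \<xi> m n i (d - i))" using i(1) by simp
  then obtain a \<psi> where "\<forall>e' w. cell B B1 f d e' w \<longrightarrow>
      z e w = a * gen_xy \<zeta> \<xi> m n i (d - i) w + cdiff B B1 aug \<psi> e' w"
    using c unfolding spanned_def by blast
  moreover have "(\<Sum>k\<le>d. (if k = i then a else 0) * gen_xy \<zeta> \<xi> m n k (d - k) w)
     = a * gen_xy \<zeta> \<xi> m n i (d - i) w" for w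
    using i(1) by (simp add: if_distrib[of "\<lambda>x. x * _"] cong: if_cong)
  ultimately show ?thesis
    using i by (intro exI[of _ "\<lambda>k. if k = i then a else 0"] exI[of _ \<psi>]) auto
next
  case False
  have "spanned B d B1 f (\<lambda>_ _. 0 :: 'k)"
    by (rule spanned_inner_zero) (use False in blast)
  then obtain a \<psi> where "\<forall>e' w. cell B B1 f d e' w \<longrightarrow> z e w = a * 0 + cdiff B B1 aug \<psi> e' w"
    using c unfolding spanned_def by blast
  then show ?thesis
    by (intro exI[of _ "\<lambda>_. 0"] exI[of _ \<psi>]) auto
qed

text \<open>Requiring only that the differential be a combination of generators keeps the induction
  stable: the generators that are subtracted need not be cocycles, but their differentials are such
  combinations.\<close>

lemma layer_induction:
  fixes z :: "nat \<times> nat \<Rightarrow> (nat \<times> nat) list \<Rightarrow> 'k::field"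
  assumes "\<And>e w. cell B B T d e w \<Longrightarrow> N \<le> level e \<Longrightarrow> z e w = 0"
    and "window_supp T \<beta>"
    and "\<And>e w. cell B B T (Suc d) e w \<Longrightarrow> cdiff B B (bichar \<zeta> \<xi>) z e w = gen_sum \<zeta> \<xi> (Suc d) \<beta> w"
  shows "\<exists>\<alpha> \<psi>. window_supp T \<alpha> \<and> (\<forall>e w. cell B B T d e w \<longrightarrow>
    z e w = gen_sum \<zeta> \<xi> d \<alpha> w + cdiff B B (bichar \<zeta> \<xi>) \<psi> e w)"
  using assms
proof (induction N arbitrary: z \<beta>)
  case 0
  then show ?case
    by (intro exI[of _ "\<lambda>_ _. 0"] exI[of _ "\<lambda>_ _. 0"]) (auto simp: window_supp_def gen_sum_def)
next
  case (Suc N)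
  define P where "P e a \<psi> \<longleftrightarrow> (\<forall>i. a i \<noteq> 0 \<longrightarrow> i \<le> d \<and> T = e + (res_deg m i, res_deg n (d - i))) \<and>
    (\<forall>w. cell B B T d e w \<longrightarrow>
       z e w = (\<Sum>i\<le>d. a i * gen_xy \<zeta> \<xi> m n i (d - i) w) + cdiff B B1 aug \<psi> 0 w)" for e a \<psi>
  have "\<exists>a \<psi>. P e a \<psi>" if e: "e \<in> B" "level e = N" for e
  proof (cases "\<exists>f. e + f = T")
    case True
    then obtain f where f: "e + f = T" by blast
    have "aug_cocycle B B1 d f (\<lambda>_. z e)"
      by (rule layer_cocycle[where T = T and N = N and \<beta> = \<beta> and \<zeta> = \<zeta> and \<xi> = \<xi>])
        (use Suc.prems e f in auto)
    from layer_solve[of d f z e \<zeta> \<xi>, OF this] obtain a \<psi> where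
      a: "\<forall>i. a i \<noteq> 0 \<longrightarrow> i \<le> d \<and> f = (res_deg m i, res_deg n (d - i))" and
      \<psi>: "\<forall>w. cell B B1 f d 0 w \<longrightarrow> z e w = (\<Sum>i\<le>d. a i * gen_xy \<zeta> \<xi> m n i (d - i) w) + cdiff B B1 aug \<psi> 0 w"
      by blast
    have "cell B B1 f d 0 w" if "cell B B T d e w" for w
    proof -
      have "e + sum_list w = e + f" using that f by (simp add: cell_def)
      then have "sum_list w = f" by (rule add_left_imp_eq)
      then show ?thesis using that by (auto simp: cell_def bas_def zero_prod_def)
    qed
    then have "P e a \<psi>" unfolding P_def using a \<psi> f by blast
    then show ?thesis by blast
  next
    case False
    then have "\<not> cell B B T d e w" for w by (auto simp: cell_def)
    then have "P e (\<lambda>_. 0) (\<lambda>_ _. 0)" unfolding P_def by auto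
    then show ?thesis by blast
  qed
  then obtain a \<psi>0 where P: "\<And>e. e \<in> B \<Longrightarrow> level e = N \<Longrightarrow> P e (a e) (\<psi>0 e)" by metis
  \<comment> \<open>Each generator is credited to the layer in which it leads, with the coefficient
    found at its leading position.\<close>
  define \<alpha> where "\<alpha> i j = (if in_window T i j \<and> level (gen_pos T i j) = N then a (gen_pos T i j) i else 0)" for i j
  define \<psi> where "\<psi> e w = (if level e = N then \<psi>0 e 0 w else 0)" for e w
  have \<alpha>: "window_supp T \<alpha>" by (auto simp: window_supp_def \<alpha>_def)
  define z' where "z' e w = z e w - gen_sum \<zeta> \<xi> d \<alpha> w - cdiff B B (bichar \<zeta> \<xi>) \<psi> e w" for e w
  have "z' e w = 0" if g: "cell B B T d e w" and N: "N \<le> level e" for e w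
  proof (cases "level e = N")
    case True
    have e: "e \<in> B" using g by (simp add: cell_def)
    note Pe = P[OF e True, unfolded P_def]
    have "gen_sum \<zeta> \<xi> d \<alpha> w = (\<Sum>i\<le>d. a e i * gen_xy \<zeta> \<xi> m n i (d - i) w)"
      unfolding gen_sum_def
    proof (rule sum.cong[OF refl])
      fix i assume i: "i \<in> {..d}"
      show "\<alpha> i (d - i) * gen_xy \<zeta> \<xi> m n i (d - i) w = a e i * gen_xy \<zeta> \<xi> m n i (d - i) w"
      proof (cases "gen_xy \<zeta> \<xi> m n i (d - i) w = 0")
        case False
        note G = gen_xy_gen_pos[OF False g]
        show ?thesis
        proof (cases "level (gen_pos T i (d - i)) = N")
          case t: True
          then have ep: "e = gen_pos T i (d - i)" "sum_list w = (res_deg m i, res_deg n (d - i))" using G True by auto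
          then have "in_window T i (d - i)" using g by (auto simp: in_window_gen_pos cell_def)
          then show ?thesis using t by (simp add: \<alpha>_def ep(1))
        next
          case f: False
          have "a e i = 0"
          proof (rule ccontr)
            assume "a e i \<noteq> 0"
            then have "T = e + (res_deg m i, res_deg n (d - i))" using Pe by blast
            then have "gen_pos T i (d - i) = e" by (simp add: gen_pos_def prod_eq_iff)
            then show False using f True by simp
          qed
          then show ?thesis using f by (simp add: \<alpha>_def)
        qed
      qed simp
    qed
    moreover have "cdiff B B (bichar \<zeta> \<xi>) \<psi> e w = cdiff B B1 aug (\<psi>0 e) 0 w"
    proof (cases d)
      case 0
      then show ?thesis using g by (simp add: cell_def)
    next
      case (Suc d')
      have b1: "x \<in> B1 \<longleftrightarrow> x = 0" for x by (auto simp: bas_def zero_prod_def)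
      have "cdiff B B (bichar \<zeta> \<xi>) \<psi> e w = cdiff B B1 aug (\<lambda>_. \<psi> e) 0 w"
        by (rule cdiff_layer[of T d']) (use g Suc True in \<open>auto simp: \<psi>_def\<close>)
      also have "(\<lambda>_. \<psi> e) = (\<lambda>_ :: nat \<times> nat. \<psi>0 e 0)" using True by (intro ext) (simp add: \<psi>_def)
      also have "cdiff B B1 aug (\<lambda>_. \<psi>0 e 0) 0 w = cdiff B B1 aug (\<psi>0 e) 0 w"
        by (rule cdiff_cong) (use g in \<open>auto simp: b1 cell_def\<close>)
      finally show ?thesis .
    qed
    ultimately show ?thesis using Pe g by (simp add: z'_def)
  next
    case False
    then have lt: "N < level e" using N by simp
    have "gen_sum \<zeta> \<xi> d \<alpha> w = 0"
      unfolding gen_sum_def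
    proof (rule sum.neutral, rule ballI)
      fix i
      show "\<alpha> i (d - i) * gen_xy \<zeta> \<xi> m n i (d - i) w = 0"
      proof (cases "gen_xy \<zeta> \<xi> m n i (d - i) w = 0")
        case f: False
        then show ?thesis using gen_xy_gen_pos(1)[OF f g] lt by (simp add: \<alpha>_def)
      qed simp
    qed
    moreover have "cdiff B B (bichar \<zeta> \<xi>) \<psi> e w = 0"
    proof (cases d)
      case 0
      then show ?thesis using g by (simp add: cell_def)
    next
      case (Suc d')
      show ?thesis by (rule cdiff_above[of T d']) (use g Suc lt in \<open>auto simp: \<psi>_def\<close>)
    qed
    ultimately show ?thesis using Suc.prems(1)[OF g] lt by (simp add: z'_def)
  qed
  moreover have "window_supp T (\<lambda>i j. \<beta> i j - small_diff \<zeta> \<xi> T \<alpha> i j)"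
    using Suc.prems(2) window_supp_small_diff[of T \<zeta> \<xi> \<alpha>] unfolding window_supp_def by (metis diff_0_right)
  moreover have "cdiff B B (bichar \<zeta> \<xi>) z' e w = gen_sum \<zeta> \<xi> (Suc d) (\<lambda>i j. \<beta> i j - small_diff \<zeta> \<xi> T \<alpha> i j) w"
    if g: "cell B B T (Suc d) e w" for e w
  proof -
    have "cdiff B B (bichar \<zeta> \<xi>) z' e w = cdiff B B (bichar \<zeta> \<xi>) z e w - cdiff B B (bichar \<zeta> \<xi>) (\<lambda>_. gen_sum \<zeta> \<xi> d \<alpha>) e w
       - cdiff B B (bichar \<zeta> \<xi>) (cdiff B B (bichar \<zeta> \<xi>) \<psi>) e w"
      unfolding z'_def cdiff_diff by (rule refl)
    also have "cdiff B B (bichar \<zeta> \<xi>) (cdiff B B (bichar \<zeta> \<xi>) \<psi>) e w = 0"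
      by (intro cdiff_cdiff downset_bas mult_char_bichar) auto
    finally show ?thesis
      using Suc.prems(3)[OF g] by (simp add: cdiff_gen_sum[OF g \<alpha>] gen_sum_diff)
  qed
  ultimately have "\<exists>\<alpha>' \<psi>'. window_supp T \<alpha>' \<and> (\<forall>e w. cell B B T d e w \<longrightarrow>
      z' e w = gen_sum \<zeta> \<xi> d \<alpha>' w + cdiff B B (bichar \<zeta> \<xi>) \<psi>' e w)"
    by (rule Suc.IH)
  then obtain \<alpha>' \<psi>' where s: "window_supp T \<alpha>'" "\<And>e w. cell B B T d e w \<Longrightarrow>
      z' e w = gen_sum \<zeta> \<xi> d \<alpha>' w + cdiff B B (bichar \<zeta> \<xi>) \<psi>' e w" by blast
  have "window_supp T (\<lambda>i j. \<alpha> i j + \<alpha>' i j)"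
    using \<alpha> s(1) unfolding window_supp_def by (metis add_0_left)
  moreover have "z e w = gen_sum \<zeta> \<xi> d (\<lambda>i j. \<alpha> i j + \<alpha>' i j) w + cdiff B B (bichar \<zeta> \<xi>) (\<lambda>e w. \<psi> e w + \<psi>' e w) e w"
    if "cell B B T d e w" for e w
    using s(2)[OF that] by (simp add: z'_def gen_sum_add cdiff_add algebra_simps)
  ultimately show ?case by blast
qed

theorem cocycle_normal_form:
  fixes z :: "nat \<times> nat \<Rightarrow> (nat \<times> nat) list \<Rightarrow> 'k::field"
  assumes "\<And>e w. cell B B T (Suc d) e w \<Longrightarrow> cdiff B B (bichar \<zeta> \<xi>) z e w = 0"
  obtains \<alpha> \<psi> where "window_supp T \<alpha>" "\<And>i. i \<le> Suc d \<Longrightarrow> small_diff \<zeta> \<xi> T \<alpha> i (Suc d - i) = 0"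
    "\<And>e w. cell B B T d e w \<Longrightarrow> z e w = gen_sum \<zeta> \<xi> d \<alpha> w + cdiff B B (bichar \<zeta> \<xi>) \<psi> e w"
proof -
  have "\<exists>\<alpha> \<psi>. window_supp T \<alpha> \<and> (\<forall>e w. cell B B T d e w \<longrightarrow>
    z e w = gen_sum \<zeta> \<xi> d \<alpha> w + cdiff B B (bichar \<zeta> \<xi>) \<psi> e w)"
  \<comment> \<open>Every basis monomial has level below \<open>m + n\<close>, so the vanishing
    condition is empty at the start.\<close>
  proof (rule layer_induction[where N = "m + n" and \<beta> = "\<lambda>_ _. 0"])
    fix e w assume "cell B B T d e w" "m + n \<le> level e"
    then show "z e w = 0" by (auto simp: cell_def bas_def level_def)
  qed (use assms in \<open>auto simp: window_supp_def gen_sum_def\<close>)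
  then obtain \<alpha> \<psi> where \<alpha>: "window_supp T \<alpha>"
    and z: "\<And>e w. cell B B T d e w \<Longrightarrow> z e w = gen_sum \<zeta> \<xi> d \<alpha> w + cdiff B B (bichar \<zeta> \<xi>) \<psi> e w" by blast
  have "small_diff \<zeta> \<xi> T \<alpha> i (Suc d - i) = 0" if i: "i \<le> Suc d" for i
  proof (rule ccontr)
    assume nz: "small_diff \<zeta> \<xi> T \<alpha> i (Suc d - i) \<noteq> 0"
    then have c: "in_window T i (Suc d - i)" using window_supp_small_diff unfolding window_supp_def by blast
    let ?e = "gen_pos T i (Suc d - i)" and ?w = "gen_word m n i (Suc d - i)"
    have g: "cell B B T (Suc d) ?e ?w"
      using c i by (auto simp: cell_def in_window_gen_pos gen_word_props)
    have "cdiff B B (bichar \<zeta> \<xi>) z ?e ?w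
        = cdiff B B (bichar \<zeta> \<xi>) (\<lambda>e w. gen_sum \<zeta> \<xi> d \<alpha> w + cdiff B B (bichar \<zeta> \<xi>) \<psi> e w) ?e ?w"
      by (rule cdiff_cell_cong[OF z g])
    also have "\<dots> = gen_sum \<zeta> \<xi> (Suc d) (small_diff \<zeta> \<xi> T \<alpha>) ?w + cdiff B B (bichar \<zeta> \<xi>) (cdiff B B (bichar \<zeta> \<xi>) \<psi>) ?e ?w"
      by (simp only: cdiff_add cdiff_gen_sum[OF g \<alpha>])
    also have "cdiff B B (bichar \<zeta> \<xi>) (cdiff B B (bichar \<zeta> \<xi>) \<psi>) ?e ?w = 0"
      by (intro cdiff_cdiff downset_bas mult_char_bichar) auto
    finally show False using assms[OF g] nz by (simp add: gen_sum_gen_word[OF i])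
  qed
  then show thesis using that \<alpha> z by blast
qed

end

section \<open>Exactness of the small complex\<close>

text \<open>Since \<open>res_deg M i + M\<close> is \<open>res_deg M (i + 2)\<close>, the windows
  that contain \<open>t\<close> belong to the last index of degree at most \<open>t\<close> and to
  its predecessor. The predecessor exists because \<open>t\<close> is positive.\<close>

lemma res_deg_window:
  assumes M: "2 \<le> M" and t: "0 < t"
  obtains i0 where "\<And>i. res_deg M i \<le> t \<and> t < res_deg M i + M \<longleftrightarrow> i = i0 \<or> i = Suc i0"
proof -
  have sm: "strict_mono (res_deg M)" using res_deg_mono[OF M] by (auto simp: strict_mono_def)
  have fin: "finite {i. res_deg M i \<le> t}"
  proof (rule finite_subset)
    show "{i. res_deg M i \<le> t} \<subseteq> {..t}"
      using strict_mono_imp_increasing[OF sm] by (auto intro: order_trans)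
  qed simp
  define k where "k = Max {i. res_deg M i \<le> t}"
  have k: "res_deg M i \<le> t \<longleftrightarrow> i \<le> k" for i
  proof
    assume "res_deg M i \<le> t" then show "i \<le> k" unfolding k_def using fin by (auto intro: Max_ge)
  next
    assume "i \<le> k"
    moreover have "res_deg M k \<le> t"
    proof -
      have "0 \<in> {i. res_deg M i \<le> t}" by simp
      then have "Max {i. res_deg M i \<le> t} \<in> {i. res_deg M i \<le> t}" using Max_in[OF fin] by blast
      then show ?thesis by (simp add: k_def)
    qed
    ultimately show "res_deg M i \<le> t" using strict_mono_less_eq[OF sm, of i k] by simp
  qed
  have "1 \<le> k" using k[of "Suc 0"] t by simp
  then obtain i0 where i0: "k = Suc i0" by (cases k) auto
  have "res_deg M i \<le> t \<and> t < res_deg M i + M \<longleftrightarrow> i = i0 \<or> i = Suc i0" for i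
    using k[of i] k[of "Suc (Suc i)"] i0 by auto
  then show thesis by (rule that)
qed

context quantum_ci
begin

lemma in_window_Suc_fst:
  assumes "\<And>i. res_deg m i \<le> fst T \<and> fst T < res_deg m i + m \<longleftrightarrow> i = i0 \<or> i = Suc i0"
  shows "in_window T i j \<longleftrightarrow> (i = i0 \<or> i = Suc i0) \<and> res_deg n j \<le> snd T \<and> snd T < res_deg n j + n"
  using assms[of i] by (auto simp: in_window_def)

lemma in_window_Suc_snd:
  assumes "\<And>j. res_deg n j \<le> snd T \<and> snd T < res_deg n j + n \<longleftrightarrow> j = j0 \<or> j = Suc j0"
  shows "in_window T i j \<longleftrightarrow> (j = j0 \<or> j = Suc j0) \<and> res_deg m i \<le> fst T \<and> fst T < res_deg m i + m"
  using assms[of j] by (auto simp: in_window_def)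

text \<open>Only the columns \<open>i0\<close> and \<open>Suc i0\<close> meet the window, and the
  scalar \<open>res_coeff \<zeta> m i0\<close> between them is invertible; dividing by it gives a
  contraction.\<close>

lemma exact_fst:
  assumes \<alpha>: "window_supp T \<alpha>" and co: "\<And>i. i \<le> Suc d \<Longrightarrow> small_diff \<zeta> \<xi> T \<alpha> i (Suc d - i) = 0"
    and T: "0 < fst T" and k: "\<And>i. res_coeff \<zeta> m i \<noteq> 0"
  obtains \<gamma> where "window_supp T \<gamma>" "\<And>i. i \<le> d \<Longrightarrow> \<alpha> i (d - i) = small_diff \<zeta> \<xi> T \<gamma> i (d - i)"
proof -
  obtain i0 where i0: "\<And>i. res_deg m i \<le> fst T \<and> fst T < res_deg m i + m \<longleftrightarrow> i = i0 \<or> i = Suc i0"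
    using res_deg_window[OF m2 T] by blast
  note cr = in_window_Suc_fst[OF i0]
  define \<gamma> where "\<gamma> i j = (if i = i0 then \<alpha> (Suc i0) j / res_coeff \<zeta> m i0 else 0)" for i j
  have "window_supp T \<gamma>"
    using \<alpha> by (auto simp: window_supp_def \<gamma>_def cr)
  moreover have "\<alpha> i (d - i) = small_diff \<zeta> \<xi> T \<gamma> i (d - i)" if i: "i \<le> d" for i
  proof (cases "in_window T i (d - i)")
    case False
    then show ?thesis using \<alpha> by (auto simp: window_supp_def small_diff_def)
  next
    case True
    then consider "i = Suc i0" | "i = i0" using cr by blast
    then show ?thesis
    proof cases
      case 1
      then show ?thesis using True k[of i0] by (simp add: small_diff_def \<gamma>_def)
    next
      case 2
      have c': "in_window T (Suc i0) (d - i0)" using True 2 by (simp add: cr)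
      have s: "Suc d - Suc i0 = d - i0" by simp
      \<comment> \<open>The cocycle condition in column \<open>Suc i0\<close> expresses column
        \<open>i0\<close> through column \<open>Suc i0\<close>, so the same \<open>\<gamma>\<close>
        also produces column \<open>i0\<close>.\<close>
      have e: "res_coeff \<zeta> m i0 * \<alpha> i0 (d - i0) =
          (if d - i0 = 0 then 0 else (-1) ^ i0 * res_coeff \<xi> n (d - i0 - 1) * \<alpha> (Suc i0) (d - i0 - 1))"
        using co[of "Suc i0"] i 2 c' unfolding s small_diff_def by (auto simp: eq_neg_iff_add_eq_0 split: if_splits)
      have "\<alpha> i0 (d - i0) = (res_coeff \<zeta> m i0 * \<alpha> i0 (d - i0)) / res_coeff \<zeta> m i0"
        using k[of i0] by simp
      also have "\<dots> = small_diff \<zeta> \<xi> T \<gamma> i0 (d - i0)"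
        unfolding e using True 2 by (auto simp: small_diff_def \<gamma>_def)
      finally show ?thesis using 2 by simp
    qed
  qed
  ultimately show thesis by (rule that)
qed

lemma exact_snd:
  assumes \<alpha>: "window_supp T \<alpha>" and co: "\<And>i. i \<le> Suc d \<Longrightarrow> small_diff \<zeta> \<xi> T \<alpha> i (Suc d - i) = 0"
    and T: "0 < snd T" and k: "\<And>j. res_coeff \<xi> n j \<noteq> 0"
  obtains \<gamma> where "window_supp T \<gamma>" "\<And>i. i \<le> d \<Longrightarrow> \<alpha> i (d - i) = small_diff \<zeta> \<xi> T \<gamma> i (d - i)"
proof -
  obtain j0 where j0: "\<And>j. res_deg n j \<le> snd T \<and> snd T < res_deg n j + n \<longleftrightarrow> j = j0 \<or> j = Suc j0"
    using res_deg_window[OF n2 T] by blast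
  note cr = in_window_Suc_snd[OF j0]
  \<comment> \<open>The sign cancels the \<open>(-1) ^ i\<close> of the differential in the
    \<open>y\<close>-direction.\<close>
  define \<gamma> where "\<gamma> i j = (if j = j0 then (-1) ^ i * \<alpha> i (Suc j0) / res_coeff \<xi> n j0 else 0)" for i j
  have "window_supp T \<gamma>"
    using \<alpha> by (auto simp: window_supp_def \<gamma>_def cr)
  moreover have "\<alpha> i (d - i) = small_diff \<zeta> \<xi> T \<gamma> i (d - i)" if i: "i \<le> d" for i
  proof (cases "in_window T i (d - i)")
    case False
    then show ?thesis using \<alpha> by (auto simp: window_supp_def small_diff_def)
  next
    case True
    have sq: "(-1) ^ i * ((-1) ^ i * x) = x" for x :: 'a
      by (simp flip: mult.assoc power_add)
    from True consider "d - i = Suc j0" | "d - i = j0" using cr by blast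
    then show ?thesis
    proof cases
      case 1
      then show ?thesis using True k[of j0] sq by (simp add: small_diff_def \<gamma>_def)
    next
      case 2
      have c': "in_window T i (Suc j0)" using True 2 by (simp add: cr)
      have s: "Suc d - i = Suc j0" using 2 i by simp
      have e: "(-1) ^ i * (res_coeff \<xi> n j0 * \<alpha> i j0) = - (if i = 0 then 0 else res_coeff \<zeta> m (i - 1) * \<alpha> (i - 1) (Suc j0))"
        using co[of i] i c' unfolding s small_diff_def by (auto simp: eq_neg_iff_add_eq_0 algebra_simps split: if_splits)
      have "\<alpha> i j0 = (-1) ^ i * ((-1) ^ i * (res_coeff \<xi> n j0 * \<alpha> i j0)) / res_coeff \<xi> n j0"
        using k[of j0] by (simp add: sq)
      also have "\<dots> = small_diff \<zeta> \<xi> T \<gamma> i j0"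
        unfolding e using True 2 by (cases i) (auto simp: small_diff_def \<gamma>_def)
      finally show ?thesis using 2 by simp
    qed
  qed
  ultimately show thesis by (rule that)
qed

lemma acyclic_weight:
  fixes z :: "nat \<times> nat \<Rightarrow> (nat \<times> nat) list \<Rightarrow> 'k::field"
  assumes co: "\<And>e w. cell B B T (Suc d) e w \<Longrightarrow> cdiff B B (bichar \<zeta> \<xi>) z e w = 0"
    and T: "0 < fst T \<and> (\<forall>i. res_coeff \<zeta> m i \<noteq> 0) \<or> 0 < snd T \<and> (\<forall>j. res_coeff \<xi> n j \<noteq> 0) \<or> T = 0 \<and> 0 < d"
  shows "\<exists>\<psi>. \<forall>e w. cell B B T d e w \<longrightarrow> z e w = cdiff B B (bichar \<zeta> \<xi>) \<psi> e w"
proof -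
  obtain \<alpha> \<psi> where \<alpha>: "window_supp T \<alpha>" and c: "\<And>i. i \<le> Suc d \<Longrightarrow> small_diff \<zeta> \<xi> T \<alpha> i (Suc d - i) = 0"
    and z: "\<And>e w. cell B B T d e w \<Longrightarrow> z e w = gen_sum \<zeta> \<xi> d \<alpha> w + cdiff B B (bichar \<zeta> \<xi>) \<psi> e w"
    using cocycle_normal_form[OF co] by blast
  obtain \<gamma> where \<gamma>: "window_supp T \<gamma>" "\<And>i. i \<le> d \<Longrightarrow> \<alpha> i (d - i) = small_diff \<zeta> \<xi> T \<gamma> i (d - i)"
  proof -
    show thesis
      using T
    proof (elim disjE conjE)
      assume k: "0 < fst T" "\<forall>i. res_coeff \<zeta> m i \<noteq> 0"
      show thesis
        by (rule exact_fst[OF \<alpha> c k(1) spec[OF k(2)]]) (assumption | rule that)+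
    next
      assume k: "0 < snd T" "\<forall>j. res_coeff \<xi> n j \<noteq> 0"
      show thesis
        by (rule exact_snd[OF \<alpha> c k(1) spec[OF k(2)]]) (assumption | rule that)+
    next
      \<comment> \<open>At \<open>T = 0\<close> the window contains only the generator
        \<open>(0, 0)\<close>, of cohomological degree 0.\<close>
      assume 3: "T = 0" "0 < d"
      have "\<alpha> i (d - i) = 0" if "i \<le> d" for i
      proof (rule ccontr)
        assume "\<alpha> i (d - i) \<noteq> 0"
        then have "in_window 0 i (d - i)" using \<alpha> 3 by (auto simp: window_supp_def)
        then have "res_deg m i \<le> 0" "res_deg n (d - i) \<le> 0" by (auto simp: in_window_def)
        moreover have "0 < i \<or> 0 < d - i" using 3 by auto
        ultimately show False using res_deg_mono[OF m2, of 0 i] res_deg_mono[OF n2, of 0 "d - i"] by auto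
      qed
      then show thesis by (intro that[of "\<lambda>_ _. 0"]) (auto simp: window_supp_def small_diff_def)
    qed
  qed
  have gen_sum: "gen_sum \<zeta> \<xi> d \<alpha> w = gen_sum \<zeta> \<xi> d (small_diff \<zeta> \<xi> T \<gamma>) w" for w
    unfolding gen_sum_def by (rule sum.cong[OF refl]) (use \<gamma>(2) in auto)
  show ?thesis
  proof (cases d)
    case 0
    have "z e w = cdiff B B (bichar \<zeta> \<xi>) \<psi> e w" if "cell B B T d e w" for e w
      using z[OF that] by (simp add: gen_sum) (simp add: gen_sum_def small_diff_def 0)
    then show ?thesis by blast
  next
    case (Suc d')
    have "z e w = cdiff B B (bichar \<zeta> \<xi>) (\<lambda>e w. gen_sum \<zeta> \<xi> d' \<gamma> w + \<psi> e w) e w" if g: "cell B B T d e w" for e w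
      using z[OF g] cdiff_gen_sum[of T d' e w \<gamma> \<zeta> \<xi>] g \<gamma>(1) Suc by (simp add: cdiff_add gen_sum[unfolded Suc])
    then show ?thesis by blast
  qed
qed

end

section \<open>From Hochschild cochains to scalar cochains\<close>

text \<open>The power of \<open>q\<close> in the product of a word of monomials. Dividing by it makes the product commutative.\<close>

fun order_coeff :: "'k::field \<Rightarrow> (nat \<times> nat) list \<Rightarrow> 'k" where
  "order_coeff q [] = 1"
| "order_coeff q (a # w) = q ^ (snd a * fst (sum_list w)) * order_coeff q w"

lemma order_coeff_nz: "q \<noteq> 0 \<Longrightarrow> order_coeff q w \<noteq> 0"
  by (induction w) auto

lemma order_coeff_snoc: "order_coeff q (w @ [a]) = order_coeff q w * q ^ (snd (sum_list w) * fst a)"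
  by (induction w) (auto simp: power_add algebra_simps)

lemma mc_sum_right:
  "(\<Sum>g\<in>bas m n. mc m n q a b g * F g) = (if a + b \<in> bas m n then q ^ (snd a * fst b) * F (a + b) else 0)"
proof -
  have ab: "(fst a + fst b, snd a + snd b) = a + b" by (simp add: prod_eq_iff)
  have "a + b \<in> bas m n \<longleftrightarrow> fst a + fst b < m \<and> snd a + snd b < n"
    by (simp add: bas_def mem_Times_iff)
  then have "(\<Sum>g\<in>bas m n. mc m n q a b g * F g)
      = (\<Sum>g\<in>bas m n. if g = a + b then q ^ (snd a * fst b) * F (a + b) else 0)"
    by (intro sum.cong[OF refl]) (auto simp: mc_def ab)
  then show ?thesis by (simp add: bas_def)
qed

context quantum_ci
begin

definition compl_deg :: "nat \<times> nat \<Rightarrow> nat \<times> nat" where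
  "compl_deg e = (m - 1 - fst e, n - 1 - snd e)"

lemma compl_deg_compl_deg: "e \<in> B \<Longrightarrow> compl_deg (compl_deg e) = e"
  by (auto simp: compl_deg_def bas_def prod_eq_iff)

lemma compl_deg_bas: "compl_deg e \<in> B"
  using m2 n2 by (auto simp: compl_deg_def bas_def)

text \<open>Complements express the Frobenius duality of the algebra: removing a factor
  \<open>a\<close> from the output, on either side, adds \<open>a\<close> to the complement. Thus
  both outer faces raise \<open>e\<close>.\<close>

lemma mc_compl_deg:
  assumes "e \<in> B"
  shows "mc m n q a c (compl_deg e) = (if e + a \<in> B \<and> c = compl_deg (e + a) then q ^ (snd a * fst c) else 0)"
    and "mc m n q c a (compl_deg e) = (if e + a \<in> B \<and> c = compl_deg (e + a) then q ^ (snd c * fst a) else 0)"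
proof -
  have *: "y + z < M \<and> M - 1 - x = y + z \<longleftrightarrow> x + y < M \<and> z = M - 1 - (x + y)"
    if "x < M" for x y z M :: nat
    using that by auto
  have c: "fst a + fst c < m \<and> snd a + snd c < n \<and> compl_deg e = (fst a + fst c, snd a + snd c)
      \<longleftrightarrow> e + a \<in> B \<and> c = compl_deg (e + a)"
    using *[of "fst e" m "fst a" "fst c"] *[of "snd e" n "snd a" "snd c"] assms
    unfolding compl_deg_def bas_def mem_Times_iff prod_eq_iff by (simp del: split_paired_all) blast
  show "mc m n q a c (compl_deg e) = (if e + a \<in> B \<and> c = compl_deg (e + a) then q ^ (snd a * fst c) else 0)"
    unfolding mc_def c by (rule refl)
  show "mc m n q c a (compl_deg e) = (if e + a \<in> B \<and> c = compl_deg (e + a) then q ^ (snd c * fst a) else 0)"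
    unfolding mc_def c[symmetric] by (simp only: add.commute[of "fst c"] add.commute[of "snd c"])
qed

lemma finB: "finite B"
  by (simp add: bas_def)

lemma mc_sum_compl_deg:
  assumes "e \<in> B"
  shows "(\<Sum>c\<in>B. mc m n q a c (compl_deg e) * F c)
      = (if e + a \<in> B then q ^ (snd a * fst (compl_deg (e + a))) * F (compl_deg (e + a)) else 0)"
    and "(\<Sum>c\<in>B. F c * mc m n q c a (compl_deg e))
      = (if e + a \<in> B then F (compl_deg (e + a)) * q ^ (snd (compl_deg (e + a)) * fst a) else 0)"
proof -
  have "(\<Sum>c\<in>B. mc m n q a c (compl_deg e) * F c)
     = (\<Sum>c\<in>B. if c = compl_deg (e + a) then (if e + a \<in> B then q ^ (snd a * fst (compl_deg (e + a))) * F (compl_deg (e + a)) else 0) else 0)"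
    by (rule sum.cong[OF refl]) (simp add: mc_compl_deg(1)[OF assms])
  then show "(\<Sum>c\<in>B. mc m n q a c (compl_deg e) * F c)
      = (if e + a \<in> B then q ^ (snd a * fst (compl_deg (e + a))) * F (compl_deg (e + a)) else 0)"
    using finB compl_deg_bas by simp
  have "(\<Sum>c\<in>B. F c * mc m n q c a (compl_deg e))
     = (\<Sum>c\<in>B. if c = compl_deg (e + a) then (if e + a \<in> B then F (compl_deg (e + a)) * q ^ (snd (compl_deg (e + a)) * fst a) else 0) else 0)"
    by (rule sum.cong[OF refl]) (simp add: mc_compl_deg(2)[OF assms])
  then show "(\<Sum>c\<in>B. F c * mc m n q c a (compl_deg e))
      = (if e + a \<in> B then F (compl_deg (e + a)) * q ^ (snd (compl_deg (e + a)) * fst a) else 0)"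
    using finB compl_deg_bas by simp
qed

definition scaled_merge_sum :: "'k::field \<Rightarrow> ((nat \<times> nat) list \<Rightarrow> 'k) \<Rightarrow> (nat \<times> nat) list \<Rightarrow> 'k" where
  "scaled_merge_sum q f w = (\<Sum>i\<in>{1..<length w}. (-1) ^ i *
     (\<Sum>g\<in>B. mc m n q (w ! (i - 1)) (w ! i) g * f (take (i - 1) w @ g # drop (i + 1) w)))"

lemma scaled_merge_sum_Cons:
  "scaled_merge_sum q f (a # b # l) =
    - (if a + b \<in> B then q ^ (snd a * fst b) * f ((a + b) # l) else 0) - scaled_merge_sum q (\<lambda>l. f (a # l)) (b # l)"
proof -
  let ?F = "\<lambda>i. (-1) ^ i * (\<Sum>g\<in>B. mc m n q ((a # b # l) ! (i - 1)) ((a # b # l) ! i) g *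
      f (take (i - 1) (a # b # l) @ g # drop (i + 1) (a # b # l)))"
  have len: "length (a # b # l) = Suc (Suc (length l))" by simp
  have "scaled_merge_sum q f (a # b # l) = ?F 1 + (\<Sum>i\<in>{Suc 1..<Suc (Suc (length l))}. ?F i)"
    unfolding scaled_merge_sum_def len by (rule sum.atLeast_Suc_lessThan) simp
  also have "?F 1 = - (if a + b \<in> B then q ^ (snd a * fst b) * f ((a + b) # l) else 0)"
    by (simp add: mc_sum_right)
  also have "(\<Sum>i\<in>{Suc 1..<Suc (Suc (length l))}. ?F i) = (\<Sum>i\<in>{1..<Suc (length l)}. ?F (Suc i))"
    by (rule sum.shift_bounds_Suc_ivl)
  also have "\<dots> = - scaled_merge_sum q (\<lambda>l. f (a # l)) (b # l)"
    unfolding scaled_merge_sum_def sum_negf[symmetric]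
  proof (rule sum.cong)
    fix i assume "i \<in> {1..<length (b # l)}"
    then obtain k where "i = Suc k" by (cases i) auto
    then show "?F (Suc i) = - ((-1) ^ i * (\<Sum>g\<in>B. mc m n q ((b # l) ! (i - 1)) ((b # l) ! i) g *
      f (a # take (i - 1) (b # l) @ g # drop (i + 1) (b # l))))"
      by simp
  qed simp
  finally show ?thesis by simp
qed

text \<open>Merging \<open>a\<close> and \<open>b\<close> strips exactly
  \<open>q ^ (snd a * fst b)\<close> from \<open>order_coeff\<close>, while the powers due to
  earlier letters depend only on the total degree of what follows. One rescaling therefore untwists
  all merges.\<close>

lemma scaled_merge_sum_merge_sum:
  assumes q: "q \<noteq> 0" and "set w \<subseteq> B"
  shows "scaled_merge_sum q f w = - order_coeff q w * merge_sum B (\<lambda>l. f l / order_coeff q l) w"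
  using assms(2)
proof (induction w arbitrary: f rule: induct_list012)
  case (3 a b l)
  have w: "merge_sum B (\<lambda>l'. f (a # l') / order_coeff q (a # l')) (b # l)
     = 1 / q ^ (snd a * fst (sum_list (b # l))) * merge_sum B (\<lambda>l'. f (a # l') / order_coeff q l') (b # l)"
    using merge_sum_weight[of "b # l" B "\<lambda>s. 1 / q ^ (snd a * fst s)" "\<lambda>l'. f (a # l') / order_coeff q l'"] 3(3)
    by simp
  have o: "order_coeff q (a # b # l) = q ^ (snd a * fst b) * order_coeff q ((a + b) # l)"
    by (simp add: power_add algebra_simps)
  have "scaled_merge_sum q f (a # b # l) = - (if a + b \<in> B then q ^ (snd a * fst b) * f ((a + b) # l) else 0)
      + order_coeff q (b # l) * merge_sum B (\<lambda>l'. f (a # l') / order_coeff q l') (b # l)"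
    using 3 by (simp add: scaled_merge_sum_Cons)
  also have "order_coeff q (b # l) * merge_sum B (\<lambda>l'. f (a # l') / order_coeff q l') (b # l)
     = order_coeff q (a # b # l) * merge_sum B (\<lambda>l'. f (a # l') / order_coeff q (a # l')) (b # l)"
    unfolding w using q by simp
  also have "(if a + b \<in> B then q ^ (snd a * fst b) * f ((a + b) # l) else 0)
     = order_coeff q (a # b # l) * (if a + b \<in> B then f ((a + b) # l) / order_coeff q ((a + b) # l) else 0)"
    unfolding o using order_coeff_nz[OF q, of "(a + b) # l"] by (simp del: order_coeff.simps)
  finally show ?case by (simp add: algebra_simps)
qed (simp_all add: scaled_merge_sum_def)

text \<open>The weight of the cochains in total degree \<open>T\<close>. The second factor of \<open>scaling\<close> moves the twist of the left action
  to the right action.\<close>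

definition weight_x :: "nat \<times> nat \<Rightarrow> int" where "weight_x T = int m - 1 - int (fst T)"
definition weight_y :: "nat \<times> nat \<Rightarrow> int" where "weight_y T = int n - 1 - int (snd T)"

definition scaling :: "'k::field \<Rightarrow> nat \<times> nat \<Rightarrow> (nat \<times> nat) list \<Rightarrow> 'k" where
  "scaling q T w = order_coeff q w * q powi (int (snd (sum_list w)) * weight_x T)"

definition component :: "'k::field \<Rightarrow> nat \<times> nat \<Rightarrow> 'k cochain \<Rightarrow> nat \<times> nat \<Rightarrow> (nat \<times> nat) list \<Rightarrow> 'k" where
  "component q T f e w = f w (compl_deg e) / scaling q T w"

text \<open>The twist left on the right action by a letter \<open>a\<close>: the mismatch with
  \<open>order_coeff\<close> gives the exponent \<open>fst a * weight_y T\<close>, and the second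
  factor of \<open>scaling\<close> gives \<open>- snd a * weight_x T\<close>.\<close>

definition weight_char :: "'k::field \<Rightarrow> nat \<times> nat \<Rightarrow> nat \<times> nat \<Rightarrow> 'k" where
  "weight_char q T = bichar (q powi weight_y T) (q powi (- weight_x T))"

lemma scaling_nz: "q \<noteq> 0 \<Longrightarrow> scaling q T w \<noteq> 0"
  by (simp add: scaling_def order_coeff_nz)

lemma hdiff_scaled_merge_sum:
  assumes "wf_args m n (Suc d) w c'"
  shows "hdiff m n q d f w c' =
      (\<Sum>c\<in>B. mc m n q (hd w) c c' * f (tl w) c) + scaled_merge_sum q (\<lambda>l. f l c') w
    + (-1) ^ length w * (\<Sum>c\<in>B. f (butlast w) c * mc m n q c (last w) c')"
proof -
  have "{1..d} = {1..<length w}" "length w = Suc d" using assms by (auto simp: wf_args_def)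
  then show ?thesis using assms by (simp add: hdiff_def scaled_merge_sum_def)
qed

lemma scaling_hd:
  assumes q: "q \<noteq> 0" and g: "cell B B T d e (a # w)" and ea: "e + a \<in> B"
  shows "scaling q T (a # w) = q ^ (snd a * fst (compl_deg (e + a))) * scaling q T w"
proof -
  have fT: "fst e + (fst a + fst (sum_list w)) = fst T" using cell_sums[OF g] by simp
  have i: "int (snd a * fst (sum_list w)) + int (snd a) * weight_x T = int (snd a * fst (compl_deg (e + a)))"
  proof -
    \<comment> \<open>The weight is output degree minus input degree, here for the shortened
      word.\<close>
    have "int (fst (sum_list w)) + weight_x T = int (fst (compl_deg (e + a)))"
      using ea fT unfolding weight_x_def compl_deg_def by (auto simp: bas_def mem_Times_iff)
    then show ?thesis by (metis distrib_left of_nat_mult)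
  qed
  have "q ^ (snd a * fst (sum_list w)) * q powi (int (snd a) * weight_x T) = q ^ (snd a * fst (compl_deg (e + a)))"
    unfolding power_int_of_nat[symmetric] i[symmetric] using q by (simp add: power_int_add)
  moreover have "q powi (int (snd (sum_list (a # w))) * weight_x T)
      = q powi (int (snd a) * weight_x T) * q powi (int (snd (sum_list w)) * weight_x T)"
    using q by (simp add: power_int_add distrib_right)
  ultimately show ?thesis by (simp add: scaling_def mult_ac)
qed

lemma weight_char_powi:
  assumes "q \<noteq> 0"
  shows "weight_char q T a = q powi (int (fst a) * weight_y T - int (snd a) * weight_x T)"
proof -
  have "weight_char q T a = q powi (weight_y T * int (fst a)) * q powi (- weight_x T * int (snd a))"
    by (simp only: weight_char_def bichar_def power_int_mult power_int_of_nat)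
  also have "\<dots> = q powi (weight_y T * int (fst a) + - weight_x T * int (snd a))"
    by (rule power_int_add[symmetric]) (use assms in simp)
  also have "weight_y T * int (fst a) + - weight_x T * int (snd a) = int (fst a) * weight_y T - int (snd a) * weight_x T"
    by (simp add: algebra_simps)
  finally show ?thesis .
qed

lemma scaling_last:
  assumes q: "q \<noteq> 0" and g: "cell B B T d e (w @ [a])" and ea: "e + a \<in> B"
  shows "weight_char q T a * scaling q T (w @ [a]) = q ^ (snd (compl_deg (e + a)) * fst a) * scaling q T w"
proof -
  have fT: "snd e + (snd (sum_list w) + snd a) = snd T" using cell_sums[OF g] by simp
  have i: "int (snd (sum_list w) * fst a) + int (fst a) * weight_y T = int (snd (compl_deg (e + a)) * fst a)"
  proof -
    have "int (snd (sum_list w)) + weight_y T = int (snd (compl_deg (e + a)))"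
      using ea fT unfolding weight_y_def compl_deg_def by (auto simp: bas_def mem_Times_iff)
    then show ?thesis by (metis distrib_left mult.commute of_nat_mult)
  qed
  have "weight_char q T a * scaling q T (w @ [a]) = order_coeff q w * (q powi (int (fst a) * weight_y T - int (snd a) * weight_x T) *
      q powi int (snd (sum_list w) * fst a) * q powi (int (snd (sum_list w) + snd a) * weight_x T))"
    by (simp only: weight_char_powi[OF q] scaling_def order_coeff_snoc power_int_of_nat sum_list_append snd_add) (simp add: mult_ac)
  also have "\<dots> = order_coeff q w * q powi ((int (fst a) * weight_y T - int (snd a) * weight_x T) + int (snd (sum_list w) * fst a)
       + int (snd (sum_list w) + snd a) * weight_x T)"
    using q by (simp add: power_int_add)
  also have "(int (fst a) * weight_y T - int (snd a) * weight_x T) + int (snd (sum_list w) * fst a)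
       + int (snd (sum_list w) + snd a) * weight_x T
     = int (snd (compl_deg (e + a)) * fst a) + int (snd (sum_list w)) * weight_x T"
    unfolding i[symmetric] by (simp add: algebra_simps)
  finally show ?thesis using q by (simp add: power_int_add scaling_def mult_ac power_int_of_nat[symmetric] del: power_int_of_nat of_nat_mult)
qed

lemma cdiff_component:
  assumes q: "q \<noteq> 0" and g: "cell B B T (Suc d) e w"
  shows "cdiff B B (weight_char q T) (component q T f) e w = hdiff m n q d f w (compl_deg e) / scaling q T w"
proof -
  have e: "e \<in> B" and wB: "set w \<subseteq> B" and wn: "w \<noteq> []" using g by (auto simp: cell_def)
  have wf: "wf_args m n (Suc d) w (compl_deg e)" using g compl_deg_bas by (auto simp: wf_args_def cell_def)
  note nz = scaling_nz[OF q]
  have 1: "(\<Sum>c\<in>B. mc m n q (hd w) c (compl_deg e) * f (tl w) c) / scaling q T w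
     = (if e + hd w \<in> B then component q T f (e + hd w) (tl w) else 0)"
  proof (cases "e + hd w \<in> B")
    case True
    have "scaling q T w = q ^ (snd (hd w) * fst (compl_deg (e + hd w))) * scaling q T (tl w)"
      using scaling_hd[OF q, of T "Suc d" e "hd w" "tl w"] g True wn by simp
    then show ?thesis using True q nz[of T "tl w"] by (simp add: mc_sum_compl_deg[OF e] component_def)
  qed (simp add: mc_sum_compl_deg[OF e])
  have 2: "(\<Sum>c\<in>B. f (butlast w) c * mc m n q c (last w) (compl_deg e)) / scaling q T w
     = weight_char q T (last w) * (if e + last w \<in> B then component q T f (e + last w) (butlast w) else 0)"
  proof (cases "e + last w \<in> B")
    case True
    have *: "weight_char q T (last w) * scaling q T w = q ^ (snd (compl_deg (e + last w)) * fst (last w)) * scaling q T (butlast w)"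
      using scaling_last[OF q, of T "Suc d" e "butlast w" "last w"] g True wn by simp
    have "q ^ (snd (compl_deg (e + last w)) * fst (last w)) / scaling q T w = weight_char q T (last w) / scaling q T (butlast w)"
      using * nz[of T w] nz[of T "butlast w"] by (simp add: field_simps)
    then show ?thesis using True by (simp add: mc_sum_compl_deg[OF e] component_def) (metis mult.commute times_divide_eq_right)
  qed (simp add: mc_sum_compl_deg[OF e])
  have 3: "scaled_merge_sum q (\<lambda>l. f l (compl_deg e)) w / scaling q T w = - merge_sum B (component q T f e) w"
  proof -
    define c where "c s = 1 / q powi (int (snd s) * weight_x T)" for s :: "nat \<times> nat"
    have "merge_sum B (component q T f e) w = merge_sum B (\<lambda>l. c (sum_list l) * (f l (compl_deg e) / order_coeff q l)) w"
      by (rule merge_sum_cong_length) (simp add: component_def scaling_def c_def)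
    also have "\<dots> = c (sum_list w) * merge_sum B (\<lambda>l. f l (compl_deg e) / order_coeff q l) w"
      by (rule merge_sum_weight[OF wB])
    finally show ?thesis
      using order_coeff_nz[OF q, of w] by (simp add: scaled_merge_sum_merge_sum[OF q wB] scaling_def c_def)
  qed
  have "hdiff m n q d f w (compl_deg e) / scaling q T w =
      (\<Sum>c\<in>B. mc m n q (hd w) c (compl_deg e) * f (tl w) c) / scaling q T w + scaled_merge_sum q (\<lambda>l. f l (compl_deg e)) w / scaling q T w
    + (-1) ^ length w * ((\<Sum>c\<in>B. f (butlast w) c * mc m n q c (last w) (compl_deg e)) / scaling q T w)"
    unfolding hdiff_scaled_merge_sum[OF wf] by (simp add: add_divide_distrib)
  then show ?thesis using wn unfolding 1 2 3 by (simp add: cdiff_def mult.assoc)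
qed

end

section \<open>Cohomology in each degree\<close>

text \<open>For even \<open>i\<close> the scalar is \<open>1 - q powi t\<close>, and for odd
  \<open>i\<close> it is a factor of \<open>1 - q powi (t * M)\<close>; neither vanishes, as
  \<open>q\<close> is not a root of unity.\<close>

lemma res_coeff_powi_nz:
  fixes q :: "'k::field"
  assumes q: "q \<noteq> 0" "\<forall>j::nat. j \<ge> 1 \<longrightarrow> q ^ j \<noteq> 1" and "t \<noteq> 0" "1 \<le> M"
  shows "res_coeff (q powi t) M i \<noteq> 0"
proof -
  have p: "q powi s \<noteq> 1" if "s \<noteq> 0" for s :: int
  proof (cases "0 \<le> s")
    case True
    then obtain k where "s = int k" by (metis nonneg_int_cases)
    then show ?thesis using q(2) that by (simp add: power_int_of_nat)
  next
    case False
    then obtain k where k: "s = - int k" "k \<ge> 1" by (intro that[of "nat (- s)"]) auto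
    then have "q ^ k \<noteq> 1" using q(2) by blast
    then show ?thesis using k by (simp add: power_int_minus power_int_of_nat)
  qed
  have "(1 - q powi t) * qint (q powi t) M = 1 - q powi (t * int M)"
    by (simp add: qint_geom power_int_mult power_int_of_nat)
  moreover have "q powi (t * int M) \<noteq> 1" using p[of "t * int M"] assms by simp
  ultimately have "qint (q powi t) M \<noteq> 0" by auto
  then show ?thesis using p[OF assms(3)] by (simp add: res_coeff_def)
qed

context quantum_ci
begin

text \<open>It has two roles: the exponent of the socle monomial, and the value of \<open>T\<close>
  at which both weights vanish. The socle as a cochain of degree 0 sits at
  \<open>T = 0\<close>.\<close>

definition socle_deg :: "nat \<times> nat" where "socle_deg = (m - 1, n - 1)"

lemma socle_deg_B: "socle_deg \<in> B"
  using m2 n2 by (simp add: socle_deg_def bas_def)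

lemma weight_x_socle_deg: "weight_x socle_deg = 0" and weight_y_socle_deg: "weight_y socle_deg = 0"
  using m2 n2 by (simp_all add: weight_x_def weight_y_def socle_deg_def)

lemma weight_char_socle_deg: "weight_char q socle_deg = bichar 1 1"
  by (simp add: weight_char_def weight_x_socle_deg weight_y_socle_deg)

lemma scaling_socle_deg: "scaling q socle_deg w = order_coeff q w"
  by (simp add: scaling_def weight_x_socle_deg)

lemma compl_deg_eq_iff: "e \<in> B \<Longrightarrow> s \<in> B \<Longrightarrow> s = compl_deg e \<longleftrightarrow> e + s = socle_deg"
  by (auto simp: compl_deg_def socle_deg_def bas_def prod_eq_iff)

lemma cocycle_component:
  assumes q: "q \<noteq> 0" and "cocycle m n q d f" and g: "cell B B T (Suc d) e w"
  shows "cdiff B B (weight_char q T) (component q T f) e w = 0"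
  using assms by (simp add: cdiff_component[OF q g] cocycle_def zero_cochain_def)

lemma cohomI:
  assumes q: "q \<noteq> 0" and f: "is_cochain m n (Suc d) f" "is_cochain m n (Suc d) r"
    and \<psi>: "\<And>T. \<exists>\<psi>. \<forall>e w. cell B B T (Suc d) e w \<longrightarrow>
      component q T f e w = component q T r e w + cdiff B B (weight_char q T) \<psi> e w"
  shows "cohom m n q (Suc d) f r"
proof -
  obtain \<psi> where \<psi>: "\<And>T e w. cell B B T (Suc d) e w \<Longrightarrow>
      component q T f e w = component q T r e w + cdiff B B (weight_char q T) (\<psi> T) e w"
    using \<psi> by metis
  \<comment> \<open>Word and output determine \<open>T\<close>, so the primitives for the separate
    \<open>T\<close> glue to one cochain.\<close>
  define h where "h w c = (if wf_args m n d w c then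
      scaling q (compl_deg c + sum_list w) w * \<psi> (compl_deg c + sum_list w) (compl_deg c) w else 0)" for w c
  have ph: "component q T h e w = \<psi> T e w" if "cell B B T d e w" for T e w
    using that scaling_nz[OF q] compl_deg_bas by (auto simp: component_def h_def cell_def wf_args_def compl_deg_compl_deg)
  have "f w c - r w c = hdiff m n q d h w c" for w c
  proof (cases "wf_args m n (Suc d) w c")
    case False
    then have "f w c = 0" "r w c = 0" using f unfolding is_cochain_def wf_args_def by blast+
    then show ?thesis using False by (simp add: hdiff_def)
  next
    case True
    define T where "T = compl_deg c + sum_list w"
    have g: "cell B B T (Suc d) (compl_deg c) w"
      using True compl_deg_bas by (auto simp: cell_def wf_args_def T_def)
    have c: "compl_deg (compl_deg c) = c" using True by (simp add: compl_deg_compl_deg wf_args_def)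
    have "component q T f (compl_deg c) w - component q T r (compl_deg c) w = cdiff B B (weight_char q T) (\<psi> T) (compl_deg c) w"
      using \<psi>[OF g] by simp
    also have "\<dots> = cdiff B B (weight_char q T) (component q T h) (compl_deg c) w"
      by (rule cdiff_cell_cong[OF _ g]) (simp add: ph)
    also have "\<dots> = hdiff m n q d h w c / scaling q T w"
      by (simp add: cdiff_component[OF q g] c)
    finally show ?thesis
      using scaling_nz[OF q, of T w] by (simp add: component_def c flip: diff_divide_distrib)
  qed
  then have "(\<lambda>w c. f w c - r w c) = hdiff m n q d h" by blast
  moreover have "is_cochain m n d h" by (auto simp: is_cochain_def h_def wf_args_def)
  ultimately show ?thesis by (auto simp: cohom_def coboundary_def)
qed

lemma acyclic_component:
  assumes q: "q \<noteq> 0" "\<forall>j::nat. j \<ge> 1 \<longrightarrow> q ^ j \<noteq> 1" and f: "cocycle m n q d f"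
    and T: "T \<noteq> socle_deg" "T \<noteq> 0 \<or> 0 < d"
  shows "\<exists>\<psi>. \<forall>e w. cell B B T d e w \<longrightarrow> component q T f e w = cdiff B B (weight_char q T) \<psi> e w"
  unfolding weight_char_def
proof (rule acyclic_weight)
  fix e w assume "cell B B T (Suc d) e w"
  then show "cdiff B B (bichar (q powi weight_y T) (q powi - weight_x T)) (component q T f) e w = 0"
    using cocycle_component[OF q(1) f] by (simp add: weight_char_def)
next
  \<comment> \<open>The twist in \<open>x\<close> comes from the \<open>y\<close>-weight and
    conversely. If \<open>weight_y T = 0\<close>, then \<open>snd T\<close> is positive, and failure
    of the second alternative would make \<open>T\<close> the socle degree. If
    \<open>fst T = 0\<close>, then \<open>weight_x T\<close> is nonzero, and failure leaves only
    \<open>T = 0\<close>.\<close>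
  have "weight_y T \<noteq> 0 \<and> 0 < fst T \<or> weight_x T \<noteq> 0 \<and> 0 < snd T \<or> T = 0 \<and> 0 < d"
    using T m2 n2 by (auto simp: weight_x_def weight_y_def socle_deg_def prod_eq_iff)
  then show "0 < fst T \<and> (\<forall>i. res_coeff (q powi weight_y T) m i \<noteq> 0) \<or>
      0 < snd T \<and> (\<forall>j. res_coeff (q powi - weight_x T) n j \<noteq> 0) \<or> T = 0 \<and> 0 < d"
    using res_coeff_powi_nz[OF q] m2 n2 by auto
qed

definition weight0_cochain :: "'k::field \<Rightarrow> nat \<Rightarrow> ((nat \<times> nat) list \<Rightarrow> 'k) \<Rightarrow> 'k cochain" where
  "weight0_cochain q d \<rho> w c = (if wf_args m n d w c \<and> c = sum_list w then order_coeff q w * \<rho> w else 0)"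

lemma is_cochain_weight0_cochain: "is_cochain m n d (weight0_cochain q d \<rho>)"
  by (auto simp: is_cochain_def weight0_cochain_def wf_args_def)

lemma component_weight0_cochain:
  assumes "q \<noteq> 0" and g: "cell B B T d e w"
  shows "component q T (weight0_cochain q d \<rho>) e w = (if T = socle_deg then \<rho> w else 0)"
proof -
  have wf: "wf_args m n d w (compl_deg e)" using g compl_deg_bas by (auto simp: cell_def wf_args_def)
  have "compl_deg e = sum_list w \<longleftrightarrow> T = socle_deg"
  proof
    assume "compl_deg e = sum_list w"
    then show "T = socle_deg"
      using compl_deg_eq_iff[of e "sum_list w"] compl_deg_bas[of e] g by (auto simp: cell_def)
  next
    assume t: "T = socle_deg"
    then have "sum_list w \<in> B" using g socle_deg_B downsetD'[OF downset_bas] by (metis cell_def)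
    then show "compl_deg e = sum_list w" using compl_deg_eq_iff[of e "sum_list w"] t g by (auto simp: cell_def)
  qed
  then show ?thesis using wf order_coeff_nz[OF assms(1), of w] by (auto simp: component_def weight0_cochain_def scaling_socle_deg)
qed

lemma in_window_socle_deg: "in_window socle_deg i j \<longleftrightarrow> i \<le> 1 \<and> j \<le> 1"
proof -
  have "res_deg M i \<le> M - 1 \<longleftrightarrow> i \<le> 1" if "2 \<le> M" for M i
  proof
    assume "res_deg M i \<le> M - 1"
    moreover have "M \<le> res_deg M i" if "2 \<le> i"
      using res_deg_mono[OF \<open>2 \<le> M\<close>, of 2 i] that by (cases "i = 2") (auto simp: numeral_2_eq_2)
    ultimately show "i \<le> 1" using that by (cases "2 \<le> i") auto
  next
    assume "i \<le> 1"
    then have "i = 0 \<or> i = 1" by auto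
    then show "res_deg M i \<le> M - 1" using that by auto
  qed
  from this[OF m2, of i] this[OF n2, of j] show ?thesis
    using m2 n2 by (auto simp: in_window_def socle_deg_def)
qed

text \<open>Inside the window only arrows out of index 0 occur, with scalar \<open>1 - 1\<close>.
  The odd scalars, which would be \<open>m\<close> and \<open>n\<close> in the field, lead out of
  the window, so the result holds in every characteristic.\<close>

lemma small_diff_socle_deg: "window_supp socle_deg \<alpha> \<Longrightarrow> small_diff 1 1 socle_deg \<alpha> i j = 0"
  by (auto simp: small_diff_def in_window_socle_deg res_coeff_def le_Suc_eq)

lemma cocycle_weight0_cochain:
  assumes q: "q \<noteq> 0" and \<alpha>: "window_supp socle_deg \<alpha>"
  shows "cocycle m n q d (weight0_cochain q d (gen_sum 1 1 d \<alpha>))"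
proof -
  let ?f = "weight0_cochain q d (gen_sum 1 1 d \<alpha>)"
  have "hdiff m n q d ?f w c = 0" for w c
  proof (cases "wf_args m n (Suc d) w c")
    case False
    then show ?thesis by (simp add: hdiff_def)
  next
    case True
    define T where "T = compl_deg c + sum_list w"
    have g: "cell B B T (Suc d) (compl_deg c) w"
      using True compl_deg_bas by (auto simp: cell_def wf_args_def T_def)
    have c: "compl_deg (compl_deg c) = c" using True by (simp add: compl_deg_compl_deg wf_args_def)
    have "hdiff m n q d ?f w c / scaling q T w = cdiff B B (weight_char q T) (component q T ?f) (compl_deg c) w"
      by (simp add: cdiff_component[OF q g] c)
    also have "\<dots> = cdiff B B (weight_char q T) (\<lambda>e w. if T = socle_deg then gen_sum 1 1 d \<alpha> w else 0) (compl_deg c) w"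
      by (rule cdiff_cell_cong[OF _ g]) (rule component_weight0_cochain[OF q])
    also have "\<dots> = 0"
    proof (cases "T = socle_deg")
      case t: True
      have "gen_sum 1 1 (Suc d) (small_diff 1 1 socle_deg \<alpha>) w = 0" by (simp add: gen_sum_def small_diff_socle_deg[OF \<alpha>])
      then show ?thesis using cdiff_gen_sum[OF g[unfolded t] \<alpha>, of 1 1] t by (simp add: weight_char_socle_deg)
    qed simp
    finally show ?thesis using scaling_nz[OF q, of T w] by simp
  qed
  then have "hdiff m n q d ?f = zero_cochain" by (simp add: zero_cochain_def fun_eq_iff)
  then show ?thesis by (simp add: cocycle_def is_cochain_weight0_cochain)
qed

lemma cocycle_cohom_weight0_cochain:
  assumes q: "q \<noteq> 0" "\<forall>j::nat. j \<ge> 1 \<longrightarrow> q ^ j \<noteq> 1" and f: "cocycle m n q (Suc d) f"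
  obtains \<alpha> where "window_supp socle_deg \<alpha>" "cohom m n q (Suc d) f (weight0_cochain q (Suc d) (gen_sum 1 1 (Suc d) \<alpha>))"
proof -
  obtain \<alpha> \<psi>0 where \<alpha>: "window_supp socle_deg \<alpha>"
    and z: "\<And>e w. cell B B socle_deg (Suc d) e w \<Longrightarrow> component q socle_deg f e w = gen_sum 1 1 (Suc d) \<alpha> w + cdiff B B (bichar 1 1) \<psi>0 e w"
    using cocycle_normal_form[of socle_deg "Suc d" 1 1 "component q socle_deg f"] cocycle_component[OF q(1) f]
    by (metis weight_char_socle_deg)
  have "cohom m n q (Suc d) f (weight0_cochain q (Suc d) (gen_sum 1 1 (Suc d) \<alpha>))"
  proof (rule cohomI[OF q(1)])
    show "is_cochain m n (Suc d) f" using f by (simp add: cocycle_def)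
    fix T
    show "\<exists>\<psi>. \<forall>e w. cell B B T (Suc d) e w \<longrightarrow> component q T f e w
        = component q T (weight0_cochain q (Suc d) (gen_sum 1 1 (Suc d) \<alpha>)) e w + cdiff B B (weight_char q T) \<psi> e w"
    proof (cases "T = socle_deg")
      case True
      then show ?thesis
        by (intro exI[of _ \<psi>0]) (simp add: z component_weight0_cochain[OF q(1)] weight_char_socle_deg)
    next
      case False
      obtain \<psi> where "\<forall>e w. cell B B T (Suc d) e w \<longrightarrow> component q T f e w = cdiff B B (weight_char q T) \<psi> e w"
        using acyclic_component[OF q f False] by blast
      then show ?thesis using False
        by (intro exI[of _ \<psi>]) (simp add: component_weight0_cochain[OF q(1)])
    qed
  qed (rule is_cochain_weight0_cochain)
  with \<alpha> show thesis by (rule that)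
qed

lemma coboundary_component:
  assumes q: "q \<noteq> 0" and f: "coboundary m n q (Suc d) f"
  obtains h where "\<And>T e w. cell B B T (Suc d) e w \<Longrightarrow> component q T f e w = cdiff B B (weight_char q T) (component q T h) e w"
proof -
  obtain h where "f = hdiff m n q d h" using f by (auto simp: coboundary_def)
  then show thesis using cdiff_component[OF q, of _ d _ _ h] by (intro that[of h]) (simp add: component_def)
qed

lemma cohom_eq:
  assumes "f = g"
  shows "cohom m n q d f g"
proof -
  have "is_cochain m n k (\<lambda>_ _. 0 :: 'a)" for k by (simp add: is_cochain_def)
  moreover have "hdiff m n q k (\<lambda>_ _. 0 :: 'a) = (\<lambda>_ _. 0)" for k by (simp add: hdiff_def fun_eq_iff)
  ultimately show ?thesis
    using assms by (auto simp: cohom_def coboundary_def zero_cochain_def split: nat.split intro!: exI[of _ "\<lambda>_ _. 0"])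
qed

end

section \<open>Explicit generators and relations between their cup products\<close>

definition diag_cochain :: "nat \<Rightarrow> nat \<Rightarrow> (nat \<times> nat \<Rightarrow> 'k::field) \<Rightarrow> 'k cochain" where
  "diag_cochain m n c as e = (if as = [e] \<and> e \<in> bas m n then c e else 0)"

definition socle :: "nat \<Rightarrow> nat \<Rightarrow> 'k::field cochain" where
  "socle m n as e = (if as = [] \<and> e = (m - 1, n - 1) then 1 else 0)"

lemma mc_nonzero: "mc m n q a b e \<noteq> 0 \<Longrightarrow> e = a + b \<and> e \<in> bas m n"
  by (auto simp: mc_def bas_def mem_Times_iff prod_eq_iff split: if_splits)

context quantum_ci
begin

lemma sum_delta_B: "(\<Sum>c\<in>B. if c = b then F c else 0) = (if b \<in> B then F b else 0)"
  using finB by simp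

lemma is_cochain_diag_cochain: "is_cochain m n (Suc 0) (diag_cochain m n c)"
  by (auto simp: is_cochain_def diag_cochain_def)

lemma diag_cochain_single: "diag_cochain m n c [a] e = (if e = a \<and> a \<in> B then c a else 0)"
  by (auto simp: diag_cochain_def)

text \<open>The differential measures the failure of \<open>c\<close> to be additive on nonzero
  products. Relations between cup products of diagonal cochains thus become identities between
  functions of exponents.\<close>

lemma hdiff_diag_cochain: "hdiff m n q (Suc 0) (diag_cochain m n c) as e =
   (if wf_args m n 2 as e then mc m n q (as ! 0) (as ! 1) e * (c (as ! 1) - c e + c (as ! 0)) else 0)"
proof (cases "wf_args m n 2 as e")
  case True
  then obtain a b where as: "as = [a, b]" and ab: "a \<in> B" "b \<in> B" and e: "e \<in> B"
    by (auto simp: wf_args_def numeral_2_eq_2 length_Suc_conv)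
  have "(\<Sum>c'\<in>B. mc m n q a c' e * diag_cochain m n c [b] c') = (\<Sum>c'\<in>B. if c' = b then mc m n q a b e * c b else 0)"
    by (rule sum.cong) (use ab in \<open>auto simp: diag_cochain_single\<close>)
  moreover have "(\<Sum>g\<in>B. mc m n q a b g * diag_cochain m n c [g] e) = (\<Sum>g\<in>B. if g = e then mc m n q a b e * c e else 0)"
    by (rule sum.cong) (use e in \<open>auto simp: diag_cochain_single\<close>)
  moreover have "(\<Sum>c'\<in>B. diag_cochain m n c [a] c' * mc m n q c' b e) = (\<Sum>c'\<in>B. if c' = a then c a * mc m n q a b e else 0)"
    by (rule sum.cong) (use ab in \<open>auto simp: diag_cochain_single\<close>)
  ultimately show ?thesis
    using True as ab e by (simp add: hdiff_def numeral_2_eq_2 sum_delta_B algebra_simps)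
qed (simp add: hdiff_def numeral_2_eq_2)

lemma cup_diag_cochain: "cup m n q (Suc 0) (Suc 0) (diag_cochain m n c) (diag_cochain m n c') as e =
   (if wf_args m n 2 as e then mc m n q (as ! 0) (as ! 1) e * (c (as ! 0) * c' (as ! 1)) else 0)"
proof (cases "wf_args m n 2 as e")
  case True
  then obtain a b where as: "as = [a, b]" and ab: "a \<in> B" "b \<in> B" and e: "e \<in> B"
    by (auto simp: wf_args_def numeral_2_eq_2 length_Suc_conv)
  have "(\<Sum>x\<in>B. \<Sum>y\<in>B. diag_cochain m n c [a] x * diag_cochain m n c' [b] y * mc m n q x y e)
     = (\<Sum>x\<in>B. if x = a then (\<Sum>y\<in>B. if y = b then c a * c' b * mc m n q a b e else 0) else 0)"
  proof (rule sum.cong[OF refl])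
    fix x
    have "(\<Sum>y\<in>B. diag_cochain m n c [a] x * diag_cochain m n c' [b] y * mc m n q x y e)
       = (\<Sum>y\<in>B. if y = b then diag_cochain m n c [a] x * c' b * mc m n q x b e else 0)"
      by (rule sum.cong) (use ab in \<open>auto simp: diag_cochain_single\<close>)
    then show "(\<Sum>y\<in>B. diag_cochain m n c [a] x * diag_cochain m n c' [b] y * mc m n q x y e)
       = (if x = a then (\<Sum>y\<in>B. if y = b then c a * c' b * mc m n q a b e else 0) else 0)"
      using ab by (simp add: sum_delta_B diag_cochain_single)
  qed
  then show ?thesis
    using True as ab e by (simp add: cup_def numeral_2_eq_2 sum_delta_B algebra_simps)
qed (simp add: cup_def numeral_2_eq_2)

lemma cohom_hdiff_diag_cochain:
  assumes "\<And>as e. f as e - g as e = hdiff m n q (Suc 0) (diag_cochain m n c) as e"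
  shows "cohom m n q 2 f g"
  unfolding cohom_def coboundary_def numeral_2_eq_2
  using assms is_cochain_diag_cochain by (auto simp: fun_eq_iff intro!: exI[of _ "diag_cochain m n c"])

lemma mc_cong:
  "(a + b = e \<Longrightarrow> x = y) \<Longrightarrow> mc m n q a b e * x = mc m n q a b e * (y :: 'k::field)"
  using mc_nonzero[of m n q a b e] by (cases "mc m n q a b e = 0") auto

text \<open>The function \<open>k(k-1)/2\<close>, integral in every characteristic; its diagonal cochain bounds the cup square of a
  derivation.\<close>

definition triangular :: "nat \<Rightarrow> 'k::field" where
  "triangular k = of_nat (\<Sum>{..<k})"

lemma triangular_add: "triangular (i + j) = triangular i + triangular j + of_nat i * (of_nat j :: 'k::field)"
  by (induction j) (auto simp: triangular_def algebra_simps)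

abbreviation "euler_x \<equiv> diag_cochain m n (\<lambda>a. of_nat (fst a))"
abbreviation "euler_y \<equiv> diag_cochain m n (\<lambda>a. of_nat (snd a))"

lemma cup_square: 
  assumes "pr = fst \<or> pr = snd"
  shows "cohom m n q 2 (cup m n q (Suc 0) (Suc 0) (diag_cochain m n (\<lambda>a. of_nat (pr a))) (diag_cochain m n (\<lambda>a. of_nat (pr a))) :: 'k::field cochain) zero_cochain"
proof (rule cohom_hdiff_diag_cochain)
  fix as e
  have pr: "pr (a + b) = pr a + pr b" for a b :: "nat \<times> nat" using assms by auto
  show "cup m n q (Suc 0) (Suc 0) (diag_cochain m n (\<lambda>a. of_nat (pr a))) (diag_cochain m n (\<lambda>a. of_nat (pr a))) as e - (zero_cochain as e :: 'k)
     = hdiff m n q (Suc 0) (diag_cochain m n (\<lambda>a. - triangular (pr a))) as e"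
  proof (cases "wf_args m n 2 as e")
    case True
    have "mc m n q (as ! 0) (as ! 1) e * (of_nat (pr (as ! 0)) * of_nat (pr (as ! 1)))
      = mc m n q (as ! 0) (as ! 1) e * (- triangular (pr (as ! 1)) - - triangular (pr e) + - triangular (pr (as ! 0)) :: 'k)"
    proof (rule mc_cong)
      assume "as ! 0 + as ! 1 = e"
      then have "pr e = pr (as ! 0) + pr (as ! 1)" using pr by blast
      then show "of_nat (pr (as ! 0)) * of_nat (pr (as ! 1))
         = (- triangular (pr (as ! 1)) - - triangular (pr e) + - triangular (pr (as ! 0)) :: 'k)"
        by (simp add: triangular_add)
    qed
    then show ?thesis using True by (simp add: cup_diag_cochain hdiff_diag_cochain zero_cochain_def)
  qed (simp add: cup_diag_cochain hdiff_diag_cochain zero_cochain_def)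
qed

text \<open>The function \<open>fst a * snd a\<close> fails to be additive by the symmetrized
  product \<open>fst a * snd b + snd a * fst b\<close>, so its diagonal cochain bounds the sum of
  the two cup products up to sign.\<close>

lemma cup_wv: "cohom m n q 2 (cup m n q (Suc 0) (Suc 0) euler_y euler_x :: 'k::field cochain)
   (smul_cochain (-1) (cup m n q (Suc 0) (Suc 0) euler_x euler_y))"
proof (rule cohom_hdiff_diag_cochain)
  fix as e
  show "cup m n q (Suc 0) (Suc 0) euler_y euler_x as e - (smul_cochain (-1) (cup m n q (Suc 0) (Suc 0) euler_x euler_y) as e :: 'k)
     = hdiff m n q (Suc 0) (diag_cochain m n (\<lambda>a. - of_nat (fst a * snd a))) as e"
  proof (cases "wf_args m n 2 as e")
    case True
    have "mc m n q (as ! 0) (as ! 1) e * (of_nat (snd (as ! 0)) * of_nat (fst (as ! 1)) + of_nat (fst (as ! 0)) * of_nat (snd (as ! 1)))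
      = mc m n q (as ! 0) (as ! 1) e * ((- of_nat (fst (as ! 1) * snd (as ! 1))) - (- of_nat (fst e * snd e)) + (- of_nat (fst (as ! 0) * snd (as ! 0))) :: 'k)"
    proof (rule mc_cong)
      assume "as ! 0 + as ! 1 = e"
      then have "fst e = fst (as ! 0) + fst (as ! 1)" "snd e = snd (as ! 0) + snd (as ! 1)" by auto
      then show "of_nat (snd (as ! 0)) * of_nat (fst (as ! 1)) + of_nat (fst (as ! 0)) * of_nat (snd (as ! 1))
        = ((- of_nat (fst (as ! 1) * snd (as ! 1))) - (- of_nat (fst e * snd e)) + (- of_nat (fst (as ! 0) * snd (as ! 0))) :: 'k)"
        by (simp add: algebra_simps)
    qed
    then show ?thesis using True
      by (simp add: cup_diag_cochain hdiff_diag_cochain smul_cochain_def algebra_simps)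
  qed (simp add: cup_diag_cochain hdiff_diag_cochain smul_cochain_def)
qed

text \<open>In weight zero \<open>\<zeta>\<close> is 1 and \<open>qint 1 k\<close> is
  \<open>k\<close>, so the generator \<open>(1, 0)\<close> is the Euler derivation, which inherits
  the cocycle property.\<close>

lemma v_weight0_cochain: "euler_x = weight0_cochain q (Suc 0) (gen_sum 1 1 (Suc 0) (\<lambda>i j. if i = 1 \<and> j = 0 then 1 else 0))"
proof (intro ext)
  fix as e show "euler_x as e = weight0_cochain q (Suc 0) (gen_sum 1 1 (Suc 0) (\<lambda>i j. if i = 1 \<and> j = 0 then 1 else 0)) as e"
  proof (cases "length as = Suc 0")
    case True
    then obtain a where "as = [a]" by (auto simp: length_Suc_conv)
    then show ?thesis by (auto simp: diag_cochain_def weight0_cochain_def wf_args_def gen_sum_def gen_xy_def gen_wy_def gen_y_def nil_ind_def)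
  qed (auto simp: diag_cochain_def weight0_cochain_def wf_args_def)
qed

lemma w_weight0_cochain: "euler_y = weight0_cochain q (Suc 0) (gen_sum 1 1 (Suc 0) (\<lambda>i j. if i = 0 \<and> j = 1 then 1 else 0))"
proof (intro ext)
  fix as e show "euler_y as e = weight0_cochain q (Suc 0) (gen_sum 1 1 (Suc 0) (\<lambda>i j. if i = 0 \<and> j = 1 then 1 else 0)) as e"
  proof (cases "length as = Suc 0")
    case True
    then obtain a where "as = [a]" by (auto simp: length_Suc_conv)
    then show ?thesis by (auto simp: diag_cochain_def weight0_cochain_def wf_args_def gen_sum_def gen_xy_def gen_wy_def gen_y_def nil_ind_def)
  qed (auto simp: diag_cochain_def weight0_cochain_def wf_args_def)
qed

text \<open>The power of \<open>q\<close> in the structure constant of the cup product is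
  \<open>order_coeff\<close> of the two-letter word, so this product is the generator
  \<open>(1, 1)\<close> itself and not merely cohomologous to it.\<close>

lemma vw_weight0_cochain: "cup m n q (Suc 0) (Suc 0) euler_x euler_y = weight0_cochain q 2 (gen_sum 1 1 2 (\<lambda>i j. if i = 1 \<and> j = 1 then 1 else 0))"
proof (intro ext)
  fix as e
  show "cup m n q (Suc 0) (Suc 0) euler_x euler_y as e = weight0_cochain q 2 (gen_sum 1 1 2 (\<lambda>i j. if i = 1 \<and> j = 1 then 1 else 0)) as e"
  proof (cases "wf_args m n 2 as e")
    case True
    then obtain a b where as: "as = [a, b]" and ab: "a \<in> B" "b \<in> B" and e: "e \<in> B"
      by (auto simp: wf_args_def numeral_2_eq_2 length_Suc_conv)
    have "mc m n q a b e = (if e = a + b then q ^ (snd a * fst b) else 0)"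
      using e by (auto simp: mc_def bas_def prod_eq_iff)
    then show ?thesis using True
      by (simp add: cup_diag_cochain weight0_cochain_def as gen_sum_def gen_xy_def gen_wy_def gen_y_def nil_ind_def numeral_2_eq_2)
  qed (simp add: cup_diag_cochain weight0_cochain_def)
qed

lemma window_supp_delta: "i \<le> 1 \<Longrightarrow> j \<le> 1 \<Longrightarrow> window_supp socle_deg (\<lambda>i' j'. if i' = i \<and> j' = j then 1 else 0)"
  by (auto simp: window_supp_def in_window_socle_deg)

end

section \<open>Bases of the cohomology in each degree\<close>

context quantum_ci
begin

lemma one_weight0_cochain: "one_cochain = weight0_cochain q 0 (gen_sum 1 1 0 (\<lambda>i j. if i = 0 \<and> j = 0 then 1 else 0))"
proof (intro ext)
  fix as e show "one_cochain as e = weight0_cochain q 0 (gen_sum 1 1 0 (\<lambda>i j. if i = 0 \<and> j = 0 then 1 else 0)) as e"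
    using zero_bas
    by (cases as) (auto simp: one_cochain_def weight0_cochain_def wf_args_def gen_sum_def gen_xy_def gen_wy_def gen_y_def nil_ind_def zero_prod_def)
qed

lemma weight0_cochain_1: "weight0_cochain q (Suc 0) (gen_sum 1 1 (Suc 0) \<alpha>) as e = \<alpha> 1 0 * euler_x as e + \<alpha> 0 1 * euler_y as e"
proof (cases "length as = Suc 0")
  case True
  then obtain a where "as = [a]" by (auto simp: length_Suc_conv)
  then show ?thesis by (auto simp: diag_cochain_def weight0_cochain_def wf_args_def gen_sum_def gen_xy_def gen_wy_def gen_y_def nil_ind_def)
qed (auto simp: diag_cochain_def weight0_cochain_def wf_args_def)

lemma weight0_cochain_2:
  assumes "window_supp socle_deg \<alpha>"
  shows "weight0_cochain q 2 (gen_sum 1 1 2 \<alpha>) as e = \<alpha> 1 1 * cup m n q (Suc 0) (Suc 0) euler_x euler_y as e"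
proof (cases "length as = 2")
  case True
  then obtain a b where as: "as = [a, b]"
    by (auto simp: numeral_2_eq_2 length_Suc_conv)
  have "\<not> in_window socle_deg 0 2" "\<not> in_window socle_deg 2 0" by (simp_all add: in_window_socle_deg)
  then have "\<alpha> 0 2 = 0" "\<alpha> 2 0 = 0" using assms unfolding window_supp_def by blast+
  then show ?thesis unfolding vw_weight0_cochain
    by (auto simp: weight0_cochain_def as gen_sum_def gen_xy_def gen_wy_def gen_y_def nil_ind_def numeral_2_eq_2)
qed (auto simp: weight0_cochain_def wf_args_def vw_weight0_cochain)

lemma weight0_cochain_ge_3:
  assumes "window_supp socle_deg \<alpha>" "3 \<le> d"
  shows "weight0_cochain q d (gen_sum 1 1 d \<alpha>) as e = 0"
proof -
  have "\<alpha> i (d - i) = 0" if "i \<le> d" for i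
  proof (rule ccontr)
    assume "\<alpha> i (d - i) \<noteq> 0"
    then have "i \<le> 1 \<and> d - i \<le> 1" using assms(1) in_window_socle_deg by (auto simp: window_supp_def)
    then show False using assms(2) by linarith
  qed
  then have "gen_sum 1 1 d \<alpha> as = 0" unfolding gen_sum_def by (intro sum.neutral) auto
  then show ?thesis by (simp add: weight0_cochain_def)
qed

lemma mc_socle_deg:
  "mc m n q a socle_deg e = (if a = 0 \<and> e = socle_deg then 1 else 0)"
  "mc m n q socle_deg a e = (if a = 0 \<and> e = socle_deg then 1 else 0)"
  using m2 n2 by (cases a; auto simp: mc_def socle_deg_def zero_prod_def)+

lemma one_socle_nil:
  "one_cochain [] c = (if c = 0 then 1 else 0)" "socle m n [] c = (if c = socle_deg then 1 else 0)"
  by (auto simp: one_cochain_def socle_def socle_deg_def zero_prod_def)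

lemma sum_socle:
  "(\<Sum>c\<in>B. F c * socle m n [] c) = (F socle_deg :: 'k::field)"
  "(\<Sum>c\<in>B. socle m n [] c * F c) = (F socle_deg :: 'k::field)"
proof -
  have "(\<Sum>c\<in>B. F c * socle m n [] c) = (\<Sum>c\<in>B. if c = socle_deg then F socle_deg else 0)"
    by (rule sum.cong) (auto simp: one_socle_nil)
  then show "(\<Sum>c\<in>B. F c * socle m n [] c) = F socle_deg" using socle_deg_B by (simp add: sum_delta_B)
  then show "(\<Sum>c\<in>B. socle m n [] c * F c) = F socle_deg" by (simp add: mult.commute)
qed

lemma cocycle_socle: "cocycle m n q 0 (socle m n :: 'k::field cochain)"
proof -
  have "hdiff m n q 0 (socle m n) as e = (0 :: 'k)" for as e
  proof (cases "wf_args m n (Suc 0) as e")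
    case True
    then obtain a where "as = [a]" by (auto simp: wf_args_def length_Suc_conv)
    then show ?thesis by (simp add: hdiff_def sum_socle mc_socle_deg)
  qed (simp add: hdiff_def)
  moreover have "is_cochain m n 0 (socle m n :: 'k cochain)"
    using socle_deg_B by (auto simp: is_cochain_def socle_def socle_deg_def)
  ultimately show ?thesis by (simp add: cocycle_def zero_cochain_def fun_eq_iff)
qed

lemma socle_deg_nz: "socle_deg \<noteq> 0"
  using m2 by (auto simp: socle_deg_def zero_prod_def)

lemma hh_basis_0:
  assumes q: "q \<noteq> 0" "\<forall>j::nat. j \<ge> 1 \<longrightarrow> q ^ j \<noteq> 1"
  shows "hh_basis m n q 0 [one_cochain, socle m n :: 'k::field cochain]"
  unfolding hh_basis_def
proof (intro conjI allI impI ballI)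
  fix c :: "'k cochain" assume "c \<in> set [one_cochain, socle m n]"
  moreover have "cocycle m n q 0 (one_cochain :: 'k cochain)"
    unfolding one_weight0_cochain[of q] by (rule cocycle_weight0_cochain[OF q(1)]) (auto intro: window_supp_delta)
  ultimately show "cocycle m n q 0 c" using cocycle_socle by auto
next
  fix a :: "nat \<Rightarrow> 'k" and i
  assume "coboundary m n q 0 (lincomb a [one_cochain, socle m n])"
  then have "lincomb a [one_cochain, socle m n] [] c = 0" for c
    by (simp add: coboundary_def zero_cochain_def)
  from this[of 0] this[of socle_deg] have "a 0 = 0" "a (Suc 0) = 0"
    using socle_deg_nz by (simp_all add: lincomb_def one_socle_nil lessThan_Suc)
  moreover assume "i < length [one_cochain, socle m n :: 'k cochain]"
  ultimately show "a i = 0" by (auto simp: less_Suc_eq)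
next
  fix z assume z: "cocycle m n q 0 (z :: 'k cochain)"
  \<comment> \<open>For any other monomial the component lies in an acyclic weight, and a coboundary
    on the empty word is 0.\<close>
  have z0: "z [] c = 0" if c: "c \<noteq> 0" "c \<noteq> socle_deg" for c
  proof (cases "c \<in> B")
    case True
    have "compl_deg c \<noteq> socle_deg"
      using compl_deg_eq_iff[OF True compl_deg_bas[of c]] c(1) by (metis add_0 add_right_cancel)
    moreover have "compl_deg c \<noteq> 0"
      using compl_deg_eq_iff[OF True compl_deg_bas[of c]] c(2) by auto
    ultimately obtain \<psi> where \<psi>: "\<And>e w. cell B B (compl_deg c) 0 e w \<Longrightarrow>
        component q (compl_deg c) z e w = cdiff B B (weight_char q (compl_deg c)) \<psi> e w"
      using acyclic_component[OF q z, of "compl_deg c"] by blast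
    have "cell B B (compl_deg c) 0 (compl_deg c) []" using compl_deg_bas by (simp add: cell_def)
    from \<psi>[OF this] show ?thesis
      using scaling_nz[OF q(1)] by (simp add: component_def compl_deg_compl_deg[OF True])
  next
    case False
    then show ?thesis using z by (auto simp: cocycle_def is_cochain_def)
  qed
  let ?a = "\<lambda>i. if i = 0 then z [] 0 else z [] socle_deg"
  have "z as e = lincomb ?a [one_cochain, socle m n] as e" for as e
  proof (cases as)
    case Nil
    then show ?thesis using z0[of e] socle_deg_nz by (auto simp: lincomb_def one_socle_nil lessThan_Suc)
  next
    case (Cons x xs)
    then have "z as e = 0" using z by (auto simp: cocycle_def is_cochain_def)
    then show ?thesis using Cons by (simp add: lincomb_def one_cochain_def socle_def lessThan_Suc)
  qed
  then have "z = lincomb ?a [one_cochain, socle m n]" by blast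
  then show "\<exists>a. cohom m n q 0 z (lincomb a [one_cochain, socle m n])"
    using cohom_eq by blast
qed

text \<open>On a one-letter word of weight zero the two outer faces agree and cancel: an inner
  derivation has no diagonal part.\<close>

lemma coboundary_1_diagonal:
  assumes q: "q \<noteq> 0" and f: "coboundary m n q (Suc 0) f" and a: "a \<in> B"
  shows "f [a] a = 0"
proof -
  obtain h where h: "\<And>T e w. cell B B T (Suc 0) e w \<Longrightarrow> component q T f e w = cdiff B B (weight_char q T) (component q T h) e w"
    using coboundary_component[OF q f] by blast
  have "cell B B socle_deg (Suc 0) (compl_deg a) [a]"
    using a compl_deg_bas[of a] compl_deg_eq_iff[of "compl_deg a" a] by (simp add: cell_def compl_deg_compl_deg)
  from h[OF this] have "component q socle_deg f (compl_deg a) [a] = 0"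
    by (simp add: cdiff_def weight_char_socle_deg bichar_def)
  then show ?thesis by (simp add: component_def compl_deg_compl_deg[OF a] scaling_socle_deg)
qed

text \<open>In weight zero the rescaled coboundary of a 1-cochain is symmetric in its two letters;
  the powers of \<open>q\<close> undo the rescaling.\<close>

lemma coboundary_2_diagonal:
  assumes q: "q \<noteq> 0" and f: "coboundary m n q 2 f" and ab: "a \<in> B" "b \<in> B" "a + b \<in> B"
  shows "f [a, b] (a + b) * q ^ (snd b * fst a) = f [b, a] (a + b) * q ^ (snd a * fst b)"
proof -
  obtain h where h: "\<And>T e w. cell B B T 2 e w \<Longrightarrow> component q T f e w = cdiff B B (weight_char q T) (component q T h) e w"
    using coboundary_component[OF q f[unfolded numeral_2_eq_2]] unfolding numeral_2_eq_2 by blast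
  have t: "compl_deg (a + b) + (a + b) = socle_deg" "compl_deg (a + b) + (b + a) = socle_deg"
    using compl_deg_eq_iff[of "compl_deg (a + b)" "a + b"] compl_deg_bas ab(3) by (simp_all add: compl_deg_compl_deg add.commute)
  have "cell B B socle_deg 2 (compl_deg (a + b)) [a, b]" "cell B B socle_deg 2 (compl_deg (a + b)) [b, a]"
    using ab compl_deg_bas t by (simp_all add: cell_def)
  from h[OF this(1)] h[OF this(2)] have "component q socle_deg f (compl_deg (a + b)) [a, b] = component q socle_deg f (compl_deg (a + b)) [b, a]"
    by (simp add: cdiff_def weight_char_socle_deg bichar_def add.commute)
  then show ?thesis using q by (simp add: component_def compl_deg_compl_deg[OF ab(3)] scaling_socle_deg field_simps)
qed

lemma hh_basis_1:
  assumes q: "q \<noteq> 0" "\<forall>j::nat. j \<ge> 1 \<longrightarrow> q ^ j \<noteq> 1"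
  shows "hh_basis m n q (Suc 0) [euler_x, euler_y :: 'k::field cochain]"
  unfolding hh_basis_def
proof (intro conjI allI impI ballI)
  fix c :: "'k cochain" assume "c \<in> set [euler_x, euler_y]"
  moreover have "cocycle m n q (Suc 0) (euler_x :: 'k cochain)"
    unfolding v_weight0_cochain[of q] by (rule cocycle_weight0_cochain[OF q(1)]) (auto intro: window_supp_delta)
  moreover have "cocycle m n q (Suc 0) (euler_y :: 'k cochain)"
    unfolding w_weight0_cochain[of q] by (rule cocycle_weight0_cochain[OF q(1)]) (auto intro: window_supp_delta)
  ultimately show "cocycle m n q (Suc 0) c" by auto
next
  fix a :: "nat \<Rightarrow> 'k" and i
  assume f: "coboundary m n q (Suc 0) (lincomb a [euler_x, euler_y])"
  have "(1, 0) \<in> B" "(0, 1) \<in> B" using m2 n2 by (auto simp: bas_def)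
  from this[THEN coboundary_1_diagonal[OF q(1) f]] this have "a 0 = 0" "a (Suc 0) = 0"
    by (simp_all add: lincomb_def diag_cochain_def lessThan_Suc)
  moreover assume "i < length [euler_x, euler_y :: 'k cochain]"
  ultimately show "a i = 0" by (auto simp: less_Suc_eq)
next
  fix z assume "cocycle m n q (Suc 0) (z :: 'k cochain)"
  from cocycle_cohom_weight0_cochain[OF q this] obtain \<alpha> where
    \<alpha>: "cohom m n q (Suc 0) z (weight0_cochain q (Suc 0) (gen_sum 1 1 (Suc 0) \<alpha>))" by blast
  have "weight0_cochain q (Suc 0) (gen_sum 1 1 (Suc 0) \<alpha>) = lincomb (\<lambda>i. if i = 0 then \<alpha> 1 0 else \<alpha> 0 1) [euler_x, euler_y]"
    by (intro ext) (simp add: weight0_cochain_1 lincomb_def lessThan_Suc)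
  with \<alpha> show "\<exists>a. cohom m n q (Suc 0) z (lincomb a [euler_x, euler_y])" by auto
qed

lemma hh_basis_2:
  assumes q: "q \<noteq> 0" "\<forall>j::nat. j \<ge> 1 \<longrightarrow> q ^ j \<noteq> 1"
  shows "hh_basis m n q 2 [cup m n q (Suc 0) (Suc 0) euler_x euler_y :: 'k::field cochain]"
  unfolding hh_basis_def
proof (intro conjI allI impI ballI)
  fix c :: "'k cochain" assume "c \<in> set [cup m n q (Suc 0) (Suc 0) euler_x euler_y]"
  moreover have "cocycle m n q 2 (cup m n q (Suc 0) (Suc 0) euler_x euler_y :: 'k cochain)"
    unfolding vw_weight0_cochain[of q] by (rule cocycle_weight0_cochain[OF q(1)]) (auto intro: window_supp_delta)
  ultimately show "cocycle m n q 2 c" by auto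
next
  fix a :: "nat \<Rightarrow> 'k" and i
  assume f: "coboundary m n q 2 (lincomb a [cup m n q (Suc 0) (Suc 0) euler_x euler_y])"
  have x: "(1, 0) \<in> B" "(0, 1) \<in> B" "(1, 0) + (0, 1) \<in> B" using m2 n2 by (auto simp: bas_def)
  \<comment> \<open>On the letters \<open>x, y\<close> in this order the cup product is 1, in the
    other order 0; symmetry kills the coefficient.\<close>
  from coboundary_2_diagonal[OF q(1) f x] have "a 0 = 0"
    using q(1) x m2 n2 by (simp add: lincomb_def lessThan_Suc cup_diag_cochain wf_args_def mc_def)
  moreover assume "i < length [cup m n q (Suc 0) (Suc 0) euler_x euler_y :: 'k cochain]"
  ultimately show "a i = 0" by simp
next
  fix z assume "cocycle m n q 2 (z :: 'k cochain)"
  then have "cocycle m n q (Suc 1) z" by (simp add: numeral_2_eq_2)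
  from cocycle_cohom_weight0_cochain[OF q this] obtain \<alpha> where
    \<alpha>: "window_supp socle_deg \<alpha>" "cohom m n q 2 z (weight0_cochain q 2 (gen_sum 1 1 2 \<alpha>))" by (auto simp: numeral_2_eq_2)
  have "weight0_cochain q 2 (gen_sum 1 1 2 \<alpha>) = lincomb (\<lambda>i. \<alpha> 1 1) [cup m n q (Suc 0) (Suc 0) euler_x euler_y]"
    by (intro ext) (simp add: weight0_cochain_2[OF \<alpha>(1)] lincomb_def lessThan_Suc)
  with \<alpha> show "\<exists>a. cohom m n q 2 z (lincomb a [cup m n q (Suc 0) (Suc 0) euler_x euler_y])" by auto
qed

lemma hh_basis_ge_3:
  assumes q: "q \<noteq> 0" "\<forall>j::nat. j \<ge> 1 \<longrightarrow> q ^ j \<noteq> 1" and d: "3 \<le> d"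
  shows "hh_basis m n (q :: 'k::field) d []"
  unfolding hh_basis_def
proof (intro conjI allI impI ballI)
  fix z assume z: "cocycle m n q d (z :: 'k cochain)"
  obtain d' where d': "d = Suc d'" using d by (cases d) auto
  from cocycle_cohom_weight0_cochain[OF q, of d'] z obtain \<alpha> where
    \<alpha>: "window_supp socle_deg \<alpha>" "cohom m n q d z (weight0_cochain q d (gen_sum 1 1 d \<alpha>))" unfolding d' by blast
  have "weight0_cochain q d (gen_sum 1 1 d \<alpha>) = lincomb (\<lambda>i. 0) []"
    by (intro ext) (simp add: weight0_cochain_ge_3[OF \<alpha>(1) d] lincomb_def)
  with \<alpha> show "\<exists>a. cohom m n q d z (lincomb a [])" by auto
qed auto

section \<open>Cup products with the socle class, and the brackets\<close>

lemma cup_socle_socle: "cup m n q 0 0 (socle m n) (socle m n) = (zero_cochain :: 'k::field cochain)"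
proof (intro ext)
  fix as e
  have "mc m n q socle_deg socle_deg e = 0" by (simp add: mc_socle_deg socle_deg_nz)
  then show "cup m n q 0 0 (socle m n) (socle m n) as e = (zero_cochain as e :: 'k)"
    by (cases as) (simp_all add: cup_def zero_cochain_def wf_args_def mult.assoc sum_socle flip: sum_distrib_left)
qed

text \<open>Every monomial but \<open>1\<close> annihilates the socle, and at \<open>1\<close> the
  diagonal cochain vanishes by assumption.\<close>

lemma cup_socle_diag_cochain:
  assumes "c (0 :: nat \<times> nat) = 0"
  shows "cup m n q 0 (Suc 0) (socle m n) (diag_cochain m n c) = (zero_cochain :: 'k::field cochain)"
    and "cup m n q (Suc 0) 0 (diag_cochain m n c) (socle m n) = (zero_cochain :: 'k::field cochain)"
proof -
  have mc0: "c a * mc m n q socle_deg a e = 0" "c a * mc m n q a socle_deg e = 0" for a e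
    using assms by (auto simp: mc_socle_deg)
  have word_diff: "diag_cochain m n c as x * mc m n q socle_deg x e = 0" "diag_cochain m n c as x * mc m n q x socle_deg e = 0" for as x e
    using mc0 by (auto simp: diag_cochain_def)
  show "cup m n q 0 (Suc 0) (socle m n) (diag_cochain m n c) = zero_cochain"
    by (intro ext) (simp add: cup_def zero_cochain_def mult.assoc sum_socle word_diff flip: sum_distrib_left)
  show "cup m n q (Suc 0) 0 (diag_cochain m n c) (socle m n) = zero_cochain"
  proof (intro ext)
    fix as e
    have "(\<Sum>x\<in>B. \<Sum>y\<in>B. diag_cochain m n c (take (Suc 0) as) x * socle m n [] y * mc m n q x y e)
       = (\<Sum>x\<in>B. diag_cochain m n c (take (Suc 0) as) x * mc m n q x socle_deg e)"
      by (intro sum.cong refl) (simp add: mult.assoc sum_socle flip: sum_distrib_left)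
    then show "cup m n q (Suc 0) 0 (diag_cochain m n c) (socle m n) as e = zero_cochain as e"
      by (auto simp: cup_def zero_cochain_def word_diff wf_args_def)
  qed
qed

text \<open>A 1-cochain acts on an element by evaluation, and a diagonal one has the socle monomial
  as eigenvector. For the two Euler derivations the eigenvalues are \<open>m - 1\<close> and
  \<open>n - 1\<close>.\<close>

lemma gbracket_diag_cochain_socle:
  "gbracket m n (Suc 0) 0 (diag_cochain m n c) (socle m n) = smul_cochain (c socle_deg) (socle m n :: 'k::field cochain)"
proof (intro ext)
  fix as e
  show "gbracket m n (Suc 0) 0 (diag_cochain m n c) (socle m n) as e = smul_cochain (c socle_deg) (socle m n) as e"
  proof (cases "wf_args m n 0 as e")
    case True
    then have "as = []" "e \<in> B" by (auto simp: wf_args_def)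
    then have "gbracket m n (Suc 0) 0 (diag_cochain m n c) (socle m n) as e = diag_cochain m n c [socle_deg] e"
      by (simp add: gbracket_def gcirc_def circ_i_def sum_socle wf_args_def)
    then show ?thesis using \<open>as = []\<close> socle_deg_B
      by (simp add: diag_cochain_single smul_cochain_def one_socle_nil)
  next
    case False
    then show ?thesis using socle_deg_B
      by (auto simp: gbracket_def gcirc_def smul_cochain_def wf_args_def socle_def socle_deg_def)
  qed
qed

text \<open>The bracket of 1-cochains is the commutator of linear maps, and diagonal maps
  commute.\<close>

lemma gbracket_diag_cochain_diag_cochain:
  "gbracket m n (Suc 0) (Suc 0) (diag_cochain m n c) (diag_cochain m n c') = (zero_cochain :: 'k::field cochain)"
proof (intro ext)
  fix as e
  have gc: "gcirc m n (Suc 0) (Suc 0) (diag_cochain m n c) (diag_cochain m n c') as e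
     = (if wf_args m n (Suc 0) as e \<and> as = [e] then c' e * c e else 0)" for c c' :: "nat \<times> nat \<Rightarrow> 'k"
  proof (cases "wf_args m n (Suc 0) as e")
    case True
    then obtain a where as: "as = [a]" and a: "a \<in> B" by (auto simp: wf_args_def length_Suc_conv)
    have "(\<Sum>x\<in>B. diag_cochain m n c' [a] x * diag_cochain m n c [x] e) = (\<Sum>x\<in>B. if x = a then (if e = a then c' e * c e else 0) else 0)"
      by (rule sum.cong) (auto simp: diag_cochain_single)
    then show ?thesis using True a by (auto simp: gcirc_def circ_i_def as sum_delta_B)
  qed (simp add: gcirc_def)
  show "gbracket m n (Suc 0) (Suc 0) (diag_cochain m n c) (diag_cochain m n c') as e = zero_cochain as e"
    by (auto simp: gbracket_def zero_cochain_def gc)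
qed

end

theorem theorem6p1:
  fixes q :: "'k::field" and m n :: nat
  assumes "q \<noteq> 0" and "\<forall>j::nat. j \<ge> 1 \<longrightarrow> q ^ j \<noteq> 1"
    and "m \<ge> 2" and "n \<ge> 2"
  shows "\<exists>u v w :: 'k cochain.
     hh_basis m n q 0 [one_cochain, u]
   \<and> hh_basis m n q 1 [v, w]
   \<and> hh_basis m n q 2 [cup m n q 1 1 v w]
   \<and> (\<forall>d\<ge>3. hh_basis m n q d [])
   \<and> cohom m n q 0 (cup m n q 0 0 u u) zero_cochain
   \<and> cohom m n q 1 (cup m n q 0 1 u v) zero_cochain
   \<and> cohom m n q 1 (cup m n q 1 0 v u) zero_cochain
   \<and> cohom m n q 1 (cup m n q 0 1 u w) zero_cochain
   \<and> cohom m n q 1 (cup m n q 1 0 w u) zero_cochain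
   \<and> cohom m n q 2 (cup m n q 1 1 v v) zero_cochain
   \<and> cohom m n q 2 (cup m n q 1 1 w w) zero_cochain
   \<and> cohom m n q 2 (cup m n q 1 1 w v) (smul_cochain (-1) (cup m n q 1 1 v w))
   \<and> cohom m n q 0 (gbracket m n 1 0 v u) (smul_cochain (of_nat (m - 1)) u)
   \<and> cohom m n q 0 (gbracket m n 1 0 w u) (smul_cochain (of_nat (n - 1)) u)
   \<and> cohom m n q 1 (gbracket m n 1 1 v w) zero_cochain"
proof -
  interpret quantum_ci m n by unfold_locales (use assms in auto)
  show ?thesis
    unfolding One_nat_def
    by (rule exI[of _ "socle m n"], rule exI[of _ euler_x], rule exI[of _ euler_y], intro conjI allI impI)
      (use assms(1,2) in \<open>auto intro: hh_basis_0 hh_basis_1 hh_basis_2 hh_basis_ge_3 cup_square cup_wv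
        simp: cup_socle_socle cup_socle_diag_cochain gbracket_diag_cochain_socle gbracket_diag_cochain_diag_cochain cohom_eq socle_deg_def\<close>)
qed

end
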